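(* Let $A=\mathrm{FK}(3)$ be the Fomin–Kirillov algebra on $3$ generators over a field $\Bbbk$ of characteristic different from $2$ and $3$, let $P_\bullet$ be its minimal projective bimodule resolution and $X_1,\dots,X_{14}\in\operatorname{HH}^\bullet(A)$ the classes defined in the context. Let $\rho:A\to A$ be the derivation with $\rho(x)=\deg(x)x$ for $x$ in the basis $\mathcal{B}=\{1,a,b,c,ab,bc,ba,ac,aba,abc,bac,abac\}$. Then the maps $\rho_n:P_n\to P_n$, $n\in\mathbb{N}_0$, defined by $$\rho_n(\omega_ix|u|y)=(\deg(x)+\deg(y)+n+2i)\,\omega_ix|u|y$$ for $x,y\in\mathcal{B}$, $0\le i\le\lfloor n/4\rfloor$ and $u$ in the usual basis of $(A^!_{-(n-4i)})^*$, form a $\rho^e$-lifting of $\rho$ to $P_\bullet$. Moreover, the class of $\rho$ (i.e. of the cocycle $G(\rho)i_1$) in $\operatorname{HH}^1(A)$ is $-X_8$, and for every $\phi\in\operatorname{HH}^n(A)$ homogeneous of internal degree $\mathfrak{a}(\phi)$ one has $[X_8,\phi]=-\mathfrak{a}(\phi)\phi$. Hence $$[X_8,X_j]=\begin{cases}-2X_j,&j\in\{1,\dots,7\}\setminus\{3\},\\-4X_3,&j=3,\\0,&j=8,\\2X_j,&j\in\{9,\dots,13\},\\6X_{14},&j=14.\end{cases}$$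
   Context: The algebra. $\Bbbk$ is a field of characteristic $\neq2,3$. $A=\mathrm{FK}(3)$ is the $\Bbbk$-algebra generated by $a,b,c$ with relations $a^2=b^2=c^2=0$, $ab+bc+ca=0$, $ba+ac+cb=0$, graded with $a,b,c$ in (internal) degree $1$; $\mathcal{B}$ is a basis. Its quadratic dual is $A^!=\Bbbk\langle A,B,C\rangle/(BA-AC,CA-AB,AB-BC,CB-BA)$, where $\{A,B,C\}$ is the basis dual to $\{a,b,c\}$, in internal degree $-1$; $A^!_{-n}$ denotes the component of degree $-n$. $A^!_{-n}$ has basis $\{1\}$ for $n=0$, $\{A,B,C\}$ for $n=1$, and for $n\ge2$ the set $\{A^n,B^n,C^n,A^{n-1}B,A^{n-1}C,A^{n-2}B^2\}$ (for $n=2$ the element $A^0B^2=B^2$ is counted only once). The dual ("usual") basis of $(A^!_{-n})^*$ is denoted by $\epsilon^!$ for $n=0$; $\alpha,\beta,\gamma$ for $n=1$; $\alpha_2,\beta_2,\gamma_2,\alpha\beta,\alpha\gamma$ for $n=2$; and $\alpha_n,\beta_n,\gamma_n,\alpha_{n-1}\beta,\alpha_{n-1}\gamma,\alpha_{n-2}\beta_2$ for $n\ge3$ (index $1$ omitted), dual in this order to the listed monomials; $(A^!_{-n})^*$ has internal degree $n$. Vertical bars in elements denote tensor products over $\Bbbk$. The resolution. Let $K_n=A\otimes(A^!_{-n})^*\otimes A$ with Koszul differential $d_n:K_n\to K_{n-1}$ the $A$-bimodule map $$d_n(1|u|1)=\sum_{(x,X)\in\{(a,A),(b,B),(c,C)\}}\big((-1)^n\,x|u(X\,\cdot)|1+1|u(\cdot\,X)|x\big),$$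 where $u(X\,\cdot)$ and $u(\cdot\,X)$ are the functionals $w\mapsto u(Xw)$ and $w\mapsto u(wX)$ on $A^!_{-(n-1)}$. Put $p=\alpha\beta_2-2\alpha_3$, $q=\alpha_2\beta-2\beta_3$, $r=\alpha_2\gamma-2\gamma_3$. The minimal projective bimodule resolution of $A$ is $P_n=\bigoplus_{0\le i\le\lfloor n/4\rfloor}\omega_iK_{n-4i}$ ($\omega_i$ a symbol of homological degree $4i$ and internal degree $6i$), with differential $\delta_n\big(\sum_i\omega_i\rho_{n-4i}\big)=\sum_i\big(\omega_id_{n-4i}(\rho_{n-4i})+\omega_{i-1}f_{n-4i}(\rho_{n-4i})\big)$ (here $\rho_j\in K_j$), where $\omega_{-1}=0$, $f_0:K_0\to K_3$ is the bimodule map with $$\begin{aligned}f_0(1|\epsilon^!|1)={}&-1|p|bac-1|q|abc+1|r|aba+a|q|(ba+ac)-a|r|bc+b|p|(ab+bc)-b|r|ac-c|q|ab-c|p|ba\\&-bc|q|a+(ba+ac)|r|a+(ab+bc)|r|b-ac|p|b-ba|q|c-ab|p|c-bac|p|1-abc|q|1+aba|r|1,\end{aligned}$$ and $f_j:K_j\to K_{j+3}$, $j\ge1$, are fixed homogeneous bimodule morphisms (raising internal degree by $6$) making this a resolution, with augmentation $\epsilon^b:x|\epsilon^!|y\mapsto xy$ ($\omega_0$ is omitted from the notation). All $\delta_n$ are homogeneous of internal degree $0$; $\deg(x)+\deg(y)+n+2i$ is the internal degree of $\omega_ix|u|y$. The choice of $f_j$ for $j\geq 1$ does not affect the classes below.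 The classes. For a basis element $u$ of $(A^!_{-n})^*$ and $x\in A$, $u|x$ denotes the bimodule morphism $P_n\to A$ sending $1|u|1\mapsto x$, all other $1|u'|1$ ($u'$ a basis element of $(A^!_{-n})^*$) to $0$, and vanishing on $\omega_iK_{n-4i}$ for $i\ge1$; $\omega_1^*\epsilon^!|1$ denotes the morphism $P_4\to A$ vanishing on $K_4$ with $\omega_11|\epsilon^!|1\mapsto1$. The $X_i\in\operatorname{HH}^\bullet(A)\cong H^\bullet(\operatorname{Hom}_{A^e}(P_\bullet,A))$ are the classes of the cocycles: $X_1=\epsilon^!|(ab+ba)$, $X_2=\epsilon^!|(ab+bc-ac)$, $X_3=\epsilon^!|abac$ (degree $0$); $X_4=\alpha|bac$, $X_5=\beta|abc$, $X_6=\gamma|aba$, $X_7=\alpha|(aba-abc)$, $X_8=\alpha|a+\beta|b+\gamma|c$ (degree $1$); $X_9=\alpha_2|1$, $X_{10}=\beta_2|1$, $X_{11}=\gamma_2|1$, $X_{12}=(\alpha\beta+\alpha\gamma)|1$ (degree $2$); $X_{13}=\alpha_3|a+\beta_3|b+\gamma_3|c$ (degree $3$); $X_{14}=\omega_1^*\epsilon^!|1$ (degree $4$). Internal degree on $\operatorname{HH}^n(A)$ is the degree of homogeneous morphisms $P_n\to A$. $\rho^e$-liftings. For a derivation $\rho$ of $A$, $\rho^e=\rho\otimes\mathrm{id}+\mathrm{id}\otimes\rho$ is a derivation of $A^e$. A $\rho^e$-operator on an $A$-bimodule (left $A^e$-module) $M$ is a linear map $f:M\to M$ with $f(sm)=\rho^e(s)m+sf(m)$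 for $s\in A^e$, $m\in M$. A $\rho^e$-lifting of $\rho$ to $P_\bullet$ is a family of $\rho^e$-operators $\rho_n:P_n\to P_n$ with $\epsilon^b\rho_0=\rho\epsilon^b$ and $\delta_n\rho_n=\rho_{n-1}\delta_n$ for $n\ge1$. Bracket. The Gerstenhaber bracket is, for $f\in\operatorname{Hom}_\Bbbk(A^{\otimes m},A)$, $g\in\operatorname{Hom}_\Bbbk(A^{\otimes n},A)$, $[f,g]=f\circ_Gg-(-1)^{(m-1)(n-1)}g\circ_Gf$ with $(f\circ_Gg)(a_1|\dots|a_{m+n-1})=\sum_{i=1}^m(-1)^{(n-1)(i-1)}f(a_1|\dots|a_{i-1}|g(a_i|\dots|a_{i+n-1})|a_{i+n}|\dots|a_{m+n-1})$ (and $f\circ_Gg=0$ if $m=0$; $g(1)$ is inserted if $n=0$). Here $\operatorname{Hom}_\Bbbk(A^{\otimes n},A)$ is identified with $\operatorname{Hom}_{A^e}(B_n(A),A)$, $B_n(A)=A^{\otimes(n+2)}$ the bar resolution with differential $\sum_j(-1)^ja_0|\dots|a_ja_{j+1}|\dots|a_{n+1}$, via $G(g)(a_0|\dots|a_{n+1})=a_0g(a_1|\dots|a_n)a_{n+1}$, and cohomology is transported to $H^\bullet(\operatorname{Hom}_{A^e}(P_\bullet,A))$ by composing with a morphism $i_\bullet:P_\bullet\to B_\bullet(A)$ of bimodule complexes lifting $\mathrm{id}_A$, chosen with $i_0(1|\epsilon^!|1)=1|1$, $i_1(1|\alpha|1)=-1|a|1$, $i_1(1|\beta|1)=-1|b|1$,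 $i_1(1|\gamma|1)=-1|c|1$. *)

theory Defs
  imports Complex_Main "HOL-Library.Poly_Mapping"
begin

section \<open>Free modules and free algebras\<close>

text \<open>\<open>'g \<Rightarrow>\<^sub>0 'k\<close> is the free \<open>'k\<close>-vector space on \<open>'g\<close>.\<close>

definition pm_scale :: "'k::field \<Rightarrow> ('g \<Rightarrow>\<^sub>0 'k) \<Rightarrow> ('g \<Rightarrow>\<^sub>0 'k)"
  where "pm_scale c p = Poly_Mapping.map ((*) c) p"

lemma lookup_pm_scale [simp]:
  "Poly_Mapping.lookup (pm_scale c p) g = c * Poly_Mapping.lookup p g"
  unfolding pm_scale_def by transfer (auto simp: when_def)

lemma pm_scale_single [simp]:
  "pm_scale c (Poly_Mapping.single g d) = Poly_Mapping.single g (c * d)"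
  by (rule poly_mapping_eqI) (auto simp: lookup_single when_def)

global_interpretation pm: vector_space "pm_scale :: 'k::field \<Rightarrow> ('g \<Rightarrow>\<^sub>0 'k) \<Rightarrow> ('g \<Rightarrow>\<^sub>0 'k)"
  by unfold_locales (auto intro!: poly_mapping_eqI simp: lookup_add algebra_simps)

text \<open>The linear extension of \<open>\<phi> :: 'g \<Rightarrow> 'v\<close>, where \<open>sc\<close> is the scalar multiplication of \<open>'v\<close>.\<close>

definition pm_ext ::
    "('k::field \<Rightarrow> 'v::ab_group_add \<Rightarrow> 'v) \<Rightarrow> ('g \<Rightarrow> 'v) \<Rightarrow> ('g \<Rightarrow>\<^sub>0 'k) \<Rightarrow> 'v"
  where "pm_ext sc \<phi> p = (\<Sum>g\<in>Poly_Mapping.keys p. sc (Poly_Mapping.lookup p g) (\<phi> g))"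

lemma pm_ext_superset:
  assumes "vector_space sc" "finite S" "Poly_Mapping.keys p \<subseteq> S"
  shows "pm_ext sc \<phi> p = (\<Sum>g\<in>S. sc (Poly_Mapping.lookup p g) (\<phi> g))"
proof -
  interpret vector_space sc by fact
  show ?thesis
    unfolding pm_ext_def
    by (rule sum.mono_neutral_left) (use assms in \<open>auto simp: in_keys_iff\<close>)
qed

lemma linear_pm_ext:
  assumes "vector_space sc"
  shows "Vector_Spaces.linear pm_scale sc (pm_ext sc \<phi>)"
proof -
  interpret v: vector_space sc by fact
  have "pm_ext sc \<phi> (p + q) = pm_ext sc \<phi> p + pm_ext sc \<phi> q" for p q
  proof -
    let ?S = "Poly_Mapping.keys p \<union> Poly_Mapping.keys q"
    show ?thesis
      using Poly_Mapping.keys_add [of p q]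
      by (simp add: pm_ext_superset [OF assms, of ?S] lookup_add v.scale_left_distrib sum.distrib)
  qed
  moreover have "pm_ext sc \<phi> (pm_scale c p) = sc c (pm_ext sc \<phi> p)" for c p
  proof -
    have "Poly_Mapping.keys (pm_scale c p) \<subseteq> Poly_Mapping.keys p"
      by (auto simp: in_keys_iff)
    then show ?thesis
      by (simp add: pm_ext_superset [OF assms, of "Poly_Mapping.keys p"] v.scale_sum_right)
  qed
  ultimately show ?thesis
    by unfold_locales auto
qed

lemma pm_ext_single [simp]:
  assumes "vector_space sc"
  shows "pm_ext sc \<phi> (Poly_Mapping.single g c) = sc c (\<phi> g)"
proof -
  interpret vector_space sc by fact
  show ?thesis
    by (simp add: pm_ext_superset [OF assms, of "{g}"])
qed

text \<open>
  Words form a monoid under concatenation, so \<open>letter list \<Rightarrow>\<^sub>0 'k\<close> with the convolution product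
  of \<^theory>\<open>HOL-Library.Poly_Mapping\<close> is the free associative algebra on three generators.  The
  letters \<open>La\<close>, \<open>Lb\<close>, \<open>Lc\<close> stand for \<open>a\<close>, \<open>b\<close>, \<open>c\<close> in \<open>FK(3)\<close> and for the dual generators
  \<open>A\<close>, \<open>B\<close>, \<open>C\<close> in its quadratic dual.
\<close>

datatype letter = La | Lb | Lc

instantiation list :: (type) monoid_add
begin
definition zero_list :: "'a list" where "zero_list = []"
definition plus_list :: "'a list \<Rightarrow> 'a list \<Rightarrow> 'a list" where "plus_list = (@)"
instance by standard (auto simp: zero_list_def plus_list_def)
end

type_synonym 'k free_alg = "letter list \<Rightarrow>\<^sub>0 'k"

abbreviation word :: "letter list \<Rightarrow> 'k::field free_alg"
  where "word w \<equiv> Poly_Mapping.single w 1"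

definition two_sided_ideal :: "'r::ring_1 set \<Rightarrow> bool"
  where "two_sided_ideal I \<longleftrightarrow>
    0 \<in> I \<and> (\<forall>x\<in>I. \<forall>y\<in>I. x + y \<in> I) \<and> (\<forall>x\<in>I. \<forall>r. r * x \<in> I \<and> x * r \<in> I)"

definition ideal_generated :: "'r::ring_1 set \<Rightarrow> 'r set"
  where "ideal_generated R = \<Inter>{I. two_sided_ideal I \<and> R \<subseteq> I}"

lemma two_sided_ideal_generated: "two_sided_ideal (ideal_generated R)"
  unfolding ideal_generated_def two_sided_ideal_def by blast

lemma ideal_generated_least: "two_sided_ideal I \<Longrightarrow> R \<subseteq> I \<Longrightarrow> ideal_generated R \<subseteq> I"
  unfolding ideal_generated_def by blast

lemma ideal_generated_superset: "R \<subseteq> ideal_generated R"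
  unfolding ideal_generated_def by blast

lemma
  shows ideal_generated_zero: "0 \<in> ideal_generated R"
    and ideal_generated_add: "x \<in> ideal_generated R \<Longrightarrow> y \<in> ideal_generated R \<Longrightarrow> x + y \<in> ideal_generated R"
    and ideal_generated_mult_left: "x \<in> ideal_generated R \<Longrightarrow> r * x \<in> ideal_generated R"
    and ideal_generated_mult_right: "x \<in> ideal_generated R \<Longrightarrow> x * r \<in> ideal_generated R"
  using two_sided_ideal_generated [of R] unfolding two_sided_ideal_def by blast+

lemma ideal_generated_uminus: "x \<in> ideal_generated R \<Longrightarrow> - x \<in> ideal_generated R"
  using ideal_generated_mult_left [of x R "- 1"] by simp

lemma equivp_ideal_generated: "equivp (\<lambda>p q. p - q \<in> ideal_generated R)"
proof (rule equivpI)
  show "reflp (\<lambda>p q. p - q \<in> ideal_generated R)"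
    by (simp add: reflp_def ideal_generated_zero)
  show "symp (\<lambda>p q. p - q \<in> ideal_generated R)"
    using ideal_generated_uminus by (fastforce simp: symp_def)
  show "transp (\<lambda>p q. p - q \<in> ideal_generated R)"
    using ideal_generated_add by (fastforce simp: transp_def)
qed

lemma ideal_generated_mult_cong:
  assumes "p - q \<in> ideal_generated R" "p' - q' \<in> ideal_generated R"
  shows "p * p' - q * q' \<in> ideal_generated R"
proof -
  have "p * p' - q * q' = (p - q) * p' + q * (p' - q')"
    by (simp add: algebra_simps)
  then show ?thesis
    using assms by (simp add: ideal_generated_add ideal_generated_mult_left ideal_generated_mult_right)
qed

lemma pm_scale_conv_mult: "pm_scale c p = Poly_Mapping.single [] c * p" for p :: "'k::field free_alg"
  unfolding pm_scale_def by (simp add: mult_map_scale_conv_mult zero_list_def)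

text \<open>An ideal generated by elements without constant term is proper.\<close>

lemma lookup_mult_Nil:
  "Poly_Mapping.lookup (p * q) [] = Poly_Mapping.lookup p [] * Poly_Mapping.lookup q []"
  for p q :: "'k::field free_alg"
proof -
  have *: "(\<Sum>v. Poly_Mapping.lookup q v when [] = u + v) = (Poly_Mapping.lookup q [] when u = [])" for u
  proof (cases "u = []")
    case True
    then have "(\<lambda>v. Poly_Mapping.lookup q v when [] = u + v) = (\<lambda>v. Poly_Mapping.lookup q v when v = [])"
      by (auto simp: plus_list_def fun_eq_iff when_def)
    then have "(\<Sum>v. Poly_Mapping.lookup q v when [] = u + v) = Poly_Mapping.lookup q []"
      by (simp only: Sum_any_when_equal)
    then show ?thesis using True by simp
  next
    case False
    then show ?thesis by (simp add: plus_list_def)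
  qed
  show ?thesis
    by (simp add: lookup_mult * mult_when)
qed

lemma one_notin_ideal_generated:
  assumes "\<And>r. r \<in> R \<Longrightarrow> Poly_Mapping.lookup r [] = 0"
  shows "(1 :: 'k::field free_alg) \<notin> ideal_generated R"
proof -
  have "ideal_generated R \<subseteq> {p. Poly_Mapping.lookup p [] = 0}"
    by (rule ideal_generated_least)
      (use assms in \<open>auto simp: two_sided_ideal_def lookup_add lookup_mult_Nil\<close>)
  moreover have "Poly_Mapping.lookup (1 :: 'k free_alg) [] = 1"
    by (metis lookup_one_zero zero_list_def)
  ultimately show ?thesis by auto
qed


section \<open>The algebra \<open>FK(3)\<close>\<close>

definition fk_rels :: "'k::field free_alg set"
  where "fk_rels =
    {word [La, La], word [Lb, Lb], word [Lc, Lc],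
     word [La, Lb] + word [Lb, Lc] + word [Lc, La],
     word [Lb, La] + word [La, Lc] + word [Lc, Lb]}"

quotient_type (overloaded) 'k fk = "'k::field free_alg" /
  "\<lambda>p q. p - q \<in> ideal_generated fk_rels"
  by (rule equivp_ideal_generated)

instantiation fk :: (field) ring_1
begin

lift_definition zero_fk :: "'a fk" is 0 .
lift_definition one_fk :: "'a fk" is 1 .
lift_definition plus_fk :: "'a fk \<Rightarrow> 'a fk \<Rightarrow> 'a fk" is "(+)"
  by (metis add_diff_add ideal_generated_add)
lift_definition uminus_fk :: "'a fk \<Rightarrow> 'a fk" is uminus
  by (metis ideal_generated_uminus minus_diff_minus)
lift_definition minus_fk :: "'a fk \<Rightarrow> 'a fk \<Rightarrow> 'a fk" is "(-)"
proof -
  fix p q p' q' :: "'a free_alg"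
  assume "p - q \<in> ideal_generated fk_rels" "p' - q' \<in> ideal_generated fk_rels"
  then have "(p - q) + - (p' - q') \<in> ideal_generated fk_rels"
    by (intro ideal_generated_add ideal_generated_uminus)
  then show "p - p' - (q - q') \<in> ideal_generated fk_rels"
    by (simp add: algebra_simps)
qed
lift_definition times_fk :: "'a fk \<Rightarrow> 'a fk \<Rightarrow> 'a fk" is "(*)"
  by (rule ideal_generated_mult_cong)

instance
proof
  show "(0 :: 'a fk) \<noteq> 1"
  proof transfer
    have "(1 :: 'a free_alg) \<notin> ideal_generated fk_rels"
      by (rule one_notin_ideal_generated) (auto simp: fk_rels_def lookup_add lookup_single)
    then show "(0 :: 'a free_alg) - 1 \<notin> ideal_generated fk_rels"
      using ideal_generated_uminus by fastforce
  qed
qed (transfer; simp add: algebra_simps ideal_generated_zero)+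

end

lift_definition fk_scale :: "'k::field \<Rightarrow> 'k fk \<Rightarrow> 'k fk" is pm_scale
  by (simp add: pm_scale_conv_mult flip: right_diff_distrib) (rule ideal_generated_mult_left)

lift_definition fk_mon :: "letter list \<Rightarrow> 'k::field fk" is word .

global_interpretation fk: vector_space "fk_scale :: 'k::field \<Rightarrow> 'k fk \<Rightarrow> 'k fk"
  by unfold_locales
    (transfer; simp add: pm.scale_right_distrib pm.scale_left_distrib ideal_generated_zero)+

text \<open>The basis \<open>\<B>\<close>, as a set of words; \<^term>\<open>length\<close> is the degree.\<close>

definition fk_basis :: "letter list set"
  where "fk_basis =
    {[], [La], [Lb], [Lc], [La, Lb], [Lb, Lc], [Lb, La], [La, Lc],
     [La, Lb, La], [La, Lb, Lc], [Lb, La, Lc], [La, Lb, La, Lc]}"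

definition fk_deg :: "int \<Rightarrow> 'k::field fk set"
  where "fk_deg N = fk.span {fk_mon w | w. int (length w) = N}"

definition fk_derivation :: "('k::field fk \<Rightarrow> 'k fk) \<Rightarrow> bool"
  where "fk_derivation \<rho> \<longleftrightarrow>
    Vector_Spaces.linear fk_scale fk_scale \<rho> \<and> (\<forall>x y. \<rho> (x * y) = \<rho> x * y + x * \<rho> y)"


section \<open>The quadratic dual\<close>

definition fkd_rels :: "'k::field free_alg set"
  where "fkd_rels =
    {word [Lb, La] - word [La, Lc], word [Lc, La] - word [La, Lb],
     word [La, Lb] - word [Lb, Lc], word [Lc, Lb] - word [Lb, La]}"

quotient_type (overloaded) 'k fkd = "'k::field free_alg" /
  "\<lambda>p q. p - q \<in> ideal_generated fkd_rels"
  by (rule equivp_ideal_generated)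

instantiation fkd :: (field) ring_1
begin

lift_definition zero_fkd :: "'a fkd" is 0 .
lift_definition one_fkd :: "'a fkd" is 1 .
lift_definition plus_fkd :: "'a fkd \<Rightarrow> 'a fkd \<Rightarrow> 'a fkd" is "(+)"
  by (metis add_diff_add ideal_generated_add)
lift_definition uminus_fkd :: "'a fkd \<Rightarrow> 'a fkd" is uminus
  by (metis ideal_generated_uminus minus_diff_minus)
lift_definition minus_fkd :: "'a fkd \<Rightarrow> 'a fkd \<Rightarrow> 'a fkd" is "(-)"
proof -
  fix p q p' q' :: "'a free_alg"
  assume "p - q \<in> ideal_generated fkd_rels" "p' - q' \<in> ideal_generated fkd_rels"
  then have "(p - q) + - (p' - q') \<in> ideal_generated fkd_rels"
    by (intro ideal_generated_add ideal_generated_uminus)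
  then show "p - p' - (q - q') \<in> ideal_generated fkd_rels"
    by (simp add: algebra_simps)
qed
lift_definition times_fkd :: "'a fkd \<Rightarrow> 'a fkd \<Rightarrow> 'a fkd" is "(*)"
  by (rule ideal_generated_mult_cong)

instance
proof
  show "(0 :: 'a fkd) \<noteq> 1"
  proof transfer
    have "(1 :: 'a free_alg) \<notin> ideal_generated fkd_rels"
      by (rule one_notin_ideal_generated) (auto simp: fkd_rels_def lookup_minus lookup_single)
    then show "(0 :: 'a free_alg) - 1 \<notin> ideal_generated fkd_rels"
      using ideal_generated_uminus by fastforce
  qed
qed (transfer; simp add: algebra_simps ideal_generated_zero)+

end

lift_definition fkd_scale :: "'k::field \<Rightarrow> 'k fkd \<Rightarrow> 'k fkd" is pm_scale
  by (simp add: pm_scale_conv_mult flip: right_diff_distrib) (rule ideal_generated_mult_left)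

lift_definition fkd_mon :: "letter list \<Rightarrow> 'k::field fkd" is word .

global_interpretation fkd: vector_space "fkd_scale :: 'k::field \<Rightarrow> 'k fkd \<Rightarrow> 'k fkd"
  by unfold_locales
    (transfer; simp add: pm.scale_right_distrib pm.scale_left_distrib ideal_generated_zero)+

text \<open>Words of the usual basis of the component of degree \<open>-n\<close>.\<close>

definition fkd_basis :: "nat \<Rightarrow> letter list set"
  where "fkd_basis n =
    (if n = 0 then {[]} else if n = 1 then {[La], [Lb], [Lc]}
     else {replicate n La, replicate n Lb, replicate n Lc,
           replicate (n - 1) La @ [Lb], replicate (n - 1) La @ [Lc],
           replicate (n - 2) La @ [Lb, Lb]})"

text \<open>
  The dual of the component of degree \<open>-n\<close>, as the space of those functionals on the whole algebra
  that vanish on all other components.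
\<close>

definition fkd_dual :: "nat \<Rightarrow> ('k::field fkd \<Rightarrow> 'k) set"
  where "fkd_dual n =
    {u. Vector_Spaces.linear fkd_scale (*) u \<and> (\<forall>w. length w \<noteq> n \<longrightarrow> u (fkd_mon w) = 0)}"

text \<open>The element of the usual dual basis that is dual to the monomial \<open>w\<close>.\<close>

definition dual_mon :: "letter list \<Rightarrow> 'k::field fkd \<Rightarrow> 'k"
  where "dual_mon w v = fkd.representation (fkd_mon ` (\<Union>n. fkd_basis n)) v (fkd_mon w)"


section \<open>Tensor products\<close>

text \<open>
  The quotient of a free vector space by the span of \<open>R\<close>.  Maps out of such a quotient are
  given as linear extensions applied to an arbitrary representative.
\<close>

lemma equivp_pm_span: "equivp (\<lambda>p q. p - q \<in> pm.span R)"
proof (rule equivpI)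
  show "reflp (\<lambda>p q. p - q \<in> pm.span R)"
    by (simp add: reflp_def pm.span_zero)
  show "symp (\<lambda>p q. p - q \<in> pm.span R)"
    using pm.span_neg by (fastforce simp: symp_def)
  show "transp (\<lambda>p q. p - q \<in> pm.span R)"
    using pm.span_add by (fastforce simp: transp_def)
qed

lemma pm_ext_span_cong:
  assumes "vector_space sc" "\<And>r. r \<in> R \<Longrightarrow> pm_ext sc \<phi> r = 0" "p - q \<in> pm.span R"
  shows "pm_ext sc \<phi> p = pm_ext sc \<phi> q"
proof -
  interpret Vector_Spaces.linear pm_scale sc "pm_ext sc \<phi>"
    using assms(1) by (rule linear_pm_ext)
  have "pm_ext sc \<phi> (p - q) = 0"
    using assms(2,3) eq_0_on_span by blast
  then show ?thesis by (simp add: diff)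
qed


subsection \<open>Tensor powers of \<open>FK(3)\<close>\<close>

text \<open>\<open>'k ten\<close> is the direct sum of all tensor powers of \<open>'k fk\<close> over the field \<open>'k\<close>.\<close>

definition ten_rels :: "('k::field fk list \<Rightarrow>\<^sub>0 'k) set"
  where "ten_rels =
    {Poly_Mapping.single (xs @ [x + y] @ ys) 1
       - Poly_Mapping.single (xs @ [x] @ ys) 1 - Poly_Mapping.single (xs @ [y] @ ys) 1 | xs x y ys. True}
    \<union> {Poly_Mapping.single (xs @ [fk_scale c x] @ ys) 1 - Poly_Mapping.single (xs @ [x] @ ys) c
       | xs c x ys. True}"

quotient_type (overloaded) 'k ten = "'k::field fk list \<Rightarrow>\<^sub>0 'k" / "\<lambda>p q. p - q \<in> pm.span ten_rels"
  by (rule equivp_pm_span)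

instantiation ten :: (field) ab_group_add
begin

lift_definition zero_ten :: "'a ten" is 0 .
lift_definition plus_ten :: "'a ten \<Rightarrow> 'a ten \<Rightarrow> 'a ten" is "(+)"
  by (metis add_diff_add pm.span_add)
lift_definition uminus_ten :: "'a ten \<Rightarrow> 'a ten" is uminus
  by (metis pm.span_neg minus_diff_minus)
lift_definition minus_ten :: "'a ten \<Rightarrow> 'a ten \<Rightarrow> 'a ten" is "(-)"
proof -
  fix p q p' q' :: "'a fk list \<Rightarrow>\<^sub>0 'a"
  assume "p - q \<in> pm.span ten_rels" "p' - q' \<in> pm.span ten_rels"
  then have "(p - q) - (p' - q') \<in> pm.span ten_rels"
    by (rule pm.span_diff)
  then show "p - p' - (q - q') \<in> pm.span ten_rels"
    by (simp add: algebra_simps)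
qed

instance
  by standard (transfer; simp add: algebra_simps pm.span_zero)+

end

lift_definition ten_scale :: "'k::field \<Rightarrow> 'k ten \<Rightarrow> 'k ten" is pm_scale
  by (metis pm.scale_right_diff_distrib pm.span_scale)

text \<open>\<open>tens [x\<^sub>1, \<dots>, x\<^sub>n]\<close> is \<open>x\<^sub>1| \<dots> |x\<^sub>n\<close>.\<close>

definition tens :: "'k::field fk list \<Rightarrow> 'k ten"
  where "tens xs = abs_ten (Poly_Mapping.single xs 1)"

global_interpretation ten: vector_space "ten_scale :: 'k::field \<Rightarrow> 'k ten \<Rightarrow> 'k ten"
  by unfold_locales
    (transfer; simp add: pm.scale_right_distrib pm.scale_left_distrib pm.span_zero)+

definition ten_power :: "nat \<Rightarrow> 'k::field ten set"
  where "ten_power n = ten.span {tens xs | xs. length xs = n}"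

definition multilinear ::
    "nat \<Rightarrow> ('k::field \<Rightarrow> 'v::ab_group_add \<Rightarrow> 'v) \<Rightarrow> ('k fk list \<Rightarrow> 'v) \<Rightarrow> bool"
  where "multilinear n sc \<phi> \<longleftrightarrow>
    (\<forall>xs ys. length xs + 1 + length ys = n \<longrightarrow>
      (\<forall>x y. \<phi> (xs @ [x + y] @ ys) = \<phi> (xs @ [x] @ ys) + \<phi> (xs @ [y] @ ys)) \<and>
      (\<forall>c x. \<phi> (xs @ [fk_scale c x] @ ys) = sc c (\<phi> (xs @ [x] @ ys))))"

text \<open>
  The linear map on the \<open>n\<close>-th tensor power induced by an \<open>n\<close>-multilinear \<open>\<phi>\<close>, extended by \<open>0\<close> to
  the other tensor powers.
\<close>

definition ten_lift ::
    "nat \<Rightarrow> ('k::field \<Rightarrow> 'v::ab_group_add \<Rightarrow> 'v) \<Rightarrow> ('k fk list \<Rightarrow> 'v) \<Rightarrow> 'k ten \<Rightarrow> 'v"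
  where "ten_lift n sc \<phi> t = pm_ext sc (\<lambda>xs. if length xs = n then \<phi> xs else 0) (rep_ten t)"

lemma
  assumes "vector_space sc" "multilinear n sc \<phi>"
  shows linear_ten_lift: "Vector_Spaces.linear ten_scale sc (ten_lift n sc \<phi>)"
    and ten_lift_tens: "ten_lift n sc \<phi> (tens xs) = (if length xs = n then \<phi> xs else 0)"
proof -
  let ?\<psi> = "\<lambda>xs. if length xs = n then \<phi> xs else 0"
  interpret v: vector_space sc by fact
  interpret l: Vector_Spaces.linear pm_scale sc "pm_ext sc ?\<psi>"
    using assms(1) by (rule linear_pm_ext)
  have rels: "pm_ext sc ?\<psi> r = 0" if "r \<in> ten_rels" for r
    using that assms(2) unfolding ten_rels_def multilinear_def
    by (auto simp: l.diff pm_ext_single [OF assms(1)])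
  have rep: "rep_ten (abs_ten p) - p \<in> pm.span ten_rels" for p :: "'a fk list \<Rightarrow>\<^sub>0 'a"
    using rep_abs_rsp_left [OF Quotient3_ten, of p p] pm.span_zero by auto
  have lift: "ten_lift n sc \<phi> (abs_ten p) = pm_ext sc ?\<psi> p" for p
    unfolding ten_lift_def by (rule pm_ext_span_cong [OF assms(1) rels rep])
  have add: "ten_lift n sc \<phi> (s + t) = ten_lift n sc \<phi> s + ten_lift n sc \<phi> t" for s t
    by (induct s, induct t) (simp add: lift plus_ten.abs_eq l.add)
  have scale: "ten_lift n sc \<phi> (ten_scale c t) = sc c (ten_lift n sc \<phi> t)" for c t
    by (induct t) (simp add: lift ten_scale.abs_eq l.scale)
  show "Vector_Spaces.linear ten_scale sc (ten_lift n sc \<phi>)"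
    by unfold_locales (simp_all add: add scale)
  show "ten_lift n sc \<phi> (tens xs) = ?\<psi> xs"
    by (simp add: tens_def lift pm_ext_single [OF assms(1)])
qed


subsection \<open>The Koszul bimodules\<close>

text \<open>
  \<open>'k kos\<close> is \<open>A \<otimes> F \<otimes> A\<close> for \<open>A = 'k fk\<close> and the space \<open>F\<close> of all functions
  \<open>'k fkd \<Rightarrow> 'k\<close>.  It contains \<open>A \<otimes> (A\<^sup>!\<^sub>-\<^sub>n)\<^sup>* \<otimes> A\<close> for every \<open>n\<close>.
\<close>

definition kos_rels :: "('k::field fk \<times> ('k fkd \<Rightarrow> 'k) \<times> 'k fk \<Rightarrow>\<^sub>0 'k) set"
  where "kos_rels =
    {Poly_Mapping.single (x + x', u, y) 1 - Poly_Mapping.single (x, u, y) 1 - Poly_Mapping.single (x', u, y) 1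
       | x x' u y. True}
    \<union> {Poly_Mapping.single (x, \<lambda>v. u v + u' v, y) 1
         - Poly_Mapping.single (x, u, y) 1 - Poly_Mapping.single (x, u', y) 1 | x u u' y. True}
    \<union> {Poly_Mapping.single (x, u, y + y') 1 - Poly_Mapping.single (x, u, y) 1 - Poly_Mapping.single (x, u, y') 1
       | x u y y'. True}
    \<union> {Poly_Mapping.single (fk_scale c x, u, y) 1 - Poly_Mapping.single (x, u, y) c | c x u y. True}
    \<union> {Poly_Mapping.single (x, \<lambda>v. c * u v, y) 1 - Poly_Mapping.single (x, u, y) c | c x u y. True}
    \<union> {Poly_Mapping.single (x, u, fk_scale c y) 1 - Poly_Mapping.single (x, u, y) c | c x u y. True}"

quotient_type (overloaded) 'k kos = "'k::field fk \<times> ('k fkd \<Rightarrow> 'k) \<times> 'k fk \<Rightarrow>\<^sub>0 'k" /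
  "\<lambda>p q. p - q \<in> pm.span kos_rels"
  by (rule equivp_pm_span)

instantiation kos :: (field) ab_group_add
begin

lift_definition zero_kos :: "'a kos" is 0 .
lift_definition plus_kos :: "'a kos \<Rightarrow> 'a kos \<Rightarrow> 'a kos" is "(+)"
  by (metis add_diff_add pm.span_add)
lift_definition uminus_kos :: "'a kos \<Rightarrow> 'a kos" is uminus
  by (metis pm.span_neg minus_diff_minus)
lift_definition minus_kos :: "'a kos \<Rightarrow> 'a kos \<Rightarrow> 'a kos" is "(-)"
proof -
  fix p q p' q' :: "'a fk \<times> ('a fkd \<Rightarrow> 'a) \<times> 'a fk \<Rightarrow>\<^sub>0 'a"
  assume "p - q \<in> pm.span kos_rels" "p' - q' \<in> pm.span kos_rels"
  then have "(p - q) - (p' - q') \<in> pm.span kos_rels"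
    by (rule pm.span_diff)
  then show "p - p' - (q - q') \<in> pm.span kos_rels"
    by (simp add: algebra_simps)
qed

instance
  by standard (transfer; simp add: algebra_simps pm.span_zero)+

end

lift_definition kos_scale :: "'k::field \<Rightarrow> 'k kos \<Rightarrow> 'k kos" is pm_scale
  by (metis pm.scale_right_diff_distrib pm.span_scale)

text \<open>\<open>kos x u y\<close> is \<open>x|u|y\<close>.\<close>

definition kos :: "'k::field fk \<Rightarrow> ('k fkd \<Rightarrow> 'k) \<Rightarrow> 'k fk \<Rightarrow> 'k kos"
  where "kos x u y = abs_kos (Poly_Mapping.single (x, u, y) 1)"

global_interpretation kos: vector_space "kos_scale :: 'k::field \<Rightarrow> 'k kos \<Rightarrow> 'k kos"
  by unfold_locales
    (transfer; simp add: pm.scale_right_distrib pm.scale_left_distrib pm.span_zero)+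

definition trilinear ::
    "('k::field \<Rightarrow> 'v::ab_group_add \<Rightarrow> 'v) \<Rightarrow> ('k fk \<Rightarrow> ('k fkd \<Rightarrow> 'k) \<Rightarrow> 'k fk \<Rightarrow> 'v) \<Rightarrow> bool"
  where "trilinear sc \<phi> \<longleftrightarrow>
    (\<forall>x x' u y. \<phi> (x + x') u y = \<phi> x u y + \<phi> x' u y) \<and>
    (\<forall>x u u' y. \<phi> x (\<lambda>v. u v + u' v) y = \<phi> x u y + \<phi> x u' y) \<and>
    (\<forall>x u y y'. \<phi> x u (y + y') = \<phi> x u y + \<phi> x u y') \<and>
    (\<forall>c x u y. \<phi> (fk_scale c x) u y = sc c (\<phi> x u y)) \<and>
    (\<forall>c x u y. \<phi> x (\<lambda>v. c * u v) y = sc c (\<phi> x u y)) \<and>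
    (\<forall>c x u y. \<phi> x u (fk_scale c y) = sc c (\<phi> x u y))"

text \<open>The linear map induced by a trilinear \<open>\<phi>\<close>.\<close>

definition kos_lift ::
    "('k::field \<Rightarrow> 'v::ab_group_add \<Rightarrow> 'v) \<Rightarrow> ('k fk \<Rightarrow> ('k fkd \<Rightarrow> 'k) \<Rightarrow> 'k fk \<Rightarrow> 'v) \<Rightarrow> 'k kos \<Rightarrow> 'v"
  where "kos_lift sc \<phi> t = pm_ext sc (\<lambda>(x, u, y). \<phi> x u y) (rep_kos t)"

lemma
  assumes "vector_space sc" "trilinear sc \<phi>"
  shows linear_kos_lift: "Vector_Spaces.linear kos_scale sc (kos_lift sc \<phi>)"
    and kos_lift_kos: "kos_lift sc \<phi> (kos x u y) = \<phi> x u y"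
proof -
  let ?\<psi> = "\<lambda>(x, u, y). \<phi> x u y"
  interpret v: vector_space sc by fact
  interpret l: Vector_Spaces.linear pm_scale sc "pm_ext sc ?\<psi>"
    using assms(1) by (rule linear_pm_ext)
  have rels: "pm_ext sc ?\<psi> r = 0" if "r \<in> kos_rels" for r
    using that assms(2) unfolding kos_rels_def trilinear_def
    by (auto simp: l.diff pm_ext_single [OF assms(1)])
  have rep: "rep_kos (abs_kos p) - p \<in> pm.span kos_rels"
    for p :: "'a fk \<times> ('a fkd \<Rightarrow> 'a) \<times> 'a fk \<Rightarrow>\<^sub>0 'a"
    using rep_abs_rsp_left [OF Quotient3_kos, of p p] pm.span_zero by auto
  have lift: "kos_lift sc \<phi> (abs_kos p) = pm_ext sc ?\<psi> p" for p
    unfolding kos_lift_def by (rule pm_ext_span_cong [OF assms(1) rels rep])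
  have add: "kos_lift sc \<phi> (s + t) = kos_lift sc \<phi> s + kos_lift sc \<phi> t" for s t
    by (induct s, induct t) (simp add: lift plus_kos.abs_eq l.add)
  have scale: "kos_lift sc \<phi> (kos_scale c t) = sc c (kos_lift sc \<phi> t)" for c t
    by (induct t) (simp add: lift kos_scale.abs_eq l.scale)
  show "Vector_Spaces.linear kos_scale sc (kos_lift sc \<phi>)"
    by unfold_locales (simp_all add: add scale)
  show "kos_lift sc \<phi> (kos x u y) = \<phi> x u y"
    by (simp add: kos_def lift pm_ext_single [OF assms(1)])
qed


section \<open>Bimodules\<close>

text \<open>
  Bimodules over \<open>'a\<close> with underlying set inside a type \<open>'m\<close> whose addition is used.  Maps between
  them are functions on the ambient types, of which only the values on the carrier matter.
\<close>

record ('a, 'm) bimodule =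
  carr :: "'m set"
  lact :: "'a \<Rightarrow> 'm \<Rightarrow> 'm"
  ract :: "'m \<Rightarrow> 'a \<Rightarrow> 'm"

definition bimod_hom ::
    "('a, 'm::ab_group_add) bimodule \<Rightarrow> ('a, 'n::ab_group_add) bimodule \<Rightarrow> ('m \<Rightarrow> 'n) \<Rightarrow> bool"
  where "bimod_hom M N h \<longleftrightarrow>
    (\<forall>m\<in>carr M. h m \<in> carr N) \<and>
    (\<forall>m\<in>carr M. \<forall>m'\<in>carr M. h (m + m') = h m + h m') \<and>
    (\<forall>m\<in>carr M. \<forall>x. h (lact M x m) = lact N x (h m) \<and> h (ract M m x) = ract N (h m) x)"

definition fk_bimod :: "('k::field fk, 'k fk) bimodule"
  where "fk_bimod = \<lparr>carr = UNIV, lact = (*), ract = (*)\<rparr>"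

definition kos_bimod :: "nat \<Rightarrow> ('k::field fk, 'k kos) bimodule"
  where "kos_bimod n =
    \<lparr>carr = kos.span {kos x u y | x u y. u \<in> fkd_dual n},
     lact = (\<lambda>a. kos_lift kos_scale (\<lambda>x u y. kos (a * x) u y)),
     ract = (\<lambda>t a. kos_lift kos_scale (\<lambda>x u y. kos x u (y * a)) t)\<rparr>"

definition bar_bimod :: "nat \<Rightarrow> ('k::field fk, 'k ten) bimodule"
  where "bar_bimod n =
    \<lparr>carr = ten_power (n + 2),
     lact = (\<lambda>a. ten_lift (n + 2) ten_scale (\<lambda>xs. tens ((a * hd xs) # tl xs))),
     ract = (\<lambda>t a. ten_lift (n + 2) ten_scale (\<lambda>xs. tens (butlast xs @ [last xs * a])) t)\<rparr>"


section \<open>The minimal projective bimodule resolution\<close>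

definition letters :: "letter set"
  where "letters = {La, Lb, Lc}"

text \<open>
  For \<open>n = 0\<close> the formula gives the zero map on \<open>K\<^sub>0\<close>, since \<open>u \<in> fkd_dual 0\<close> vanishes in nonzero degrees.
\<close>

definition kos_diff :: "nat \<Rightarrow> 'k::field kos \<Rightarrow> 'k kos"
  where "kos_diff n = kos_lift kos_scale (\<lambda>x u y. \<Sum>l\<in>letters.
    kos_scale ((-1) ^ n) (kos (x * fk_mon [l]) (\<lambda>w. u (fkd_mon [l] * w)) y)
    + kos x (\<lambda>w. u (w * fkd_mon [l])) (fk_mon [l] * y))"

text \<open>\<open>kos_deg n N\<close> is the part of internal degree \<open>N\<close> of \<open>K\<^sub>n\<close>.\<close>

definition kos_deg :: "nat \<Rightarrow> int \<Rightarrow> 'k::field kos set"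
  where "kos_deg n N = kos.span
    {kos x u y | x u y s t. x \<in> fk_deg s \<and> y \<in> fk_deg t \<and> u \<in> fkd_dual n \<and> s + t + int n = N}"

definition f0_value :: "'k::field kos"
  where "f0_value =
   (let a = fk_mon [La]; b = fk_mon [Lb]; c = fk_mon [Lc];
        p = (\<lambda>v. dual_mon [La, Lb, Lb] v - 2 * dual_mon [La, La, La] v);
        q = (\<lambda>v. dual_mon [La, La, Lb] v - 2 * dual_mon [Lb, Lb, Lb] v);
        r = (\<lambda>v. dual_mon [La, La, Lc] v - 2 * dual_mon [Lc, Lc, Lc] v)
    in - kos 1 p (b*a*c) - kos 1 q (a*b*c) + kos 1 r (a*b*a)
       + kos a q (b*a + a*c) - kos a r (b*c) + kos b p (a*b + b*c)
       - kos b r (a*c) - kos c q (a*b) - kos c p (b*a)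
       - kos (b*c) q a + kos (b*a + a*c) r a + kos (a*b + b*c) r b
       - kos (a*c) p b - kos (b*a) q c - kos (a*b) p c
       - kos (b*a*c) p 1 - kos (a*b*c) q 1 + kos (a*b*a) r 1)"

text \<open>
  An element \<open>\<Sum>\<^sub>i \<omega>\<^sub>i \<rho>\<^sub>n\<^sub>-\<^sub>4\<^sub>i\<close> of \<open>P\<^sub>n\<close> is the finitely supported family \<open>i \<mapsto> \<rho>\<^sub>n\<^sub>-\<^sub>4\<^sub>i\<close>.
\<close>

type_synonym 'k res = "nat \<Rightarrow>\<^sub>0 'k kos"

abbreviation omega :: "nat \<Rightarrow> 'k::field kos \<Rightarrow> 'k res"
  where "omega \<equiv> Poly_Mapping.single"

definition res_scale :: "'k::field \<Rightarrow> 'k res \<Rightarrow> 'k res"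
  where "res_scale c = Poly_Mapping.map (kos_scale c)"

definition res_bimod :: "nat \<Rightarrow> ('k::field fk, 'k res) bimodule"
  where "res_bimod n =
    \<lparr>carr = {z. \<forall>i. Poly_Mapping.lookup z i \<in> (if 4 * i \<le> n then carr (kos_bimod (n - 4 * i)) else {0})},
     lact = (\<lambda>a. Poly_Mapping.map (lact (kos_bimod n) a)),
     ract = (\<lambda>z a. Poly_Mapping.map (\<lambda>t. ract (kos_bimod n) t a) z)\<rparr>"

definition res_deg :: "nat \<Rightarrow> int \<Rightarrow> 'k::field res set"
  where "res_deg n N =
    {z. \<forall>i. Poly_Mapping.lookup z i \<in> (if 4 * i \<le> n then kos_deg (n - 4 * i) (N - 6 * int i) else {0})}"

definition res_diff :: "(nat \<Rightarrow> 'k::field kos \<Rightarrow> 'k kos) \<Rightarrow> nat \<Rightarrow> 'k res \<Rightarrow> 'k res"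
  where "res_diff f n z = (\<Sum>i\<le>n div 4.
    omega i (kos_diff (n - 4 * i) (Poly_Mapping.lookup z i))
    + (if i = 0 then 0 else omega (i - 1) (f (n - 4 * i) (Poly_Mapping.lookup z i))))"

text \<open>On \<open>(A\<^sup>!\<^sub>0)\<^sup>*\<close> one has \<open>u = u(1) \<epsilon>\<^sup>!\<close>.\<close>

definition res_aug :: "'k::field res \<Rightarrow> 'k fk"
  where "res_aug z = kos_lift fk_scale (\<lambda>x u y. fk_scale (u 1) (x * y)) (Poly_Mapping.lookup z 0)"

text \<open>
  The hypotheses on the maps \<open>f\<^sub>j\<close>.  Projectivity of the \<open>P\<^sub>n\<close> is automatic, as they are free bimodules, and so is
  minimality, as homogeneity forces all coefficients of the differential to have positive degree.
\<close>

definition fk_resolution :: "(nat \<Rightarrow> 'k::field kos \<Rightarrow> 'k kos) \<Rightarrow> bool"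
  where "fk_resolution f \<longleftrightarrow>
    (\<forall>j. bimod_hom (kos_bimod j) (kos_bimod (j + 3)) (f j)) \<and>
    (\<forall>j N. \<forall>t\<in>kos_deg j N. f j t \<in> kos_deg (j + 3) (N + 6)) \<and>
    f 0 (kos 1 (dual_mon []) 1) = f0_value \<and>
    (\<forall>n\<ge>1. {z \<in> carr (res_bimod n). res_diff f n z = 0} = res_diff f (n + 1) ` carr (res_bimod (n + 1))) \<and>
    {z \<in> carr (res_bimod 0). res_aug z = 0} = res_diff f 1 ` carr (res_bimod 1) \<and>
    res_aug ` carr (res_bimod 0) = (UNIV :: 'k fk set)"


section \<open>Hochschild cohomology\<close>

definition hom_cocycle :: "(nat \<Rightarrow> 'k::field kos \<Rightarrow> 'k kos) \<Rightarrow> nat \<Rightarrow> ('k res \<Rightarrow> 'k fk) \<Rightarrow> bool"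
  where "hom_cocycle f n \<phi> \<longleftrightarrow>
    bimod_hom (res_bimod n) fk_bimod \<phi> \<and> (\<forall>z\<in>carr (res_bimod (n + 1)). \<phi> (res_diff f (n + 1) z) = 0)"

definition hom_coboundary :: "(nat \<Rightarrow> 'k::field kos \<Rightarrow> 'k kos) \<Rightarrow> nat \<Rightarrow> ('k res \<Rightarrow> 'k fk) \<Rightarrow> bool"
  where "hom_coboundary f n \<phi> \<longleftrightarrow>
    (if n = 0 then \<forall>z\<in>carr (res_bimod 0). \<phi> z = 0
     else \<exists>h. bimod_hom (res_bimod (n - 1)) fk_bimod h \<and>
              (\<forall>z\<in>carr (res_bimod n). \<phi> z = h (res_diff f n z)))"

text \<open>The coset of \<open>\<phi>\<close> modulo coboundaries.\<close>

definition hh_class ::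
    "(nat \<Rightarrow> 'k::field kos \<Rightarrow> 'k kos) \<Rightarrow> nat \<Rightarrow> ('k res \<Rightarrow> 'k fk) \<Rightarrow> ('k res \<Rightarrow> 'k fk) set"
  where "hh_class f n \<phi> =
    {\<psi>. bimod_hom (res_bimod n) fk_bimod \<psi> \<and> hom_coboundary f n (\<lambda>z. \<psi> z - \<phi> z)}"

definition HH :: "(nat \<Rightarrow> 'k::field kos \<Rightarrow> 'k kos) \<Rightarrow> nat \<Rightarrow> ('k res \<Rightarrow> 'k fk) set set"
  where "HH f n = hh_class f n ` {\<phi>. hom_cocycle f n \<phi>}"

definition hh_scale ::
    "(nat \<Rightarrow> 'k::field kos \<Rightarrow> 'k kos) \<Rightarrow> nat \<Rightarrow> 'k \<Rightarrow> ('k res \<Rightarrow> 'k fk) set \<Rightarrow> ('k res \<Rightarrow> 'k fk) set"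
  where "hh_scale f n c \<xi> = (\<Union>\<phi>\<in>\<xi>. hh_class f n (\<lambda>z. fk_scale c (\<phi> z)))"

definition hh_homogeneous ::
    "(nat \<Rightarrow> 'k::field kos \<Rightarrow> 'k kos) \<Rightarrow> nat \<Rightarrow> int \<Rightarrow> ('k res \<Rightarrow> 'k fk) set \<Rightarrow> bool"
  where "hh_homogeneous f n d \<xi> \<longleftrightarrow>
    (\<exists>\<phi>. hom_cocycle f n \<phi> \<and> (\<forall>N. \<forall>z\<in>res_deg n N. \<phi> z \<in> fk_deg (N + d)) \<and> \<xi> = hh_class f n \<phi>)"


subsection \<open>The bar resolution\<close>

definition bar_diff :: "nat \<Rightarrow> 'k::field ten \<Rightarrow> 'k ten"
  where "bar_diff n = ten_lift (n + 2) ten_scale (\<lambda>xs.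
    \<Sum>j\<le>n. ten_scale ((-1) ^ j) (tens (take j xs @ [xs ! j * xs ! (j + 1)] @ drop (j + 2) xs)))"

definition bar_aug :: "'k::field ten \<Rightarrow> 'k fk"
  where "bar_aug = ten_lift 2 fk_scale (\<lambda>xs. xs ! 0 * xs ! 1)"

text \<open>Morphisms from the resolution to the bar resolution that lift the identity, normalised in degrees 0 and 1.\<close>

definition fk_comparison ::
    "(nat \<Rightarrow> 'k::field kos \<Rightarrow> 'k kos) \<Rightarrow> (nat \<Rightarrow> 'k res \<Rightarrow> 'k ten) \<Rightarrow> bool"
  where "fk_comparison f \<iota> \<longleftrightarrow>
    (\<forall>n. bimod_hom (res_bimod n) (bar_bimod n) (\<iota> n)) \<and>
    (\<forall>n\<ge>1. \<forall>z\<in>carr (res_bimod n). bar_diff n (\<iota> n z) = \<iota> (n - 1) (res_diff f n z)) \<and>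
    (\<forall>z\<in>carr (res_bimod 0). bar_aug (\<iota> 0 z) = res_aug z) \<and>
    \<iota> 0 (omega 0 (kos 1 (dual_mon []) 1)) = tens [1, 1] \<and>
    (\<forall>l\<in>letters. \<iota> 1 (omega 0 (kos 1 (dual_mon [l]) 1)) = - tens [1, fk_mon [l], 1])"


subsection \<open>Hochschild cochains and the Gerstenhaber bracket\<close>

text \<open>
  A Hochschild \<open>n\<close>-cochain is an \<open>n\<close>-multilinear function on lists of length \<open>n\<close>.  Exponents of signs
  are taken with \<open>n + 1\<close> in place of \<open>n - 1\<close>, to avoid truncated subtraction.
\<close>

definition bar_hom :: "nat \<Rightarrow> ('k::field fk list \<Rightarrow> 'k fk) \<Rightarrow> 'k ten \<Rightarrow> 'k fk"
  where "bar_hom n g = ten_lift (n + 2) fk_scale (\<lambda>xs. hd xs * g (butlast (tl xs)) * last xs)"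

definition hochschild_cocycle :: "nat \<Rightarrow> ('k::field fk list \<Rightarrow> 'k fk) \<Rightarrow> bool"
  where "hochschild_cocycle n g \<longleftrightarrow>
    multilinear n fk_scale g \<and> (\<forall>t\<in>carr (bar_bimod (n + 1)). bar_hom n g (bar_diff (n + 1) t) = 0)"

definition gcirc ::
    "nat \<Rightarrow> nat \<Rightarrow> ('k::field fk list \<Rightarrow> 'k fk) \<Rightarrow> ('k fk list \<Rightarrow> 'k fk) \<Rightarrow> 'k fk list \<Rightarrow> 'k fk"
  where "gcirc m n g h xs = (\<Sum>i = 1..m. (-1) ^ ((n + 1) * (i - 1)) *
    g (take (i - 1) xs @ [h (take n (drop (i - 1) xs))] @ drop (i - 1 + n) xs))"

definition gbracket ::
    "nat \<Rightarrow> nat \<Rightarrow> ('k::field fk list \<Rightarrow> 'k fk) \<Rightarrow> ('k fk list \<Rightarrow> 'k fk) \<Rightarrow> 'k fk list \<Rightarrow> 'k fk"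
  where "gbracket m n g h xs = gcirc m n g h xs - (-1) ^ ((m + 1) * (n + 1)) * gcirc n m h g xs"

text \<open>
  The bracket of \<open>\<xi> \<in> HH\<^sup>m\<close> and \<open>\<eta> \<in> HH\<^sup>n\<close>, transported along \<open>\<iota>\<close>: the union of the classes obtained from
  all cocycles on the bar resolution representing \<open>\<xi>\<close> and \<open>\<eta>\<close>.  These classes coincide, so that the
  union is itself a single class.
\<close>

definition hh_bracket ::
    "(nat \<Rightarrow> 'k::field kos \<Rightarrow> 'k kos) \<Rightarrow> (nat \<Rightarrow> 'k res \<Rightarrow> 'k ten) \<Rightarrow> nat \<Rightarrow> nat \<Rightarrow>
      ('k res \<Rightarrow> 'k fk) set \<Rightarrow> ('k res \<Rightarrow> 'k fk) set \<Rightarrow> ('k res \<Rightarrow> 'k fk) set"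
  where "hh_bracket f \<iota> m n \<xi> \<eta> =
    \<Union>{hh_class f (m + n - 1) (bar_hom (m + n - 1) (gbracket m n g h) \<circ> \<iota> (m + n - 1)) | g h.
        hochschild_cocycle m g \<and> hochschild_cocycle n h \<and>
        bar_hom m g \<circ> \<iota> m \<in> \<xi> \<and> bar_hom n h \<circ> \<iota> n \<in> \<eta>}"


section \<open>The classes \<open>X\<^sub>1, \<dots>, X\<^sub>1\<^sub>4\<close>\<close>

text \<open>
  \<open>elem_hom i w x\<close> takes the value \<open>x\<close> on \<open>\<omega>\<^sub>i 1|u|1\<close> if \<open>u\<close> is the usual dual basis element of \<open>w\<close> and
  vanishes on all other \<open>\<omega>\<^sub>j 1|u'|1\<close>: the coefficient of \<open>v\<close> at \<open>u\<close> is \<open>v(w)\<close>.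
\<close>

definition elem_hom :: "nat \<Rightarrow> letter list \<Rightarrow> 'k::field fk \<Rightarrow> 'k res \<Rightarrow> 'k fk"
  where "elem_hom i w x z =
    kos_lift fk_scale (\<lambda>y v y'. fk_scale (v (fkd_mon w)) (y * x * y')) (Poly_Mapping.lookup z i)"

definition X_degree :: "nat \<Rightarrow> nat"
  where "X_degree j =
    (if j \<le> 3 then 0 else if j \<le> 8 then 1 else if j \<le> 12 then 2 else if j = 13 then 3 else 4)"

definition X_cocycle :: "nat \<Rightarrow> 'k::field res \<Rightarrow> 'k fk"
  where "X_cocycle j =
   (let a = fk_mon [La]; b = fk_mon [Lb]; c = fk_mon [Lc] in
    [elem_hom 0 [] (a*b + b*a),
     elem_hom 0 [] (a*b + b*c - a*c),
     elem_hom 0 [] (a*b*a*c),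
     elem_hom 0 [La] (b*a*c),
     elem_hom 0 [Lb] (a*b*c),
     elem_hom 0 [Lc] (a*b*a),
     elem_hom 0 [La] (a*b*a - a*b*c),
     (\<lambda>z. elem_hom 0 [La] a z + elem_hom 0 [Lb] b z + elem_hom 0 [Lc] c z),
     elem_hom 0 [La, La] 1,
     elem_hom 0 [Lb, Lb] 1,
     elem_hom 0 [Lc, Lc] 1,
     (\<lambda>z. elem_hom 0 [La, Lb] 1 z + elem_hom 0 [La, Lc] 1 z),
     (\<lambda>z. elem_hom 0 [La, La, La] a z + elem_hom 0 [Lb, Lb, Lb] b z + elem_hom 0 [Lc, Lc, Lc] c z),
     elem_hom 1 [] 1] ! (j - 1))"

definition X_class :: "(nat \<Rightarrow> 'k::field kos \<Rightarrow> 'k kos) \<Rightarrow> nat \<Rightarrow> ('k res \<Rightarrow> 'k fk) set"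
  where "X_class f j = hh_class f (X_degree j) (X_cocycle j)"


section \<open>Liftings of derivations\<close>

text \<open>
  The enveloping algebra \<open>A\<^sup>e\<close> is \<^term>\<open>ten_power 2\<close> as a vector space, with \<open>x|y\<close> acting by
  \<open>m \<mapsto> x m y\<close>.
\<close>

definition env_act ::
    "('k::field fk, 'm::ab_group_add) bimodule \<Rightarrow> 'k ten \<Rightarrow> 'm \<Rightarrow> 'm"
  where "env_act M s m =
    ten_lift 2 (\<lambda>c. lact M (fk_scale c 1)) (\<lambda>xs. lact M (xs ! 0) (ract M m (xs ! 1))) s"

definition env_derivation :: "('k::field fk \<Rightarrow> 'k fk) \<Rightarrow> 'k ten \<Rightarrow> 'k ten"
  where "env_derivation \<rho> =
    ten_lift 2 ten_scale (\<lambda>xs. tens [\<rho> (xs ! 0), xs ! 1] + tens [xs ! 0, \<rho> (xs ! 1)])"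

definition res_linear :: "nat \<Rightarrow> ('k::field res \<Rightarrow> 'k res) \<Rightarrow> bool"
  where "res_linear n h \<longleftrightarrow>
    (\<forall>z\<in>carr (res_bimod n). h z \<in> carr (res_bimod n)) \<and>
    (\<forall>z\<in>carr (res_bimod n). \<forall>z'\<in>carr (res_bimod n). h (z + z') = h z + h z') \<and>
    (\<forall>c. \<forall>z\<in>carr (res_bimod n). h (res_scale c z) = res_scale c (h z))"

definition derivation_operator :: "('k::field fk \<Rightarrow> 'k fk) \<Rightarrow> nat \<Rightarrow> ('k res \<Rightarrow> 'k res) \<Rightarrow> bool"
  where "derivation_operator \<rho> n h \<longleftrightarrow>
    res_linear n h \<and>
    (\<forall>s\<in>ten_power 2. \<forall>z\<in>carr (res_bimod n).
      h (env_act (res_bimod n) s z) =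
        env_act (res_bimod n) (env_derivation \<rho> s) z + env_act (res_bimod n) s (h z))"

definition derivation_lifting ::
    "(nat \<Rightarrow> 'k::field kos \<Rightarrow> 'k kos) \<Rightarrow> ('k fk \<Rightarrow> 'k fk) \<Rightarrow> (nat \<Rightarrow> 'k res \<Rightarrow> 'k res) \<Rightarrow> bool"
  where "derivation_lifting f \<rho> R \<longleftrightarrow>
    (\<forall>n. derivation_operator \<rho> n (R n)) \<and>
    (\<forall>z\<in>carr (res_bimod 0). res_aug (R 0 z) = \<rho> (res_aug z)) \<and>
    (\<forall>n\<ge>1. \<forall>z\<in>carr (res_bimod n). res_diff f n (R n z) = R (n - 1) (res_diff f n z))"

definition euler_derivation :: "('k::field fk \<Rightarrow> 'k fk) \<Rightarrow> bool"
  where "euler_derivation \<rho> \<longleftrightarrow>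
    fk_derivation \<rho> \<and> (\<forall>w\<in>fk_basis. \<rho> (fk_mon w) = fk_scale (of_nat (length w)) (fk_mon w))"

text \<open>The linear maps \<open>\<rho>\<^sub>n\<close>, given by their values on the basis of \<open>P\<^sub>n\<close>.\<close>

definition euler_maps :: "(nat \<Rightarrow> 'k::field res \<Rightarrow> 'k res) \<Rightarrow> bool"
  where "euler_maps R \<longleftrightarrow>
    (\<forall>n. res_linear n (R n) \<and>
      (\<forall>i v w m. i \<le> n div 4 \<longrightarrow> v \<in> fk_basis \<longrightarrow> w \<in> fk_basis \<longrightarrow> m \<in> fkd_basis (n - 4 * i) \<longrightarrow>
        R n (omega i (kos (fk_mon v) (dual_mon m) (fk_mon w))) =
          res_scale (of_nat (length v + length w + n + 2 * i))
            (omega i (kos (fk_mon v) (dual_mon m) (fk_mon w)))))"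

end

theory Submission
  imports Defs
begin

text \<open>
  All internal degrees are eigenvalues of the Euler operators: \<open>\<rho>\<^sub>n\<close> acts on the part of \<open>P\<^sub>n\<close> of internal degree
  \<open>N\<close> as multiplication by \<open>N\<close>, so every compatibility of the \<open>\<rho>\<^sub>n\<close> is a statement about degrees.

  A cocycle of the bar resolution in the class \<open>X\<^sub>8\<close> is a derivation \<open>g\<close> of the form
  \<open>x \<mapsto> - \<rho>(x) + (x e - e x)\<close>, since a derivation is determined by its values on the generators.  It lifts to
  \<open>P\<close> by \<open>S m = - \<rho>\<^sub>n(m) + (m e - e m)\<close>, and to the bar resolution by the sum of its actions on the tensor
  factors; both liftings agree up to homotopy, because \<open>P\<close> is free and the bar resolution is exact.  Hence
  \<open>[g, \<phi>]\<close> is represented by \<open>g \<phi> - \<phi> S = - \<rho> \<phi> + \<phi> \<rho>\<^sub>n\<close>, which is \<open>- \<aa>(\<phi>) \<phi>\<close> if \<open>\<phi>\<close> is homogeneous of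
  degree \<open>\<aa>(\<phi>)\<close>.
\<close>

text \<open>Two matters lie outside the count of degrees. The functionals \<open>dual_mon m\<close>
  are defined by a basis representation, so nothing on \<open>P\<close> can be evaluated before the
  listed monomials are known to form a basis of the quadratic dual. Its relations identify words
  with words: spanning becomes a rewriting problem, and independence follows from an invariant of
  words that separates the normal forms. The bracket of two classes is a union over all representing
  pairs on the bar resolution. Such pairs must exist and must all give the same class. Existence
  needs a chain map from the bar resolution to \<open>P\<close>, opposite to \<open>\<iota>\<close>,
  hence projectivity of the bar bimodules, which comes from an abstract basis of the tensor powers.
  For uniqueness, the element \<open>e\<close> and the coboundary by which a representing cocycle
  differs from \<phi> are carried along: the former cancels against bimodule maps, and the
  commutator of the latter with the Euler operators is again a coboundary. The sign in -\<rho> comes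
  from the normalisation of \<open>\<iota>\<close> in degree 1, which sends a generator to
  -1|x|1.\<close>

lemma linearI:
  assumes "vector_space s1" "vector_space s2"
    and "\<And>x y. h (x + y) = h x + h y" "\<And>c x. h (s1 c x) = s2 c (h x)"
  shows "Vector_Spaces.linear s1 s2 h"
proof -
  interpret vector_space_pair s1 s2 using assms(1,2) by (simp add: vector_space_pair_def)
  show ?thesis using assms(3,4) by unfold_locales auto
qed

lemma
  assumes "Vector_Spaces.linear s1 s2 h"
  shows linearD_add: "h (x + y) = h x + h y"
    and linearD_scale: "h (s1 c x) = s2 c (h x)"
    and linearD_zero: "h 0 = 0"
    and linearD_diff: "h (x - y) = h x - h y"
    and linearD_uminus: "h (- x) = - h x"
    and linearD_sum: "h (\<Sum>i\<in>I. g i) = (\<Sum>i\<in>I. h (g i))"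
proof -
  interpret Vector_Spaces.linear s1 s2 h by fact
  show "h (x + y) = h x + h y" "h (s1 c x) = s2 c (h x)" "h 0 = 0" "h (x - y) = h x - h y"
    "h (- x) = - h x" "h (\<Sum>i\<in>I. g i) = (\<Sum>i\<in>I. h (g i))"
    by (auto simp: add scale zero diff neg sum)
qed

lemma vector_space_mult: "vector_space ((*) :: 'k::field \<Rightarrow> 'k \<Rightarrow> 'k)"
  by unfold_locales (auto simp: algebra_simps)

lemmas fk_vs = fk.vector_space_axioms
lemmas fkd_vs = fkd.vector_space_axioms
lemmas ten_vs = ten.vector_space_axioms
lemmas kos_vs = kos.vector_space_axioms
lemmas pm_vs = pm.vector_space_axioms

text \<open>A set closed under scaling spans by finite sums alone, so \<open>P\<close> need only be
  additive. This suits pure tensors, which absorb scalars into one factor.\<close>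

lemma (in module) span_induct_scaled [consumes 1, case_names scaled zero add base]:
  assumes "x \<in> span S" "\<And>c s. s \<in> S \<Longrightarrow> scale c s \<in> S" "P 0"
    "\<And>x y. x \<in> span S \<Longrightarrow> y \<in> span S \<Longrightarrow> P x \<Longrightarrow> P y \<Longrightarrow> P (x + y)" "\<And>s. s \<in> S \<Longrightarrow> P s"
  shows "P x"
proof -
  have "x \<in> span S \<and> P x"
    using assms(1)
  proof (induction rule: span_induct_alt)
    case base
    then show ?case using assms(3) by (simp add: span_zero)
  next
    case (step c x y)
    then have "scale c x \<in> span S" "P (scale c x)"
      using assms(2,5) by (auto intro: span_base)
    then show ?case using step assms(4) by (simp add: span_add)
  qed
  then show ?thesis by simp
qed

lemma pm_span_single: "p \<in> pm.span (range (\<lambda>g. Poly_Mapping.single g 1))"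
proof (induction p rule: update_induct)
  case const
  then show ?case by (simp add: pm.span_zero)
next
  case (update p a b)
  have "Poly_Mapping.update a b p = p + pm_scale b (Poly_Mapping.single a 1)"
    using update by (auto intro!: poly_mapping_eqI simp: lookup_update lookup_add lookup_single in_keys_iff)
  then show ?case
    using update by (metis pm.span_add pm.span_base pm.span_scale rangeI)
qed

lemma linear_eq_single:
  assumes "Vector_Spaces.linear pm_scale sc h" "Vector_Spaces.linear pm_scale sc h'"
    and "\<And>g. h (Poly_Mapping.single g 1) = h' (Poly_Mapping.single g 1)"
  shows "h p = h' p"
  using pm_span_single [of p]
  by (induction rule: pm.span_induct_alt)
    (auto simp: linearD_zero [OF assms(1)] linearD_zero [OF assms(2)] linearD_add [OF assms(1)]
      linearD_add [OF assms(2)] linearD_scale [OF assms(1)] linearD_scale [OF assms(2)] assms(3)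
      simp del: pm_scale_single)


section \<open>Quotients of the free algebra\<close>

lemma word_mult: "word u * word v = word (u @ v)"
  by (simp add: mult_single plus_list_def)

lemma pm_scale_mult_left: "pm_scale c p * q = pm_scale c (p * q)" for p q :: "'k::field free_alg"
  by (simp add: pm_scale_conv_mult mult.assoc)

lemma pm_scale_mult_right: "p * pm_scale c q = pm_scale c (p * q)" for p q :: "'k::field free_alg"
proof -
  have "p * Poly_Mapping.single [] c = pm_scale c p"
    by (rule linear_eq_single [where h = "\<lambda>p. p * Poly_Mapping.single [] c"])
      (auto intro!: linearI [OF pm_vs pm_vs]
        simp: pm_scale_mult_left pm.scale_right_distrib algebra_simps mult_single plus_list_def)
  then show ?thesis
    by (simp add: pm_scale_conv_mult flip: mult.assoc)
qed

text \<open>The kernel of a linear map is in general no ideal. The elements killed after every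
  two-sided multiplication do form one, and that it contains the relations is checked on words, by
  linearity in each outer factor.\<close>

lemma pm_ext_ideal_generated:
  fixes R :: "'k::field free_alg set"
  assumes vs: "vector_space sc"
    and R: "\<And>r u v. r \<in> R \<Longrightarrow> pm_ext sc \<theta> (word u * r * word v) = 0"
    and p: "p \<in> ideal_generated R"
  shows "pm_ext sc \<theta> p = 0"
proof -
  note lin = linear_pm_ext [OF vs, of \<theta>]
  have zero: "Vector_Spaces.linear pm_scale sc (\<lambda>_. 0)"
    using vs by (auto intro!: linearI [OF pm_vs] simp: module.scale_zero_right module_iff_vector_space)
  define J where "J = {p. \<forall>r s. pm_ext sc \<theta> (r * p * s) = 0}"
  have "two_sided_ideal J"
    unfolding two_sided_ideal_def J_def
    by (auto simp: linearD_add [OF lin] linearD_zero [OF lin] distrib_left distrib_right)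
      (simp_all flip: mult.assoc, simp add: mult.assoc)
  moreover have "R \<subseteq> J"
  proof
    fix r assume r: "r \<in> R"
    have 1: "pm_ext sc \<theta> (word u * r * s) = 0" for u s
      by (rule linear_eq_single [where h = "\<lambda>s. pm_ext sc \<theta> (word u * r * s)", OF _ zero])
        (auto intro!: linearI [OF pm_vs vs] simp: R r distrib_left pm_scale_mult_right
          linearD_add [OF lin] linearD_scale [OF lin])
    have "pm_ext sc \<theta> (q * r * s) = 0" for q s
      by (rule linear_eq_single [where h = "\<lambda>q. pm_ext sc \<theta> (q * r * s)", OF _ zero])
        (auto intro!: linearI [OF pm_vs vs] simp: 1 distrib_right pm_scale_mult_left
          linearD_add [OF lin] linearD_scale [OF lin])
    then show "r \<in> J" by (simp add: J_def)
  qed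
  ultimately have "p \<in> J" using p ideal_generated_least by blast
  then have "pm_ext sc \<theta> (1 * p * 1) = 0" unfolding J_def by blast
  then show ?thesis by simp
qed


lemma fk_mon_append: "fk_mon (u @ v) = (fk_mon u * fk_mon v :: 'k::field fk)"
  by transfer (simp add: word_mult ideal_generated_zero)

lemma fk_mon_Nil [simp]: "fk_mon [] = 1"
  by transfer (simp add: ideal_generated_zero single_one flip: zero_list_def)

lemma fk_scale_mult_left: "fk_scale c x * y = fk_scale c (x * y)"
  by transfer (simp add: pm_scale_mult_left ideal_generated_zero)

lemma fk_scale_mult_right: "x * fk_scale c y = fk_scale c (x * y)"
  by transfer (simp add: pm_scale_mult_right ideal_generated_zero)

lemma fk_span_mon: "x \<in> fk.span (range fk_mon)" for x :: "'k::field fk"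
proof -
  have "abs_fk p \<in> fk.span (range fk_mon)" for p :: "'k free_alg"
    using pm_span_single [of p]
  proof (induction rule: pm.span_induct_alt)
    case base
    then show ?case by (simp add: fk.span_zero flip: zero_fk.abs_eq)
  next
    case (step c x y)
    then obtain w where "x = word w" by blast
    then have eq: "abs_fk (pm_scale c x + y) = fk_scale c (fk_mon w) + abs_fk y"
      by (simp only: plus_fk.abs_eq fk_scale.abs_eq fk_mon.abs_eq)
    show ?case
      unfolding eq by (intro fk.span_add fk.span_scale fk.span_base rangeI step)
  qed
  then show ?thesis by (induct x) auto
qed

lemma fk_linear_eqI:
  assumes "Vector_Spaces.linear fk_scale sc h" "Vector_Spaces.linear fk_scale sc h'"
    and "\<And>w. h (fk_mon w) = h' (fk_mon w)"
  shows "h x = h' x"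
  using fk_span_mon [of x]
  by (induction rule: fk.span_induct_alt)
    (auto simp: linearD_zero [OF assms(1)] linearD_zero [OF assms(2)] linearD_add [OF assms(1)]
      linearD_add [OF assms(2)] linearD_scale [OF assms(1)] linearD_scale [OF assms(2)] assms(3))

definition fk_lift ::
    "('k::field \<Rightarrow> 'v::ab_group_add \<Rightarrow> 'v) \<Rightarrow> (letter list \<Rightarrow> 'v) \<Rightarrow> 'k fk \<Rightarrow> 'v"
  where "fk_lift sc \<theta> x = pm_ext sc \<theta> (rep_fk x)"

text \<open>The map later obtained from this, the Euler derivation, is linear but not
  multiplicative. Hence the relations have to be tested between arbitrary words \<open>u\<close> and
  \<open>v\<close>.\<close>

lemma
  fixes \<theta> :: "letter list \<Rightarrow> 'v::ab_group_add" and sc :: "'k::field \<Rightarrow> 'v \<Rightarrow> 'v"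
  assumes vs: "vector_space sc"
    and R: "\<And>r u v. r \<in> fk_rels \<Longrightarrow> pm_ext sc \<theta> (word u * r * word v) = 0"
  shows linear_fk_lift: "Vector_Spaces.linear fk_scale sc (fk_lift sc \<theta>)"
    and fk_lift_mon: "fk_lift sc \<theta> (fk_mon w) = \<theta> w"
proof -
  note lin = linear_pm_ext [OF vs, of \<theta>]
  interpret v: vector_space sc by fact
  have rep: "rep_fk (abs_fk p) - p \<in> ideal_generated fk_rels" for p :: "'k free_alg"
    using rep_abs_rsp_left [OF Quotient3_fk, of p p] by (simp add: ideal_generated_zero)
  have lift: "fk_lift sc \<theta> (abs_fk p) = pm_ext sc \<theta> p" for p
  proof -
    have "pm_ext sc \<theta> (rep_fk (abs_fk p) - p) = 0"
      using R by (rule pm_ext_ideal_generated [OF vs _ rep])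
    then show ?thesis by (simp add: linearD_diff [OF lin] fk_lift_def)
  qed
  have add: "fk_lift sc \<theta> (s + t) = fk_lift sc \<theta> s + fk_lift sc \<theta> t" for s t
    by (induct s, induct t) (simp add: lift plus_fk.abs_eq linearD_add [OF lin])
  have scale: "fk_lift sc \<theta> (fk_scale c t) = sc c (fk_lift sc \<theta> t)" for c t
    by (induct t) (simp add: lift fk_scale.abs_eq linearD_scale [OF lin])
  show "Vector_Spaces.linear fk_scale sc (fk_lift sc \<theta>)"
    by (rule linearI [OF fk_vs vs]) (rule add scale)+
  show "fk_lift sc \<theta> (fk_mon w) = \<theta> w"
    by (simp add: fk_mon.abs_eq lift pm_ext_single [OF vs])
qed

lemma fkd_mon_append: "fkd_mon (u @ v) = (fkd_mon u * fkd_mon v :: 'k::field fkd)"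
  by transfer (simp add: word_mult ideal_generated_zero)

lemma fkd_mon_Nil [simp]: "fkd_mon [] = 1"
  by transfer (simp add: ideal_generated_zero single_one flip: zero_list_def)

lemma fkd_scale_mult_left: "fkd_scale c x * y = fkd_scale c (x * y)"
  by transfer (simp add: pm_scale_mult_left ideal_generated_zero)

lemma fkd_scale_mult_right: "x * fkd_scale c y = fkd_scale c (x * y)"
  by transfer (simp add: pm_scale_mult_right ideal_generated_zero)

lemma fkd_span_mon: "x \<in> fkd.span (range fkd_mon)" for x :: "'k::field fkd"
proof -
  have "abs_fkd p \<in> fkd.span (range fkd_mon)" for p :: "'k free_alg"
    using pm_span_single [of p]
  proof (induction rule: pm.span_induct_alt)
    case base
    then show ?case by (simp add: fkd.span_zero flip: zero_fkd.abs_eq)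
  next
    case (step c x y)
    then obtain w where "x = word w" by blast
    then have eq: "abs_fkd (pm_scale c x + y) = fkd_scale c (fkd_mon w) + abs_fkd y"
      by (simp only: plus_fkd.abs_eq fkd_scale.abs_eq fkd_mon.abs_eq)
    show ?case
      unfolding eq by (intro fkd.span_add fkd.span_scale fkd.span_base rangeI step)
  qed
  then show ?thesis by (induct x) auto
qed

lemma fkd_linear_eqI:
  assumes "Vector_Spaces.linear fkd_scale sc h" "Vector_Spaces.linear fkd_scale sc h'"
    and "\<And>w. h (fkd_mon w) = h' (fkd_mon w)"
  shows "h x = h' x"
  using fkd_span_mon [of x]
  by (induction rule: fkd.span_induct_alt)
    (auto simp: linearD_zero [OF assms(1)] linearD_zero [OF assms(2)] linearD_add [OF assms(1)]
      linearD_add [OF assms(2)] linearD_scale [OF assms(1)] linearD_scale [OF assms(2)] assms(3))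

definition fkd_lift ::
    "('k::field \<Rightarrow> 'v::ab_group_add \<Rightarrow> 'v) \<Rightarrow> (letter list \<Rightarrow> 'v) \<Rightarrow> 'k fkd \<Rightarrow> 'v"
  where "fkd_lift sc \<theta> x = pm_ext sc \<theta> (rep_fkd x)"

lemma
  fixes \<theta> :: "letter list \<Rightarrow> 'v::ab_group_add" and sc :: "'k::field \<Rightarrow> 'v \<Rightarrow> 'v"
  assumes vs: "vector_space sc"
    and R: "\<And>r u v. r \<in> fkd_rels \<Longrightarrow> pm_ext sc \<theta> (word u * r * word v) = 0"
  shows linear_fkd_lift: "Vector_Spaces.linear fkd_scale sc (fkd_lift sc \<theta>)"
    and fkd_lift_mon: "fkd_lift sc \<theta> (fkd_mon w) = \<theta> w"
proof -
  note lin = linear_pm_ext [OF vs, of \<theta>]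
  interpret v: vector_space sc by fact
  have rep: "rep_fkd (abs_fkd p) - p \<in> ideal_generated fkd_rels" for p :: "'k free_alg"
    using rep_abs_rsp_left [OF Quotient3_fkd, of p p] by (simp add: ideal_generated_zero)
  have lift: "fkd_lift sc \<theta> (abs_fkd p) = pm_ext sc \<theta> p" for p
  proof -
    have "pm_ext sc \<theta> (rep_fkd (abs_fkd p) - p) = 0"
      using R by (rule pm_ext_ideal_generated [OF vs _ rep])
    then show ?thesis by (simp add: linearD_diff [OF lin] fkd_lift_def)
  qed
  have add: "fkd_lift sc \<theta> (s + t) = fkd_lift sc \<theta> s + fkd_lift sc \<theta> t" for s t
    by (induct s, induct t) (simp add: lift plus_fkd.abs_eq linearD_add [OF lin])
  have scale: "fkd_lift sc \<theta> (fkd_scale c t) = sc c (fkd_lift sc \<theta> t)" for c t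
    by (induct t) (simp add: lift fkd_scale.abs_eq linearD_scale [OF lin])
  show "Vector_Spaces.linear fkd_scale sc (fkd_lift sc \<theta>)"
    by (rule linearI [OF fkd_vs vs]) (rule add scale)+
  show "fkd_lift sc \<theta> (fkd_mon w) = \<theta> w"
    by (simp add: fkd_mon.abs_eq lift pm_ext_single [OF vs])
qed

section \<open>The quadratic dual\<close>

primrec letter_index :: "letter \<Rightarrow> int" where
  "letter_index La = 0" | "letter_index Lb = 1" | "letter_index Lc = 2"

text \<open>
  Letting the letter of index \<open>k\<close> act on \<open>\<int>/3\<close> as the reflection \<open>x \<mapsto> k - x\<close>, the products \<open>AB\<close>, \<open>BC\<close>,
  \<open>CA\<close> become equal rotations, as do \<open>BA\<close>, \<open>AC\<close>, \<open>CB\<close>.  The value below is the image of \<open>0\<close>.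
\<close>

primrec reflect :: "letter list \<Rightarrow> int" where
  "reflect [] = 0" | "reflect (l # w) = (letter_index l - reflect w) mod 3"

definition constant_word :: "letter list \<Rightarrow> bool"
  where "constant_word w \<longleftrightarrow> (\<exists>l. w = replicate (length w) l)"

text \<open>
  The relations of \<open>A\<^sup>!\<close> identify words with words; the key is a complete invariant of the resulting equivalence.
\<close>

definition word_key :: "letter list \<Rightarrow> letter list \<times> nat \<times> int"
  where "word_key w = (if constant_word w then w else [], length w, reflect w)"

lemma constant_word_iff: "constant_word w \<longleftrightarrow> (\<forall>x\<in>set w. \<forall>y\<in>set w. x = y)"
proof (cases w)
  case Nil
  then show ?thesis by (simp add: constant_word_def)
next
  case (Cons l v)
  have "constant_word w \<longleftrightarrow> (\<exists>l. \<forall>x\<in>set w. x = l)"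
    unfolding constant_word_def by (metis in_set_replicate replicate_eqI)
  then show ?thesis using Cons by auto
qed

lemma reflect_append_cong:
  "length v = length v' \<Longrightarrow> reflect v = reflect v' \<Longrightarrow> reflect (u @ v) = reflect (u @ v')"
  by (induction u) auto

text \<open>Each relation exchanges one pair of distinct neighbours for another, so neither side is
  a constant word, and both pairs act as the same rotation.\<close>

lemma word_key_rels:
  "word_key (u @ Lb # La # v) = word_key (u @ La # Lc # v)"
  "word_key (u @ Lc # La # v) = word_key (u @ La # Lb # v)"
  "word_key (u @ La # Lb # v) = word_key (u @ Lb # Lc # v)"
  "word_key (u @ Lc # Lb # v) = word_key (u @ Lb # La # v)"
proof -
  \<comment> \<open>With \<open>r\<close> the value of \<open>reflect v\<close>, prefixing
    \<open>BA\<close> or \<open>AC\<close> gives 1 + r or r - 2, and prefixing \<open>CA\<close> or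
    \<open>AB\<close> gives 2 + r or r - 1.\<close>
  have "(1 + r) mod 3 = (r - 2) mod 3" "(2 + r) mod 3 = (r - 1) mod 3" for r :: int
    by presburger+
  then have "reflect (Lb # La # v) = reflect (La # Lc # v)" "reflect (Lc # La # v) = reflect (La # Lb # v)"
    "reflect (La # Lb # v) = reflect (Lb # Lc # v)" "reflect (Lc # Lb # v) = reflect (Lb # La # v)"
    by (simp_all add: mod_simps)
  moreover have "\<not> constant_word (u @ l # l' # v)" if "l \<noteq> l'" for l l'
    using that by (auto simp: constant_word_iff)
  ultimately show
    "word_key (u @ Lb # La # v) = word_key (u @ La # Lc # v)"
    "word_key (u @ Lc # La # v) = word_key (u @ La # Lb # v)"
    "word_key (u @ La # Lb # v) = word_key (u @ Lb # Lc # v)"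
    "word_key (u @ Lc # Lb # v) = word_key (u @ Lb # La # v)"
    by (simp_all add: word_key_def reflect_append_cong del: reflect.simps)
qed

lemma pm_ext_single_diff:
  assumes "vector_space sc"
  shows "pm_ext sc \<theta> (word u - word v) = sc 1 (\<theta> u) - sc 1 (\<theta> v)"
  using linear_pm_ext [OF assms, of \<theta>] by (simp add: linearD_diff pm_ext_single [OF assms])

text \<open>The indicator of one equivalence class of words. It descends to the quotient because
  every relation is a difference of two words with the same key.\<close>

definition key_functional :: "letter list \<times> nat \<times> int \<Rightarrow> 'k::field fkd \<Rightarrow> 'k"
  where "key_functional \<kappa> = fkd_lift (*) (\<lambda>w. of_bool (word_key w = \<kappa>))"

lemma
  fixes \<kappa> :: "letter list \<times> nat \<times> int"
  shows linear_key_functional: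
      "Vector_Spaces.linear fkd_scale (*) (key_functional \<kappa> :: 'k::field fkd \<Rightarrow> 'k)"
    and key_functional_mon: "key_functional \<kappa> (fkd_mon w :: 'k fkd) = of_bool (word_key w = \<kappa>)"
proof -
  have *: "pm_ext (*) (\<lambda>w. of_bool (word_key w = \<kappa>)) (word u * r * word v) = 0"
    if "r \<in> fkd_rels" for u v and r :: "'k free_alg"
    using that unfolding fkd_rels_def
    by (auto simp: right_diff_distrib left_diff_distrib word_mult
        pm_ext_single_diff [OF vector_space_mult] word_key_rels)
  show "Vector_Spaces.linear fkd_scale (*) (key_functional \<kappa> :: 'k fkd \<Rightarrow> 'k)"
    "key_functional \<kappa> (fkd_mon w :: 'k fkd) = of_bool (word_key w = \<kappa>)"
    unfolding key_functional_def
    using linear_fkd_lift [OF vector_space_mult *] fkd_lift_mon [OF vector_space_mult *] by blast+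
qed

lemma length_fkd_basis: "m \<in> fkd_basis n \<Longrightarrow> length m = n"
  by (auto simp: fkd_basis_def split: if_splits)

lemma finite_fkd_basis [simp]: "finite (fkd_basis n)"
  by (simp add: fkd_basis_def)

lemma reflect_replicate_La:
  "reflect (replicate k La @ w) = (if even k then reflect w else (- reflect w) mod 3)"
proof (induction k)
  case (Suc k)
  have "reflect w mod 3 = reflect w" by (cases w) auto
  then show ?case using Suc by (auto simp: mod_simps)
qed simp

text \<open>For non-constant basis words of one length, the tails \<open>[Lb]\<close>,
  \<open>[Lc]\<close>, \<open>[Lb, Lb]\<close> reflect 0 to 1, 2, 0. A prefix of letters
  \<open>La\<close> only changes signs modulo 3, in the same way for the first two tails, so the
  three values stay distinct.\<close>

lemma word_key_inj:
  assumes m: "m \<in> fkd_basis n" and m': "m' \<in> fkd_basis n'" and key: "word_key m = word_key m'"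
  shows "m = m'"
proof (cases "constant_word m \<or> constant_word m'")
  case True
  then show ?thesis using key by (auto simp: word_key_def split: if_splits)
next
  case False
  have n: "n' = n" "reflect m = reflect m'"
    using assms by (auto simp: word_key_def dest!: length_fkd_basis)
  have "m \<in> {replicate (n - 1) La @ [Lb], replicate (n - 1) La @ [Lc], replicate (n - 2) La @ [Lb, Lb]}"
    if "m \<in> fkd_basis n" "\<not> constant_word m" for m
    using that by (auto simp: fkd_basis_def constant_word_iff split: if_splits)
  from this [of m] this [of m'] show ?thesis
    using m m' False n by (cases "even (n - 1)"; cases "even (n - 2)") (auto simp: reflect_replicate_La)
qed


section \<open>Rewriting monomials of the quadratic dual to normal form\<close>

lemma fkd_mon_rels:
  "fkd_mon [Lb] * fkd_mon [La] = (fkd_mon [La] * fkd_mon [Lc] :: 'k::field fkd)"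
  "fkd_mon [Lc] * fkd_mon [La] = (fkd_mon [La] * fkd_mon [Lb] :: 'k fkd)"
  "fkd_mon [Lb] * fkd_mon [Lc] = (fkd_mon [La] * fkd_mon [Lb] :: 'k fkd)"
  "fkd_mon [Lc] * fkd_mon [Lb] = (fkd_mon [La] * fkd_mon [Lc] :: 'k fkd)"
proof -
  have *: "fkd_mon u = (fkd_mon v :: 'k fkd)" if "word u - word v \<in> (fkd_rels :: 'k free_alg set)" for u v
    using that ideal_generated_superset [of fkd_rels] Quotient3_rel_abs [OF Quotient3_fkd, of "word u" "word v"]
    by (auto simp: fkd_mon.abs_eq)
  have "fkd_mon [Lb, La] = (fkd_mon [La, Lc] :: 'k fkd)" "fkd_mon [Lc, La] = (fkd_mon [La, Lb] :: 'k fkd)"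
    "fkd_mon [La, Lb] = (fkd_mon [Lb, Lc] :: 'k fkd)" "fkd_mon [Lc, Lb] = (fkd_mon [Lb, La] :: 'k fkd)"
    by (auto intro!: * simp: fkd_rels_def)
  then show
    "fkd_mon [Lb] * fkd_mon [La] = (fkd_mon [La] * fkd_mon [Lc] :: 'k::field fkd)"
    "fkd_mon [Lc] * fkd_mon [La] = (fkd_mon [La] * fkd_mon [Lb] :: 'k fkd)"
    "fkd_mon [Lb] * fkd_mon [Lc] = (fkd_mon [La] * fkd_mon [Lb] :: 'k fkd)"
    "fkd_mon [Lc] * fkd_mon [Lb] = (fkd_mon [La] * fkd_mon [Lc] :: 'k fkd)"
    by (simp_all flip: fkd_mon_append)
qed

lemma fkd_mon_rels_assoc:
  "fkd_mon [Lb] * (fkd_mon [La] * z) = fkd_mon [La] * (fkd_mon [Lc] * z)"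
  "fkd_mon [Lc] * (fkd_mon [La] * z) = fkd_mon [La] * (fkd_mon [Lb] * z)"
  "fkd_mon [Lb] * (fkd_mon [Lc] * z) = fkd_mon [La] * (fkd_mon [Lb] * z)"
  "fkd_mon [Lc] * (fkd_mon [Lb] * z) = fkd_mon [La] * (fkd_mon [Lc] * z)"
  by (simp_all add: fkd_mon_rels flip: mult.assoc)

lemma fkd_mon_BBA: "fkd_mon [Lb] * (fkd_mon [Lb] * fkd_mon [La]) = fkd_mon [La] * (fkd_mon [Lb] * fkd_mon [Lb])"
proof -
  have "fkd_mon [Lb] * (fkd_mon [Lb] * fkd_mon [La]) = fkd_mon [Lb] * (fkd_mon [Lc] * fkd_mon [Lb])"
    by (simp only: fkd_mon_rels)
  also have "\<dots> = fkd_mon [La] * (fkd_mon [Lb] * fkd_mon [Lb])"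
    by (rule fkd_mon_rels_assoc)
  finally show ?thesis .
qed

text \<open>The two ways of reducing \<open>BCB\<close> end in \<open>ABB\<close> and
  \<open>ACC\<close>: a relation of degree 3 that the oriented quadratic rules do not produce by
  themselves.\<close>

lemma fkd_mon_ACC: "fkd_mon [La] * (fkd_mon [Lc] * fkd_mon [Lc]) = fkd_mon [La] * (fkd_mon [Lb] * fkd_mon [Lb])"
proof -
  have "fkd_mon [La] * (fkd_mon [Lc] * fkd_mon [Lc]) = fkd_mon [Lb] * (fkd_mon [La] * fkd_mon [Lc])"
    by (rule fkd_mon_rels_assoc(1) [symmetric])
  also have "\<dots> = fkd_mon [Lb] * (fkd_mon [Lb] * fkd_mon [La])"
    by (simp only: fkd_mon_rels)
  finally show ?thesis by (simp only: fkd_mon_BBA)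
qed

text \<open>By \<open>fkd_mon_BBA\<close> the square of \<open>B\<close> commutes with
  \<open>A\<close>, so \<open>ABBB\<close> equals \<open>BBAB\<close>; once \<open>AB\<close> is
  replaced by \<open>CA\<close> in it, the quadratic rules apply again.\<close>

lemma fkd_mon_ABBB: "fkd_mon [La] * (fkd_mon [Lb] * (fkd_mon [Lb] * fkd_mon [Lb])) =
    fkd_mon [La] * (fkd_mon [La] * (fkd_mon [La] * fkd_mon [Lb]))"
proof -
  have "fkd_mon [La] * (fkd_mon [Lb] * (fkd_mon [Lb] * fkd_mon [Lb])) =
      fkd_mon [Lb] * (fkd_mon [Lb] * fkd_mon [La]) * fkd_mon [Lb]"
    by (simp only: fkd_mon_BBA mult.assoc)
  also have "\<dots> = fkd_mon [Lb] * (fkd_mon [Lb] * (fkd_mon [Lc] * fkd_mon [La]))"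
    by (simp only: fkd_mon_rels(2) mult.assoc)
  also have "\<dots> = fkd_mon [La] * (fkd_mon [Lc] * (fkd_mon [Lb] * fkd_mon [La]))"
    by (simp only: fkd_mon_rels_assoc(1,3))
  also have "\<dots> = fkd_mon [La] * (fkd_mon [La] * (fkd_mon [La] * fkd_mon [Lb]))"
    by (simp only: fkd_mon_rels_assoc(4) fkd_mon_rels(2))
  finally show ?thesis .
qed

lemmas fkd_simps = fkd_mon_rels fkd_mon_rels_assoc fkd_mon_ACC fkd_mon_ABBB mult.assoc

text \<open>The normal forms of non-constant words, taken as elements of the algebra so that no
  representative has to be chosen. Length 3 has a base case of its own because \<open>BB\<close> is
  a constant word.\<close>

inductive mixed_monomial :: "nat \<Rightarrow> 'k::field fkd \<Rightarrow> bool" where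
  "mixed_monomial 2 (fkd_mon [La] * fkd_mon [Lb])"
| "mixed_monomial 2 (fkd_mon [La] * fkd_mon [Lc])"
| "mixed_monomial 3 (fkd_mon [La] * (fkd_mon [Lb] * fkd_mon [Lb]))"
| "mixed_monomial n x \<Longrightarrow> mixed_monomial (Suc n) (fkd_mon [La] * x)"

text \<open>Leading letters \<open>La\<close> are untouched by multiplication from the right, so
  only the three base monomials times a letter have to be reduced.\<close>

lemma mixed_monomial_mult:
  "mixed_monomial n x \<Longrightarrow> mixed_monomial (Suc n) (x * fkd_mon [l])"
proof (induction rule: mixed_monomial.induct)
  case (4 n x)
  then show ?case by (metis mixed_monomial.intros(4) mult.assoc)
qed (cases l; simp add: fkd_simps numeral_2_eq_2 numeral_3_eq_3;
  intro mixed_monomial.intros mixed_monomial.intros [unfolded numeral_2_eq_2 numeral_3_eq_3])+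

lemma mixed_monomial_basis:
  "mixed_monomial n x \<Longrightarrow> x \<in> fkd_mon ` fkd_basis n"
proof -
  assume "mixed_monomial n x"
  then have "\<exists>k. \<exists>t\<in>{[Lb], [Lc], [Lb, Lb]}. n = k + 1 + length t \<and> x = fkd_mon (replicate (k + 1) La @ t)"
  proof (induction rule: mixed_monomial.induct)
    case (4 n x)
    then obtain k t where "t \<in> {[Lb], [Lc], [Lb, Lb]}" "n = k + 1 + length t"
        "x = fkd_mon (replicate (k + 1) La @ t)" by blast
    then show ?case
      by (intro exI [of _ "Suc k"] bexI [of _ t]) (simp_all flip: fkd_mon_append)
  qed (intro exI [of _ 0], simp flip: fkd_mon_append)+
  then show "x \<in> fkd_mon ` fkd_basis n"
    by (auto simp: fkd_basis_def)
qed

text \<open>This is the moment at which a word stops being constant. If it does not begin with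
  \<open>La\<close>, its last two letters are rewritten to begin with \<open>La\<close>, which
  reduces to the case of a constant block followed by \<open>La\<close>.\<close>

lemma mixed_monomial_constant_snoc:
  assumes "k \<noteq> l"
  shows "mixed_monomial (n + 2) (fkd_mon (replicate (n + 1) k @ [l]) :: 'k::field fkd)"
proof -
  have step: "fkd_mon (replicate (Suc n + 1) k @ [l]) = fkd_mon (replicate (n + 1) k) * (fkd_mon [k] * fkd_mon [l])"
    for n and k l :: letter
    by (simp add: replicate_app_Cons_same flip: fkd_mon_append)
  have one: "fkd_mon (replicate (0 + 1) k @ [l]) = fkd_mon [k] * fkd_mon [l]" for k l
    by (simp flip: fkd_mon_append)
  note base = mixed_monomial.intros(1,2) [unfolded numeral_2_eq_2]
  have A: "mixed_monomial (n + 2) (fkd_mon (replicate (n + 1) La @ [l]) :: 'k fkd)" if "l \<noteq> La" for l n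
  proof (induction n)
    case 0
    then show ?case unfolding one using that base by (cases l) auto
  next
    case (Suc n)
    then show ?case using mixed_monomial.intros(4) [OF Suc] by (simp flip: fkd_mon_append)
  qed
  have "mixed_monomial (n + 2) (fkd_mon (replicate (n + 1) k @ [La]) :: 'k fkd)" if k: "k \<noteq> La" for n k
  proof (induction n)
    case 0
    then show ?case unfolding one using that base by (cases k) (auto simp: fkd_simps)
  next
    case (Suc n)
    \<comment> \<open>Rewriting the last two letters shortens the constant block by one and leaves a
      word of the same shape times one further letter.\<close>
    obtain l where "fkd_mon [k] * fkd_mon [La] = (fkd_mon [La] * fkd_mon [l] :: 'k fkd)"
      using k fkd_mon_rels [where 'k = 'k] by (cases k) auto
    then have "fkd_mon (replicate (Suc n + 1) k @ [La]) = fkd_mon (replicate (n + 1) k @ [La]) * (fkd_mon [l] :: 'k fkd)"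
      by (subst step) (simp only: fkd_mon_append mult.assoc)
    then show ?case
      using mixed_monomial_mult [OF Suc] by simp
  qed note toA = this
  have "mixed_monomial (n + 2) (fkd_mon (replicate (n + 1) k @ [l]) :: 'k fkd)"
    if kl: "k \<noteq> La" "l \<noteq> La" "k \<noteq> l" for n k l
  proof (cases n)
    case 0
    then show ?thesis
      unfolding 0 one using that base by (cases k; cases l) (auto simp: fkd_simps)
  next
    case (Suc n')
    obtain l' where "fkd_mon [k] * fkd_mon [l] = (fkd_mon [La] * fkd_mon [l'] :: 'k fkd)"
      using kl fkd_mon_rels [where 'k = 'k] by (cases k; cases l) auto
    then have "fkd_mon (replicate (Suc n' + 1) k @ [l]) = fkd_mon (replicate (n' + 1) k @ [La]) * (fkd_mon [l'] :: 'k fkd)"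
      by (subst step) (simp only: fkd_mon_append mult.assoc)
    then show ?thesis
      using mixed_monomial_mult [OF toA [OF kl(1), of n']] Suc by simp
  qed
  then show ?thesis using A toA assms by (metis (full_types))
qed

text \<open>Since the relations are binomial, a monomial equals a single basis monomial and not
  merely a combination. When letters are appended one by one, a word stays constant for a while and,
  once mixed, remains mixed.\<close>

lemma fkd_mon_in_basis: "fkd_mon w \<in> (fkd_mon ` fkd_basis (length w) :: 'k::field fkd set)"
proof -
  have "(\<exists>k. w = replicate (length w) k) \<or> mixed_monomial (length w) (fkd_mon w :: 'k fkd)"
  proof (induction w rule: rev_induct)
    case (snoc l w)
    then consider k where "w = replicate (length w) k" | "mixed_monomial (length w) (fkd_mon w :: 'k fkd)"
      by blast
    then show ?case
    proof cases
      case 1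
      show ?thesis
      proof (cases "k = l \<or> w = []")
        case True
        then have "w @ [l] = replicate (Suc (length w)) l" using 1
          by (metis append_Nil length_0_conv replicate_0 replicate_Suc replicate_append_same)
        then show ?thesis by auto
      next
        case False
        then obtain n where n: "length w = n + 1" by (cases w) auto
        have "mixed_monomial (n + 2) (fkd_mon (w @ [l]) :: 'k fkd)"
          using mixed_monomial_constant_snoc [of k l n] False 1 n by metis
        then show ?thesis using n by simp
      qed
    qed (simp add: fkd_mon_append mixed_monomial_mult)
  qed simp
  moreover have "replicate n k \<in> fkd_basis n" for n k
    by (cases k) (auto simp: fkd_basis_def)
  ultimately show ?thesis
    using mixed_monomial_basis by (metis imageI)
qed

section \<open>The usual basis of the quadratic dual and its dual basis\<close>

lemma fkd_mon_inj: "inj_on (fkd_mon :: _ \<Rightarrow> 'k::field fkd) (\<Union>n. fkd_basis n)"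
proof (rule inj_onI)
  fix m m' assume m: "m \<in> (\<Union>n. fkd_basis n)" "m' \<in> (\<Union>n. fkd_basis n)"
    and eq: "fkd_mon m = (fkd_mon m' :: 'k fkd)"
  have "key_functional (word_key m) (fkd_mon m :: 'k fkd) = 1"
    by (simp add: key_functional_mon)
  then have "word_key m = word_key m'"
    unfolding eq by (simp add: key_functional_mon of_bool_def split: if_splits)
  then show "m = m'" using m word_key_inj by blast
qed

text \<open>The indicator of the key of \<open>m\<close> is 1 on \<open>m\<close> and 0 on all other
  basis monomials, hence 0 on their span.\<close>

lemma independent_fkd_basis: "fkd.independent (fkd_mon ` (\<Union>n. fkd_basis n) :: 'k::field fkd set)"
  unfolding fkd.dependent_def
proof clarify
  let ?B = "fkd_mon ` (\<Union>n. fkd_basis n) :: 'k fkd set"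
  fix m n assume m: "m \<in> fkd_basis n" and span: "fkd_mon m \<in> fkd.span (?B - {fkd_mon m})"
  note lin = linear_key_functional [of "word_key m", where 'k = 'k]
  have zero: "key_functional (word_key m) b = 0" if "b \<in> ?B - {fkd_mon m}" for b :: "'k fkd"
    using that word_key_inj [OF _ m] by (force simp: key_functional_mon)
  have "key_functional (word_key m) x = 0" if "x \<in> fkd.span (?B - {fkd_mon m})" for x
    using that
    by (induction rule: fkd.span_induct_alt)
      (auto simp: linearD_zero [OF lin] linearD_add [OF lin] linearD_scale [OF lin] zero)
  from this [OF span] show False by (simp add: key_functional_mon)
qed

lemma span_fkd_basis: "fkd.span (fkd_mon ` (\<Union>n. fkd_basis n)) = (UNIV :: 'k::field fkd set)"
proof -
  have "range fkd_mon \<subseteq> (fkd_mon ` (\<Union>n. fkd_basis n) :: 'k fkd set)"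
    using fkd_mon_in_basis by fast
  then show ?thesis using fkd_span_mon fkd.span_mono by blast
qed

lemma linear_dual_mon: "Vector_Spaces.linear fkd_scale (*) (dual_mon m :: 'k::field fkd \<Rightarrow> 'k)"
  using fkd.linear_representation [OF independent_fkd_basis span_fkd_basis, of "fkd_mon m"]
  by (simp add: dual_mon_def [abs_def])

lemma dual_mon_basis:
  assumes "m \<in> fkd_basis n" "m' \<in> fkd_basis n'"
  shows "dual_mon m (fkd_mon m' :: 'k::field fkd) = of_bool (m = m')"
proof -
  have "fkd_mon m' \<in> (fkd_mon ` (\<Union>n. fkd_basis n) :: 'k fkd set)"
    using assms by blast
  moreover have "fkd_mon m = (fkd_mon m' :: 'k fkd) \<longleftrightarrow> m = m'"
    using assms by (intro inj_on_eq_iff [OF fkd_mon_inj]) auto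
  ultimately show ?thesis
    by (simp add: dual_mon_def fkd.representation_basis [OF independent_fkd_basis])
qed

lemma dual_mon_in_dual:
  assumes "m \<in> fkd_basis n"
  shows "dual_mon m \<in> (fkd_dual n :: ('k::field fkd \<Rightarrow> 'k) set)"
proof -
  have "dual_mon m (fkd_mon w :: 'k fkd) = 0" if "length w \<noteq> n" for w
  proof -
    obtain m' where m': "m' \<in> fkd_basis (length w)" "fkd_mon w = (fkd_mon m' :: 'k fkd)"
      using fkd_mon_in_basis by blast
    then show ?thesis
      using that length_fkd_basis [OF assms] length_fkd_basis [OF m'(1)]
        dual_mon_basis [OF assms m'(1), where 'k = 'k] by auto
  qed
  then show ?thesis by (simp add: fkd_dual_def linear_dual_mon)
qed

text \<open>Both sides are linear, and every monomial equals a basis monomial of its own length,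
  where the dual basis can be evaluated.\<close>

lemma fkd_dual_expand:
  fixes u :: "'k::field fkd \<Rightarrow> 'k"
  assumes "u \<in> fkd_dual n"
  shows "u = (\<lambda>v. \<Sum>m\<in>fkd_basis n. u (fkd_mon m) * dual_mon m v)"
proof
  fix v
  have lin: "Vector_Spaces.linear fkd_scale (*) u" and zero: "\<And>w. length w \<noteq> n \<Longrightarrow> u (fkd_mon w) = 0"
    using assms by (auto simp: fkd_dual_def)
  have lin': "Vector_Spaces.linear fkd_scale (*) (\<lambda>v. \<Sum>m\<in>fkd_basis n. u (fkd_mon m) * dual_mon m v)"
    by (rule linearI [OF fkd_vs vector_space_mult])
      (auto simp: linearD_add [OF linear_dual_mon] linearD_scale [OF linear_dual_mon] sum.distrib
        sum_distrib_left algebra_simps)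
  show "u v = (\<Sum>m\<in>fkd_basis n. u (fkd_mon m) * dual_mon m v)"
  proof (rule fkd_linear_eqI [OF lin lin'])
    fix w
    obtain m' where m': "m' \<in> fkd_basis (length w)" "fkd_mon w = (fkd_mon m' :: 'k fkd)"
      using fkd_mon_in_basis by blast
    show "u (fkd_mon w) = (\<Sum>m\<in>fkd_basis n. u (fkd_mon m) * dual_mon m (fkd_mon w))"
    proof (cases "length w = n")
      case True
      have "(\<Sum>m\<in>fkd_basis n. u (fkd_mon m) * dual_mon m (fkd_mon w)) =
          (\<Sum>m\<in>fkd_basis n. if m = m' then u (fkd_mon m) else 0)"
        using m' True by (intro sum.cong) (auto simp: dual_mon_basis)
      then show ?thesis using m' True by simp
    next
      case False
      have "dual_mon m (fkd_mon w :: 'k fkd) = 0" if "m \<in> fkd_basis n" for m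
        using dual_mon_in_dual [OF that, where 'k = 'k] False by (simp add: fkd_dual_def)
      then show ?thesis using zero [OF False] by simp
    qed
  qed
qed

section \<open>The algebra \<open>FK(3)\<close>\<close>

text \<open>Oriented so that \<open>c\<close> disappears whenever it stands directly to the left of
  \<open>a\<close> or \<open>b\<close>.\<close>

lemma fk_mon_rels:
  "fk_mon [La] * fk_mon [La] = (0 :: 'k::field fk)"
  "fk_mon [Lb] * fk_mon [Lb] = (0 :: 'k fk)"
  "fk_mon [Lc] * fk_mon [Lc] = (0 :: 'k fk)"
  "fk_mon [Lc] * fk_mon [La] = - (fk_mon [La] * fk_mon [Lb]) - (fk_mon [Lb] * fk_mon [Lc] :: 'k fk)"
  "fk_mon [Lc] * fk_mon [Lb] = - (fk_mon [Lb] * fk_mon [La]) - (fk_mon [La] * fk_mon [Lc] :: 'k fk)"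
proof -
  have *: "abs_fk r = 0" if "r \<in> (fk_rels :: 'k free_alg set)" for r
    using that ideal_generated_superset [of fk_rels] Quotient3_rel_abs [OF Quotient3_fk, of r 0]
    by (auto simp: zero_fk.abs_eq)
  have "fk_mon [La, La] = (0 :: 'k fk)" "fk_mon [Lb, Lb] = (0 :: 'k fk)" "fk_mon [Lc, Lc] = (0 :: 'k fk)"
    "fk_mon [La, Lb] + fk_mon [Lb, Lc] + fk_mon [Lc, La] = (0 :: 'k fk)"
    "fk_mon [Lb, La] + fk_mon [La, Lc] + fk_mon [Lc, Lb] = (0 :: 'k fk)"
    unfolding fk_mon.abs_eq plus_fk.abs_eq by (rule *; simp add: fk_rels_def)+
  then have "fk_mon [La] * fk_mon [La] = (0 :: 'k fk)" "fk_mon [Lb] * fk_mon [Lb] = (0 :: 'k fk)"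
    "fk_mon [Lc] * fk_mon [Lc] = (0 :: 'k fk)"
    "fk_mon [La] * fk_mon [Lb] + fk_mon [Lb] * fk_mon [Lc] + fk_mon [Lc] * fk_mon [La] = (0 :: 'k fk)"
    "fk_mon [Lb] * fk_mon [La] + fk_mon [La] * fk_mon [Lc] + fk_mon [Lc] * fk_mon [Lb] = (0 :: 'k fk)"
    by (simp_all flip: fk_mon_append)
  then show
    "fk_mon [La] * fk_mon [La] = (0 :: 'k::field fk)"
    "fk_mon [Lb] * fk_mon [Lb] = (0 :: 'k fk)"
    "fk_mon [Lc] * fk_mon [Lc] = (0 :: 'k fk)"
    "fk_mon [Lc] * fk_mon [La] = - (fk_mon [La] * fk_mon [Lb]) - (fk_mon [Lb] * fk_mon [Lc] :: 'k fk)"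
    "fk_mon [Lc] * fk_mon [Lb] = - (fk_mon [Lb] * fk_mon [La]) - (fk_mon [La] * fk_mon [Lc] :: 'k fk)"
    by (auto simp: eq_neg_iff_add_eq_0 algebra_simps)
qed

lemma fk_mon_rels_assoc:
  "fk_mon [La] * (fk_mon [La] * z) = 0"
  "fk_mon [Lb] * (fk_mon [Lb] * z) = 0"
  "fk_mon [Lc] * (fk_mon [Lc] * z) = 0"
  "fk_mon [Lc] * (fk_mon [La] * z) = - (fk_mon [La] * (fk_mon [Lb] * z)) - fk_mon [Lb] * (fk_mon [Lc] * z)"
  "fk_mon [Lc] * (fk_mon [Lb] * z) = - (fk_mon [Lb] * (fk_mon [La] * z)) - fk_mon [La] * (fk_mon [Lc] * z)"
  by (simp_all add: fk_mon_rels algebra_simps flip: mult.assoc)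

text \<open>The braid relation, from the overlap \<open>caa\<close>: it vanishes by
  \<open>aa = 0\<close>, while reducing \<open>ca\<close> first leaves
  \<open>bab - aba\<close>.\<close>

lemma fk_mon_BAB: "fk_mon [Lb] * (fk_mon [La] * fk_mon [Lb]) = fk_mon [La] * (fk_mon [Lb] * fk_mon [La] :: 'k::field fk)"
proof -
  have "0 = fk_mon [Lc] * (fk_mon [La] * fk_mon [La] :: 'k fk)"
    by (simp add: fk_mon_rels)
  also have "\<dots> = - (fk_mon [La] * (fk_mon [Lb] * fk_mon [La])) - fk_mon [Lb] * (fk_mon [Lc] * fk_mon [La])"
    by (rule fk_mon_rels_assoc)
  finally show ?thesis
    by (simp add: fk_mon_rels fk_mon_rels_assoc algebra_simps)
qed

lemma fk_mon_BAB_assoc: "fk_mon [Lb] * (fk_mon [La] * (fk_mon [Lb] * z)) = fk_mon [La] * (fk_mon [Lb] * (fk_mon [La] * z))"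
  using arg_cong [OF fk_mon_BAB, of "\<lambda>x. x * z"] by (simp add: mult.assoc)

lemmas fk_simps = fk_mon_rels fk_mon_rels_assoc fk_mon_BAB fk_mon_BAB_assoc algebra_simps

text \<open>Basis words times a letter are reduced by the oriented relations and the braid relation.
  Lengths are tracked because each homogeneous part is later spanned by the basis words of its own
  degree.\<close>

lemma fk_mon_in_span_basis:
  "fk_mon w \<in> fk.span (fk_mon ` {v \<in> fk_basis. length v = length w} :: 'k::field fk set)"
proof (induction w rule: rev_induct)
  case Nil
  then show ?case by (intro fk.span_base) (auto simp: fk_basis_def intro!: image_eqI [of _ _ "[]"])
next
  case (snoc l w)
  let ?S = "\<lambda>n. fk.span (fk_mon ` {v \<in> fk_basis. length v = n} :: 'k fk set)"
  have base: "fk_mon v \<in> ?S n" if "v \<in> fk_basis" "length v = n" for v n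
    using that by (intro fk.span_base) auto
  \<comment> \<open>Rewriting leaves products bracketed to the right, so the memberships in
    \<open>mem\<close> are stated in that form.\<close>
  have three: "fk_mon [x, y, z] = (fk_mon [x] * (fk_mon [y] * fk_mon [z]) :: 'k fk)"
    and two: "fk_mon [x, y] = (fk_mon [x] * fk_mon [y] :: 'k fk)"
    and four: "fk_mon [x, y, z, t] = (fk_mon [x] * (fk_mon [y] * (fk_mon [z] * fk_mon [t])) :: 'k fk)" for x y z t
    by (simp_all flip: fk_mon_append)
  have mem: "fk_mon [x] \<in> ?S (Suc 0)"
    "fk_mon [La] * fk_mon [Lb] \<in> ?S (Suc (Suc 0))" "fk_mon [Lb] * fk_mon [Lc] \<in> ?S (Suc (Suc 0))"
    "fk_mon [Lb] * fk_mon [La] \<in> ?S (Suc (Suc 0))" "fk_mon [La] * fk_mon [Lc] \<in> ?S (Suc (Suc 0))"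
    "fk_mon [La] * (fk_mon [Lb] * fk_mon [La]) \<in> ?S (Suc (Suc (Suc 0)))"
    "fk_mon [La] * (fk_mon [Lb] * fk_mon [Lc]) \<in> ?S (Suc (Suc (Suc 0)))"
    "fk_mon [Lb] * (fk_mon [La] * fk_mon [Lc]) \<in> ?S (Suc (Suc (Suc 0)))"
    "fk_mon [La] * (fk_mon [Lb] * (fk_mon [La] * fk_mon [Lc])) \<in> ?S (Suc (Suc (Suc (Suc 0))))" for x
    unfolding four [symmetric]
    unfolding three [symmetric]
    unfolding two [symmetric]
    by (rule base; cases x; simp add: fk_basis_def)+
  have step: "fk_mon v * fk_mon [l] \<in> ?S (Suc (length v))" if v: "v \<in> fk_basis" for v
  proof -
    note intros = fk.span_zero fk.span_diff fk.span_neg mem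
    from v consider "v = []" | x where "v = [x]" |
      "v = [La, Lb]" | "v = [Lb, Lc]" | "v = [Lb, La]" | "v = [La, Lc]" |
      "v = [La, Lb, La]" | "v = [La, Lb, Lc]" | "v = [Lb, La, Lc]" | "v = [La, Lb, La, Lc]"
      unfolding fk_basis_def by blast
    then show ?thesis
    proof cases
      case 1
      then show ?thesis by (simp add: mem)
    next
      case (2 x)
      then show ?thesis
        by (cases x; cases l; simp add: fk_mon_rels; intro intros)
    qed (cases l; simp add: two three four fk_mon_rels fk_mon_rels_assoc fk_mon_BAB fk_mon_BAB_assoc
        mult.assoc right_diff_distrib; intro intros)+
  qed
  have "x * fk_mon [l] \<in> ?S (Suc n)" if "x \<in> ?S n" for x n
    using that
    by (induction rule: fk.span_induct_alt)
      (auto simp: fk.span_zero distrib_right fk_scale_mult_left intro!: fk.span_add fk.span_scale step)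
  from this [OF snoc] show ?case by (simp add: fk_mon_append)
qed


section \<open>The grading of \<open>FK(3)\<close> and its derivations\<close>

lemma
  shows fk_deg_zero: "0 \<in> fk_deg N"
    and fk_deg_add: "x \<in> fk_deg N \<Longrightarrow> y \<in> fk_deg N \<Longrightarrow> x + y \<in> fk_deg N"
    and fk_deg_diff: "x \<in> fk_deg N \<Longrightarrow> y \<in> fk_deg N \<Longrightarrow> x - y \<in> fk_deg N"
    and fk_deg_scale: "x \<in> fk_deg N \<Longrightarrow> fk_scale c x \<in> fk_deg N"
    and fk_deg_mon: "fk_mon w \<in> fk_deg (int (length w))"
  unfolding fk_deg_def
  by (auto intro: fk.span_zero fk.span_add fk.span_diff fk.span_scale fk.span_base)

lemma fk_deg_one: "1 \<in> fk_deg 0"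
  using fk_deg_mon [of "[]"] by simp

lemma fk_deg_mult:
  assumes "x \<in> fk_deg s" "y \<in> fk_deg t"
  shows "x * y \<in> fk_deg (s + t)"
proof -
  have 1: "fk_mon v * y \<in> fk_deg (int (length v) + t)" for v
    using assms(2) unfolding fk_deg_def [of t]
  proof (induction rule: fk.span_induct_alt)
    case (step c z y)
    then obtain w where "z = fk_mon w" "int (length w) = t" by blast
    then have "fk_mon v * z \<in> fk_deg (int (length v) + t)"
      using fk_deg_mon [of "v @ w"] by (simp add: fk_mon_append)
    then show ?case
      using step by (simp add: distrib_left fk_scale_mult_right fk_deg_add fk_deg_scale)
  qed (simp add: fk_deg_zero)
  show ?thesis
    using assms(1) unfolding fk_deg_def [of s]
    by (induction rule: fk.span_induct_alt)
      (auto simp: fk_deg_zero distrib_right fk_scale_mult_left intro!: fk_deg_add fk_deg_scale 1)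
qed

lemma fk_deg_span_basis:
  fixes x :: "'k::field fk"
  assumes "x \<in> fk_deg N"
  shows "x \<in> fk.span (fk_mon ` {v \<in> fk_basis. int (length v) = N})"
  using assms unfolding fk_deg_def
proof (induction rule: fk.span_induct_alt)
  case (step c x y)
  then obtain w where "x = fk_mon w" "N = int (length w)" by blast
  then have "x \<in> fk.span (fk_mon ` {v \<in> fk_basis. int (length v) = N})"
    using fk_mon_in_span_basis [of w, where 'k = 'k] by simp
  then show ?case
    using step by (intro fk.span_add fk.span_scale)
qed (rule fk.span_zero)

lemma fk_deg_induct [case_names add hom]:
  fixes x :: "'k::field fk"
  assumes "\<And>x y. P x \<Longrightarrow> P y \<Longrightarrow> P (x + y)" "\<And>N x. x \<in> fk_deg N \<Longrightarrow> P x"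
  shows "P x"
  using fk_span_mon [of x]
  by (induction rule: fk.span_induct_alt)
    (auto intro!: assms(1) intro: assms(2) fk_deg_zero fk_deg_scale fk_deg_mon)

lemma
  assumes "fk_derivation \<rho>"
  shows linear_fk_derivation: "Vector_Spaces.linear fk_scale fk_scale \<rho>"
    and fk_derivation_mult: "\<rho> (x * y) = \<rho> x * y + x * \<rho> y"
    and fk_derivation_one: "\<rho> 1 = 0"
proof -
  show "Vector_Spaces.linear fk_scale fk_scale \<rho>" and *: "\<rho> (x * y) = \<rho> x * y + x * \<rho> y" for x y
    using assms by (auto simp: fk_derivation_def)
  show "\<rho> 1 = 0" using * [of 1 1] by simp
qed

lemma fk_derivation_eqI:
  fixes \<rho> :: "'k::field fk \<Rightarrow> 'k fk"
  assumes "fk_derivation \<rho>" "fk_derivation \<rho>'" "\<And>l. \<rho> (fk_mon [l]) = \<rho>' (fk_mon [l])"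
  shows "\<rho> x = \<rho>' x"
proof (rule fk_linear_eqI [OF linear_fk_derivation [OF assms(1)] linear_fk_derivation [OF assms(2)]])
  show "\<rho> (fk_mon w) = \<rho>' (fk_mon w)" for w
  proof (induction w)
    case Nil
    then show ?case using assms(1,2) by (simp add: fk_derivation_one)
  next
    case (Cons l w)
    have "fk_mon (l # w) = (fk_mon [l] * fk_mon w :: 'k fk)" by (simp flip: fk_mon_append)
    then show ?case using Cons assms by (simp add: fk_derivation_mult)
  qed
qed

section \<open>The Euler derivation\<close>

definition euler :: "'k::field fk \<Rightarrow> 'k fk"
  where "euler = fk_lift fk_scale (\<lambda>w. fk_scale (of_nat (length w)) (fk_mon w))"

text \<open>Well defined because the relations are homogeneous: all words in
  \<open>word u * r * word v\<close> have the same length, so one scalar factors out of the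
  relation.\<close>

lemma
  shows linear_euler: "Vector_Spaces.linear fk_scale fk_scale (euler :: 'k::field fk \<Rightarrow> 'k fk)"
    and euler_mon: "euler (fk_mon w :: 'k fk) = fk_scale (of_nat (length w)) (fk_mon w)"
proof -
  let ?\<theta> = "\<lambda>w. fk_scale (of_nat (length w)) (fk_mon w) :: 'k fk"
  note lin = linear_pm_ext [OF fk_vs, of ?\<theta>]
  have *: "pm_ext fk_scale ?\<theta> (word u * r * word v) = 0" if r: "r \<in> fk_rels" for u v and r :: "'k free_alg"
  proof -
    have mon: "fk_mon (u @ x # y # v) = fk_mon u * (fk_mon [x] * fk_mon [y]) * (fk_mon v :: 'k fk)" for x y
      by (simp flip: fk_mon_append)
    have "fk_scale c (fk_mon (u @ La # La # v)) = (0 :: 'k fk)" "fk_scale c (fk_mon (u @ Lb # Lb # v)) = (0 :: 'k fk)"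
      "fk_scale c (fk_mon (u @ Lc # Lc # v)) = (0 :: 'k fk)"
      "fk_scale c (fk_mon (u @ La # Lb # v)) + fk_scale c (fk_mon (u @ Lb # Lc # v))
        + fk_scale c (fk_mon (u @ Lc # La # v)) = (0 :: 'k fk)"
      "fk_scale c (fk_mon (u @ Lb # La # v)) + fk_scale c (fk_mon (u @ La # Lc # v))
        + fk_scale c (fk_mon (u @ Lc # Lb # v)) = (0 :: 'k fk)" for c
      unfolding mon by (simp_all add: fk_mon_rels algebra_simps flip: fk.scale_right_distrib)
    then show ?thesis
      using r unfolding fk_rels_def
      by (elim insertE emptyE; simp add: distrib_left distrib_right word_mult linearD_add [OF lin]
          pm_ext_single [OF fk_vs])
  qed
  show "Vector_Spaces.linear fk_scale fk_scale (euler :: 'k fk \<Rightarrow> 'k fk)"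
    "euler (fk_mon w :: 'k fk) = fk_scale (of_nat (length w)) (fk_mon w)"
    unfolding euler_def
    using linear_fk_lift [OF fk_vs *] fk_lift_mon [OF fk_vs *] by blast+
qed

lemma linear_eigenspace_fk_deg:
  fixes x :: "'k::field fk"
  assumes lin: "Vector_Spaces.linear fk_scale fk_scale \<rho>"
    and mon: "\<And>w. \<rho> (fk_mon w) = fk_scale (of_nat (length w)) (fk_mon w)" and x: "x \<in> fk_deg N"
  shows "\<rho> x = fk_scale (of_int N) x"
  using x unfolding fk_deg_def
  by (induction rule: fk.span_induct_alt)
    (auto simp: linearD_zero [OF lin] linearD_add [OF lin] linearD_scale [OF lin] mon
      fk.scale_right_distrib mult.commute)

lemma euler_deg: "x \<in> fk_deg N \<Longrightarrow> euler x = fk_scale (of_int N) x"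
  using linear_eigenspace_fk_deg [OF linear_euler euler_mon] .

text \<open>Degrees add under multiplication, so on homogeneous factors the Leibniz rule is
  distributivity of the eigenvalues.\<close>

lemma fk_derivation_euler: "fk_derivation (euler :: 'k::field fk \<Rightarrow> 'k fk)"
  unfolding fk_derivation_def
proof (intro conjI allI linear_euler)
  fix x y :: "'k fk"
  show "euler (x * y) = euler x * y + x * euler y"
  proof (induction x rule: fk_deg_induct)
    case (hom s x)
    note x = this
    show ?case
    proof (induction y rule: fk_deg_induct)
      case (hom t y)
      note y = this
      show ?case
        by (simp add: euler_deg [OF fk_deg_mult [OF x y]] euler_deg [OF x] euler_deg [OF y]
            fk_scale_mult_left fk_scale_mult_right fk.scale_left_distrib)
    next
      case (add y y')
      then show ?case by (simp add: linearD_add [OF linear_euler] distrib_left)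
    qed
  next
    case (add x x')
    then show ?case by (simp add: linearD_add [OF linear_euler] distrib_right)
  qed
qed

lemma euler_derivation_iff: "euler_derivation \<rho> \<longleftrightarrow> \<rho> = (euler :: 'k::field fk \<Rightarrow> 'k fk)"
proof
  assume \<rho>: "euler_derivation \<rho>"
  then have der: "fk_derivation \<rho>" by (simp add: euler_derivation_def)
  have "\<rho> (fk_mon [l]) = euler (fk_mon [l])" for l
  proof -
    have "[l] \<in> fk_basis" by (cases l) (simp_all add: fk_basis_def)
    then show ?thesis using \<rho> by (simp add: euler_derivation_def euler_mon)
  qed
  then show "\<rho> = euler"
    by (rule ext [OF fk_derivation_eqI [OF der fk_derivation_euler]])
next
  assume "\<rho> = euler"
  then show "euler_derivation \<rho>"
    by (simp add: euler_derivation_def fk_derivation_euler euler_mon)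
qed

section \<open>Bimodules\<close>

text \<open>Both actions of \<open>fk_scale c 1\<close> must agree with the ambient scalar
  multiplication, which makes bimodule maps linear over the field (\<open>bimod_hom_scale\<close>).
  The laws are confined to the carrier: in the bar bimodules the action of 1 kills the other tensor
  powers.\<close>

locale fk_bimodule = vector_space sc
  for sc :: "'k::field \<Rightarrow> 'm::ab_group_add \<Rightarrow> 'm" +
  fixes M :: "('k fk, 'm) bimodule"
  assumes zero_carr: "0 \<in> carr M"
    and add_carr: "m \<in> carr M \<Longrightarrow> m' \<in> carr M \<Longrightarrow> m + m' \<in> carr M"
    and lact_carr: "m \<in> carr M \<Longrightarrow> lact M x m \<in> carr M"
    and ract_carr: "m \<in> carr M \<Longrightarrow> ract M m x \<in> carr M"
    and lact_add_right: "m \<in> carr M \<Longrightarrow> m' \<in> carr M \<Longrightarrow> lact M x (m + m') = lact M x m + lact M x m'"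
    and lact_add_left: "m \<in> carr M \<Longrightarrow> lact M (x + y) m = lact M x m + lact M y m"
    and ract_add_left: "m \<in> carr M \<Longrightarrow> m' \<in> carr M \<Longrightarrow> ract M (m + m') x = ract M m x + ract M m' x"
    and ract_add_right: "m \<in> carr M \<Longrightarrow> ract M m (x + y) = ract M m x + ract M m y"
    and lact_lact: "m \<in> carr M \<Longrightarrow> lact M x (lact M y m) = lact M (x * y) m"
    and ract_ract: "m \<in> carr M \<Longrightarrow> ract M (ract M m x) y = ract M m (x * y)"
    and ract_lact: "m \<in> carr M \<Longrightarrow> ract M (lact M x m) y = lact M x (ract M m y)"
    and lact_scalar: "m \<in> carr M \<Longrightarrow> lact M (fk_scale c 1) m = sc c m"
    and ract_scalar: "m \<in> carr M \<Longrightarrow> ract M m (fk_scale c 1) = sc c m"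
begin

lemma lact_one: "m \<in> carr M \<Longrightarrow> lact M 1 m = m"
  using lact_scalar [of m 1] by simp

lemma ract_one: "m \<in> carr M \<Longrightarrow> ract M m 1 = m"
  using ract_scalar [of m 1] by simp

lemma scale_carr: "m \<in> carr M \<Longrightarrow> sc c m \<in> carr M"
  using lact_carr [of m "fk_scale c 1"] by (simp add: lact_scalar)

lemma uminus_carr: "m \<in> carr M \<Longrightarrow> - m \<in> carr M"
  using scale_carr [of m "- 1"] by simp

lemma diff_carr: "m \<in> carr M \<Longrightarrow> m' \<in> carr M \<Longrightarrow> m - m' \<in> carr M"
  using add_carr [of m "- m'"] by (simp add: uminus_carr)

lemma sum_carr: "(\<And>i. i \<in> I \<Longrightarrow> g i \<in> carr M) \<Longrightarrow> sum g I \<in> carr M"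
  by (induction I rule: infinite_finite_induct) (auto simp: zero_carr add_carr)

lemma lact_scale_left: "m \<in> carr M \<Longrightarrow> lact M (fk_scale c x) m = sc c (lact M x m)"
  using lact_lact [of m "fk_scale c 1" x] by (simp add: fk_scale_mult_left lact_scalar lact_carr)

lemma lact_scale_right: "m \<in> carr M \<Longrightarrow> lact M x (sc c m) = sc c (lact M x m)"
  using lact_lact [of m x "fk_scale c 1"] by (simp add: fk_scale_mult_right lact_scale_left lact_one)

lemma ract_scale_right: "m \<in> carr M \<Longrightarrow> ract M m (fk_scale c x) = sc c (ract M m x)"
  using ract_ract [of m x "fk_scale c 1"] by (simp add: fk_scale_mult_right ract_scalar ract_carr)

lemma ract_scale_left: "m \<in> carr M \<Longrightarrow> ract M (sc c m) x = sc c (ract M m x)"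
  using ract_ract [of m "fk_scale c 1" x] by (simp add: fk_scale_mult_left ract_scale_right ract_one)

lemma lact_zero: "lact M x 0 = 0"
  using lact_add_right [of 0 0 x] zero_carr by simp

lemma ract_zero: "ract M 0 x = 0"
  using ract_add_left [of 0 0 x] zero_carr by simp

lemma lact_diff: "m \<in> carr M \<Longrightarrow> m' \<in> carr M \<Longrightarrow> lact M x (m - m') = lact M x m - lact M x m'"
  using lact_add_right [of "m - m'" m' x] by (simp add: diff_carr)

lemma ract_diff: "m \<in> carr M \<Longrightarrow> m' \<in> carr M \<Longrightarrow> ract M (m - m') x = ract M m x - ract M m' x"
  using ract_add_left [of "m - m'" m' x] by (simp add: diff_carr)

lemma lact_diff_left: "m \<in> carr M \<Longrightarrow> lact M (x - y) m = lact M x m - lact M y m"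
  using lact_add_left [of m "x - y" y] by simp

lemma ract_diff_right: "m \<in> carr M \<Longrightarrow> ract M m (x - y) = ract M m x - ract M m y"
  using ract_add_right [of m "x - y" y] by simp

lemma lact_zero_left: "m \<in> carr M \<Longrightarrow> lact M 0 m = 0"
  using lact_diff_left [of m 0 0] by simp

lemma ract_zero_right: "m \<in> carr M \<Longrightarrow> ract M m 0 = 0"
  using ract_diff_right [of m 0 0] by simp

lemma lact_uminus_left: "m \<in> carr M \<Longrightarrow> lact M (- x) m = - lact M x m"
  using lact_diff_left [of m 0 x] by (simp add: lact_zero_left)

lemma ract_uminus_right: "m \<in> carr M \<Longrightarrow> ract M m (- x) = - ract M m x"
  using ract_diff_right [of m 0 x] by (simp add: ract_zero_right)

lemma lact_uminus_right: "m \<in> carr M \<Longrightarrow> lact M x (- m) = - lact M x m"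
  using lact_diff [of 0 m x] by (simp add: zero_carr lact_zero)

lemma ract_uminus_left: "m \<in> carr M \<Longrightarrow> ract M (- m) x = - ract M m x"
  using ract_diff [of 0 m x] by (simp add: zero_carr ract_zero)

end

lemma
  assumes "bimod_hom M N h"
  shows bimod_hom_carr: "m \<in> carr M \<Longrightarrow> h m \<in> carr N"
    and bimod_hom_add: "m \<in> carr M \<Longrightarrow> m' \<in> carr M \<Longrightarrow> h (m + m') = h m + h m'"
    and bimod_hom_lact: "m \<in> carr M \<Longrightarrow> h (lact M x m) = lact N x (h m)"
    and bimod_hom_ract: "m \<in> carr M \<Longrightarrow> h (ract M m x) = ract N (h m) x"
  using assms by (auto simp: bimod_hom_def)

lemma bimod_hom_compose:
  assumes "bimod_hom M N h" "bimod_hom N L h'"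
  shows "bimod_hom M L (\<lambda>m. h' (h m))"
  using assms by (simp add: bimod_hom_def)

lemma
  assumes "bimod_hom M N h" "fk_bimodule s M" "fk_bimodule s' N"
  shows bimod_hom_zero: "h 0 = 0"
    and bimod_hom_scale: "m \<in> carr M \<Longrightarrow> h (s c m) = s' c (h m)"
    and bimod_hom_diff: "m \<in> carr M \<Longrightarrow> m' \<in> carr M \<Longrightarrow> h (m - m') = h m - h m'"
proof -
  interpret M: fk_bimodule s M by fact
  interpret N: fk_bimodule s' N by fact
  show "h 0 = 0" using bimod_hom_add [OF assms(1) M.zero_carr M.zero_carr] by simp
  show "m \<in> carr M \<Longrightarrow> h (s c m) = s' c (h m)"
    using bimod_hom_lact [OF assms(1), of m "fk_scale c 1"]
    by (simp add: M.lact_scalar N.lact_scalar bimod_hom_carr [OF assms(1)])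
  show "h (m - m') = h m - h m'" if "m \<in> carr M" "m' \<in> carr M"
    using bimod_hom_add [OF assms(1) M.diff_carr [OF that] that(2)] by simp
qed

lemma
  assumes "bimod_hom M N h" "bimod_hom M N h'" "fk_bimodule s N"
  shows bimod_hom_plus: "bimod_hom M N (\<lambda>m. h m + h' m)"
    and bimod_hom_minus: "bimod_hom M N (\<lambda>m. h m - h' m)"
proof -
  interpret N: fk_bimodule s N by fact
  show "bimod_hom M N (\<lambda>m. h m + h' m)"
    using assms(1,2) by (auto simp: bimod_hom_def N.add_carr N.lact_add_right N.ract_add_left)
  show "bimod_hom M N (\<lambda>m. h m - h' m)"
    using assms(1,2) by (auto simp: bimod_hom_def N.diff_carr N.lact_diff N.ract_diff)
qed

lemma bimod_hom_scale_hom: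
  assumes "bimod_hom M N h" "fk_bimodule s N"
  shows "bimod_hom M N (\<lambda>m. s c (h m))"
proof -
  interpret N: fk_bimodule s N by fact
  show ?thesis
    using assms(1)
    by (auto simp: bimod_hom_def N.scale_carr N.lact_scale_right N.ract_scale_left N.scale_right_distrib)
qed

lemma fk_bimodule_fk: "fk_bimodule fk_scale (fk_bimod :: ('k::field fk, 'k fk) bimodule)"
  by (rule fk_bimodule.intro [OF fk_vs])
    (simp add: fk_bimodule_axioms_def fk_bimod_def algebra_simps fk_scale_mult_left fk_scale_mult_right)

lemma carr_fk_bimod [simp]: "carr fk_bimod = UNIV"
  and lact_fk_bimod [simp]: "lact fk_bimod = (*)"
  and ract_fk_bimod [simp]: "ract fk_bimod = (*)"
  by (simp_all add: fk_bimod_def)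


section \<open>The Koszul bimodules\<close>

lemma abs_kos_eq:
  assumes "p - q \<in> pm.span kos_rels"
  shows "abs_kos p = abs_kos q"
  using assms Quotient3_rel_abs [OF Quotient3_kos, of p q] by blast

lemma
  fixes x :: "'k::field fk"
  shows kos_add_left: "kos (x + x') u y = kos x u y + kos x' u y"
    and kos_add_mid: "kos x (\<lambda>v. u v + u' v) y = kos x u y + kos x u' y"
    and kos_add_right: "kos x u (y + y') = kos x u y + kos x u y'"
    and kos_scale_left: "kos (fk_scale c x) u y = kos_scale c (kos x u y)"
    and kos_scale_mid: "kos x (\<lambda>v. c * u v) y = kos_scale c (kos x u y)"
    and kos_scale_right: "kos x u (fk_scale c y) = kos_scale c (kos x u y)"
proof -
  have *: "abs_kos p = abs_kos q + abs_kos q'" if "p - q - q' \<in> kos_rels"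
    for p q q' :: "'k fk \<times> ('k fkd \<Rightarrow> 'k) \<times> 'k fk \<Rightarrow>\<^sub>0 'k"
    using that unfolding plus_kos.abs_eq by (intro abs_kos_eq pm.span_base) (simp add: diff_diff_add)
  have **: "abs_kos p = abs_kos q" if "p - q \<in> kos_rels"
    for p q :: "'k fk \<times> ('k fkd \<Rightarrow> 'k) \<times> 'k fk \<Rightarrow>\<^sub>0 'k"
    using that by (intro abs_kos_eq pm.span_base)
  show "kos (x + x') u y = kos x u y + kos x' u y"
    unfolding kos_def
    by (rule *, unfold kos_rels_def)
      (rule UnI1, rule UnI1, rule UnI1, rule UnI1, rule UnI1, intro CollectI exI conjI, rule refl, rule TrueI)
  show "kos x (\<lambda>v. u v + u' v) y = kos x u y + kos x u' y"
    unfolding kos_def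
    by (rule *, unfold kos_rels_def)
      (rule UnI1, rule UnI1, rule UnI1, rule UnI1, rule UnI2, intro CollectI exI conjI, rule refl, rule TrueI)
  show "kos x u (y + y') = kos x u y + kos x u y'"
    unfolding kos_def
    by (rule *, unfold kos_rels_def)
      (rule UnI1, rule UnI1, rule UnI1, rule UnI2, intro CollectI exI conjI, rule refl, rule TrueI)
  show "kos (fk_scale c x) u y = kos_scale c (kos x u y)"
    unfolding kos_def kos_scale.abs_eq pm_scale_single mult_1_right
    by (rule **, unfold kos_rels_def)
      (rule UnI1, rule UnI1, rule UnI2, intro CollectI exI conjI, rule refl, rule TrueI)
  show "kos x (\<lambda>v. c * u v) y = kos_scale c (kos x u y)"
    unfolding kos_def kos_scale.abs_eq pm_scale_single mult_1_right
    by (rule **, unfold kos_rels_def)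
      (rule UnI1, rule UnI2, intro CollectI exI conjI, rule refl, rule TrueI)
  show "kos x u (fk_scale c y) = kos_scale c (kos x u y)"
    unfolding kos_def kos_scale.abs_eq pm_scale_single mult_1_right
    by (rule **, unfold kos_rels_def)
      (rule UnI2, intro CollectI exI conjI, rule refl, rule TrueI)
qed

lemma trilinear_kos: "trilinear kos_scale kos"
  unfolding trilinear_def
  by (intro conjI allI) (rule kos_add_left kos_add_mid kos_add_right kos_scale_left kos_scale_mid kos_scale_right)+

lemma kos_zero [simp]: "kos 0 u y = 0" "kos x u 0 = 0"
  using kos_add_left [of 0 0 u y] kos_add_right [of x u 0 0] by simp_all

lemma kos_zero_mid [simp]: "kos x (\<lambda>v. 0) y = 0"
  using kos_scale_mid [of x 0 "\<lambda>v. 0" y] by simp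

lemma kos_sum_mid:
  "kos x (\<lambda>v. \<Sum>i\<in>I. c i * u i v) y = (\<Sum>i\<in>I. kos (fk_scale (c i) x) (u i) y)"
  by (induction I rule: infinite_finite_induct)
    (simp_all add: kos_add_mid [of x "\<lambda>v. c _ * u _ v"] kos_scale_mid kos_scale_left)

text \<open>A scalar multiple of a pure tensor is again a pure tensor, so additivity and pure
  tensors suffice.\<close>

lemma kos_induct [case_names add kos]:
  fixes t :: "'k::field kos"
  assumes add: "\<And>s t. P s \<Longrightarrow> P t \<Longrightarrow> P (s + t)" and kos: "\<And>x u y. P (kos x u y)"
  shows "P t"
proof -
  have "P (abs_kos p)" for p
    using pm_span_single [of p]
  proof (induction rule: pm.span_induct_alt)
    case base
    then show ?case using kos [of 0 undefined 0] by (simp add: zero_kos.abs_eq)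
  next
    case (step c g p)
    then obtain x u y where "g = Poly_Mapping.single (x, u, y) 1" by auto
    then have "abs_kos (pm_scale c g + p) = kos (fk_scale c x) u y + abs_kos p"
      unfolding kos_scale_left by (simp only: plus_kos.abs_eq kos_scale.abs_eq kos_def)
    then show ?case using add [OF kos step(2)] by simp
  qed
  then show ?thesis by (induct t) auto
qed

lemma linear_compose:
  assumes "Vector_Spaces.linear s1 s2 h" "Vector_Spaces.linear s2 s3 h'"
  shows "Vector_Spaces.linear s1 s3 (\<lambda>x. h' (h x))"
proof -
  interpret h: Vector_Spaces.linear s1 s2 h by fact
  interpret h': Vector_Spaces.linear s2 s3 h' by fact
  show ?thesis
    by (rule linearI [OF h.vs1.vector_space_axioms h'.vs2.vector_space_axioms])
      (simp_all add: h.add h.scale h'.add h'.scale)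
qed

lemma trilinear_fk_maps:
  assumes "trilinear sc \<phi>" "Vector_Spaces.linear fk_scale fk_scale g" "Vector_Spaces.linear fk_scale fk_scale g'"
    and "\<And>u u'. k (\<lambda>v. u v + u' v) = (\<lambda>v. k u v + k u' v)" "\<And>c u. k (\<lambda>v. c * u v) = (\<lambda>v. c * k u v)"
  shows "trilinear sc (\<lambda>x u y. \<phi> (g x) (k u) (g' y))"
  using assms(1) unfolding trilinear_def
  by (simp add: linearD_add [OF assms(2)] linearD_scale [OF assms(2)] linearD_add [OF assms(3)]
      linearD_scale [OF assms(3)] assms(4,5))

lemma linear_fk_mult_left: "Vector_Spaces.linear fk_scale fk_scale (\<lambda>x. a * x)"
  and linear_fk_mult_right: "Vector_Spaces.linear fk_scale fk_scale (\<lambda>x. x * a)"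
  by (rule linearI [OF fk_vs fk_vs]; simp add: algebra_simps fk_scale_mult_left fk_scale_mult_right)+

lemma linear_ident: "vector_space s \<Longrightarrow> Vector_Spaces.linear s s (\<lambda>x. x)"
  by (rule linearI) auto

lemma
  shows linear_kos_lact: "Vector_Spaces.linear kos_scale kos_scale (lact (kos_bimod n) a)"
    and kos_lact_kos: "lact (kos_bimod n) a (kos x u y) = kos (a * x) u y"
    and linear_kos_ract: "Vector_Spaces.linear kos_scale kos_scale (\<lambda>t. ract (kos_bimod n) t a)"
    and kos_ract_kos: "ract (kos_bimod n) (kos x u y) a = kos x u (y * a)"
proof -
  have 1: "trilinear kos_scale (\<lambda>x u y. kos (a * x) u y)"
    by (rule trilinear_fk_maps [OF trilinear_kos linear_fk_mult_left linear_ident [OF fk_vs]]) simp_all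
  have 2: "trilinear kos_scale (\<lambda>x u y. kos x u (y * a))"
    by (rule trilinear_fk_maps [OF trilinear_kos linear_ident [OF fk_vs] linear_fk_mult_right]) simp_all
  show "Vector_Spaces.linear kos_scale kos_scale (lact (kos_bimod n) a)"
    "lact (kos_bimod n) a (kos x u y) = kos (a * x) u y"
    "Vector_Spaces.linear kos_scale kos_scale (\<lambda>t. ract (kos_bimod n) t a)"
    "ract (kos_bimod n) (kos x u y) a = kos x u (y * a)"
    using linear_kos_lift [OF kos_vs 1] kos_lift_kos [OF kos_vs 1]
      linear_kos_lift [OF kos_vs 2] kos_lift_kos [OF kos_vs 2]
    by (simp_all add: kos_bimod_def)
qed

lemmas kos_act_simps = kos_lact_kos kos_ract_kos
  linearD_add [OF linear_kos_lact] linearD_add [OF linear_kos_ract]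

lemma kos_bimod_arith:
  fixes t :: "'k::field kos"
  shows "lact (kos_bimod n) (x + y) t = lact (kos_bimod n) x t + lact (kos_bimod n) y t"
    and "ract (kos_bimod n) t (x + y) = ract (kos_bimod n) t x + ract (kos_bimod n) t y"
    and "lact (kos_bimod n) x (lact (kos_bimod n) y t) = lact (kos_bimod n) (x * y) t"
    and "ract (kos_bimod n) (ract (kos_bimod n) t x) y = ract (kos_bimod n) t (x * y)"
    and "ract (kos_bimod n) (lact (kos_bimod n) x t) y = lact (kos_bimod n) x (ract (kos_bimod n) t y)"
    and "lact (kos_bimod n) (fk_scale c 1) t = kos_scale c t"
    and "ract (kos_bimod n) t (fk_scale c 1) = kos_scale c t"
  by (induction t rule: kos_induct)
    (simp_all add: kos_act_simps distrib_left distrib_right mult.assoc kos_add_left kos_add_right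
      fk_scale_mult_left fk_scale_mult_right kos_scale_left kos_scale_right kos.scale_right_distrib)

lemma carr_kos_bimod: "carr (kos_bimod n) = kos.span {kos x u y | x u y. u \<in> fkd_dual n}"
  by (simp add: kos_bimod_def)

lemma kos_in_carr: "u \<in> fkd_dual n \<Longrightarrow> kos x u y \<in> carr (kos_bimod n)"
  unfolding carr_kos_bimod by (rule kos.span_base) blast

text \<open>The middle functional is expanded in the dual basis and its coefficients are moved into
  the left factor. What remains are the free generators between arbitrary outer factors.\<close>

lemma kos_carr_induct [consumes 1, case_names add kos]:
  fixes t :: "'k::field kos"
  assumes t: "t \<in> carr (kos_bimod n)"
    and add: "\<And>s t. P s \<Longrightarrow> P t \<Longrightarrow> P (s + t)"
    and kos: "\<And>x m y. m \<in> fkd_basis n \<Longrightarrow> P (kos x (dual_mon m) y)"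
  shows "P t"
proof -
  have "replicate n La \<in> fkd_basis n" by (simp add: fkd_basis_def)
  from kos [OF this, of 0 0] have zero: "P 0" by simp
  have "P (kos x u y)" if "u \<in> fkd_dual n" for x u y
  proof -
    have "kos x u y = (\<Sum>m\<in>fkd_basis n. kos (fk_scale (u (fkd_mon m)) x) (dual_mon m) y)"
      by (subst fkd_dual_expand [OF that], rule kos_sum_mid)
    moreover have "P (\<Sum>m\<in>S. kos (fk_scale (u (fkd_mon m)) x) (dual_mon m) y)"
      if "finite S" "S \<subseteq> fkd_basis n" for S
      using that by (induction rule: finite_induct) (auto intro!: zero add kos)
    ultimately show ?thesis by simp
  qed
  then have *: "P (kos_scale c (kos x u y))" if "u \<in> fkd_dual n" for c x u y
    using that by (simp flip: kos_scale_left)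
  show ?thesis
    using t unfolding carr_kos_bimod
    by (induction rule: kos.span_induct_alt) (auto intro!: add * zero)
qed

lemma fk_bimodule_kos: "fk_bimodule kos_scale (kos_bimod n :: ('k::field fk, 'k kos) bimodule)"
proof (rule fk_bimodule.intro [OF kos_vs], unfold_locales)
  show carr_add: "m + m' \<in> carr (kos_bimod n)" if "m \<in> carr (kos_bimod n)" "m' \<in> carr (kos_bimod n)"
    for m m' :: "'k kos"
    using that by (simp add: carr_kos_bimod kos.span_add)
  show "lact (kos_bimod n) x m \<in> carr (kos_bimod n)" if "m \<in> carr (kos_bimod n)" for m and x :: "'k fk"
    using that
    by (induction rule: kos_carr_induct) (simp_all add: kos_act_simps carr_add kos_in_carr dual_mon_in_dual)
  show "ract (kos_bimod n) m x \<in> carr (kos_bimod n)" if "m \<in> carr (kos_bimod n)" for m and x :: "'k fk"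
    using that
    by (induction rule: kos_carr_induct) (simp_all add: kos_act_simps carr_add kos_in_carr dual_mon_in_dual)
qed (simp_all add: carr_kos_bimod kos.span_zero kos_bimod_arith kos_act_simps)

lemma kos_in_deg:
  "x \<in> fk_deg s \<Longrightarrow> y \<in> fk_deg t \<Longrightarrow> u \<in> fkd_dual n \<Longrightarrow> s + t + int n = N \<Longrightarrow> kos x u y \<in> kos_deg n N"
  unfolding kos_deg_def by (rule kos.span_base) blast

lemma kos_deg_zero: "0 \<in> kos_deg n N"
  and kos_deg_add: "t \<in> kos_deg n N \<Longrightarrow> t' \<in> kos_deg n N \<Longrightarrow> t + t' \<in> kos_deg n N"
  by (simp_all add: kos_deg_def kos.span_zero kos.span_add)

lemma kos_deg_carr: "t \<in> kos_deg n N \<Longrightarrow> t \<in> carr (kos_bimod n)"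
  unfolding kos_deg_def carr_kos_bimod
  by (erule rev_subsetD [OF _ kos.span_mono]) blast

lemma kos_deg_induct [consumes 1, case_names add kos]:
  fixes t :: "'k::field kos"
  assumes t: "t \<in> kos_deg n N"
    and add: "\<And>s t. P s \<Longrightarrow> P t \<Longrightarrow> P (s + t)"
    and kos: "\<And>x m y i j. m \<in> fkd_basis n \<Longrightarrow> x \<in> fk_deg i \<Longrightarrow> y \<in> fk_deg j \<Longrightarrow> i + j + int n = N \<Longrightarrow>
      P (kos x (dual_mon m) y)"
  shows "P t"
proof -
  have "replicate n La \<in> fkd_basis n" by (simp add: fkd_basis_def)
  from kos [OF this fk_deg_zero fk_deg_zero, of 0 "N - int n"] have zero: "P 0" by simp
  have "P (kos x u y)" if "u \<in> fkd_dual n" "x \<in> fk_deg i" "y \<in> fk_deg j" "i + j + int n = N" for x u y i j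
  proof -
    have "kos x u y = (\<Sum>m\<in>fkd_basis n. kos (fk_scale (u (fkd_mon m)) x) (dual_mon m) y)"
      by (subst fkd_dual_expand [OF that(1)], rule kos_sum_mid)
    moreover have "P (\<Sum>m\<in>S. kos (fk_scale (u (fkd_mon m)) x) (dual_mon m) y)"
      if "finite S" "S \<subseteq> fkd_basis n" for S
      using that
    proof (induction rule: finite_induct)
      case (insert m S)
      then show ?case
        using kos [OF _ fk_deg_scale [OF \<open>x \<in> fk_deg i\<close>] \<open>y \<in> fk_deg j\<close> \<open>i + j + int n = N\<close>]
        by (simp add: add)
    qed (simp add: zero)
    ultimately show ?thesis by simp
  qed
  then have *: "P (kos_scale c (kos x u y))"
    if "u \<in> fkd_dual n" "x \<in> fk_deg i" "y \<in> fk_deg j" "i + j + int n = N" for c x u y i j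
    unfolding kos_scale_left [symmetric] using that fk_deg_scale by blast
  show ?thesis
    using t unfolding kos_deg_def
    by (induction rule: kos.span_induct_alt) (use zero add * in blast)+
qed


section \<open>The resolution\<close>

lemma lookup_map_zero: "h 0 = 0 \<Longrightarrow> Poly_Mapping.lookup (Poly_Mapping.map h z) i = h (Poly_Mapping.lookup z i)"
  by (simp add: Poly_Mapping.map.rep_eq when_def)

lemma lookup_res_scale [simp]: "Poly_Mapping.lookup (res_scale c z) i = kos_scale c (Poly_Mapping.lookup z i)"
  by (simp add: res_scale_def lookup_map_zero)

text \<open>The actions of \<open>kos_bimod\<close> are the same functions for every index, so
  \<open>k\<close> may be chosen freely, whichever summand is looked up.\<close>

lemma lookup_res_lact [simp]:
  "Poly_Mapping.lookup (lact (res_bimod n) a z) i = lact (kos_bimod k) a (Poly_Mapping.lookup z i)"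
  by (simp add: res_bimod_def lookup_map_zero linearD_zero [OF linear_kos_lact]) (simp add: kos_bimod_def)

lemma lookup_res_ract [simp]:
  "Poly_Mapping.lookup (ract (res_bimod n) z a) i = ract (kos_bimod k) (Poly_Mapping.lookup z i) a"
  by (simp add: res_bimod_def lookup_map_zero linearD_zero [OF linear_kos_ract]) (simp add: kos_bimod_def)

global_interpretation res: vector_space "res_scale :: 'k::field \<Rightarrow> 'k res \<Rightarrow> 'k res"
  by unfold_locales
    (auto intro!: poly_mapping_eqI simp: lookup_add kos.scale_right_distrib kos.scale_left_distrib)

lemmas res_vs = res.vector_space_axioms

lemma carr_res_iff:
  "z \<in> carr (res_bimod n) \<longleftrightarrow>
    (\<forall>i. if 4 * i \<le> n then Poly_Mapping.lookup z i \<in> carr (kos_bimod (n - 4 * i)) else Poly_Mapping.lookup z i = 0)"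
  by (auto simp: res_bimod_def)

lemma res_deg_iff:
  "z \<in> res_deg n N \<longleftrightarrow>
    (\<forall>i. if 4 * i \<le> n then Poly_Mapping.lookup z i \<in> kos_deg (n - 4 * i) (N - 6 * int i) else Poly_Mapping.lookup z i = 0)"
  by (auto simp: res_deg_def)

lemma lookup_carr_res: "z \<in> carr (res_bimod n) \<Longrightarrow> 4 * i \<le> n \<Longrightarrow> Poly_Mapping.lookup z i \<in> carr (kos_bimod (n - 4 * i))"
  and lookup_carr_res_0: "z \<in> carr (res_bimod n) \<Longrightarrow> n < 4 * i \<Longrightarrow> Poly_Mapping.lookup z i = 0"
  by (force simp: carr_res_iff)+

lemma res_deg_carr: "z \<in> res_deg n N \<Longrightarrow> z \<in> carr (res_bimod n)"
  unfolding res_deg_iff carr_res_iff using kos_deg_carr by metis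

lemma fk_bimodule_res: "fk_bimodule res_scale (res_bimod n :: ('k::field fk, 'k res) bimodule)"
proof -
  interpret K: fk_bimodule kos_scale "kos_bimod m :: ('k fk, 'k kos) bimodule" for m
    by (rule fk_bimodule_kos)
  show ?thesis
  proof (rule fk_bimodule.intro [OF res_vs], unfold_locales)
    fix z z' :: "'k res" and x y :: "'k fk" and c :: 'k
    show "0 \<in> carr (res_bimod n :: ('k fk, 'k res) bimodule)"
      by (simp add: carr_res_iff K.zero_carr)
    show "z + z' \<in> carr (res_bimod n)" if "z \<in> carr (res_bimod n)" "z' \<in> carr (res_bimod n)"
      using that by (force simp: carr_res_iff lookup_add intro: K.add_carr)
    show "lact (res_bimod n) x z \<in> carr (res_bimod n)" if "z \<in> carr (res_bimod n)"
      unfolding carr_res_iff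
    proof
      fix i
      show "if 4 * i \<le> n then Poly_Mapping.lookup (lact (res_bimod n) x z) i \<in> carr (kos_bimod (n - 4 * i))
          else Poly_Mapping.lookup (lact (res_bimod n) x z) i = 0"
        using lookup_carr_res [OF that, of i] lookup_carr_res_0 [OF that, of i]
        by (simp add: K.lact_carr K.lact_zero lookup_res_lact [where k = "n - 4 * i"])
    qed
    show "ract (res_bimod n) z x \<in> carr (res_bimod n)" if "z \<in> carr (res_bimod n)"
      unfolding carr_res_iff
    proof
      fix i
      show "if 4 * i \<le> n then Poly_Mapping.lookup (ract (res_bimod n) z x) i \<in> carr (kos_bimod (n - 4 * i))
          else Poly_Mapping.lookup (ract (res_bimod n) z x) i = 0"
        using lookup_carr_res [OF that, of i] lookup_carr_res_0 [OF that, of i]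
        by (simp add: K.ract_carr K.ract_zero lookup_res_ract [where k = "n - 4 * i"])
    qed
  qed (rule poly_mapping_eqI; simp add: lookup_add lookup_res_lact [where k = 0] lookup_res_ract [where k = 0]
      kos_bimod_arith linearD_add [OF linear_kos_lact] linearD_add [OF linear_kos_ract])+
qed

lemma omega_in_carr: "4 * i \<le> n \<Longrightarrow> t \<in> carr (kos_bimod (n - 4 * i)) \<Longrightarrow> omega i t \<in> carr (res_bimod n)"
  using fk_bimodule.zero_carr [OF fk_bimodule_kos]
  by (auto simp: carr_res_iff lookup_single when_def)

lemma omega_in_deg: "4 * i \<le> n \<Longrightarrow> t \<in> kos_deg (n - 4 * i) (N - 6 * int i) \<Longrightarrow> omega i t \<in> res_deg n N"
  by (auto simp: res_deg_iff lookup_single when_def kos_deg_zero)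

lemma res_scale_omega: "res_scale c (omega i t) = omega i (kos_scale c t)"
  by (rule poly_mapping_eqI) (simp add: lookup_single when_def)

lemma res_lact_omega: "lact (res_bimod n) a (omega i t) = omega i (lact (kos_bimod k) a t)"
  by (rule poly_mapping_eqI)
    (simp add: lookup_single when_def lookup_res_lact [where k = k] linearD_zero [OF linear_kos_lact])

lemma res_ract_omega: "ract (res_bimod n) (omega i t) a = omega i (ract (kos_bimod k) t a)"
  by (rule poly_mapping_eqI)
    (simp add: lookup_single when_def lookup_res_ract [where k = k] linearD_zero [OF linear_kos_ract])

lemma res_sum_omega:
  assumes "\<And>i. n < 4 * i \<Longrightarrow> Poly_Mapping.lookup z i = 0"
  shows "z = (\<Sum>i\<le>n div 4. omega i (Poly_Mapping.lookup z i))"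
proof (rule poly_mapping_eqI)
  fix j
  have "Poly_Mapping.lookup (\<Sum>i\<le>n div 4. omega i (Poly_Mapping.lookup z i)) j =
      (\<Sum>i\<le>n div 4. if i = j then Poly_Mapping.lookup z i else 0)"
    by (simp add: lookup_sum lookup_single when_def)
  then show "Poly_Mapping.lookup z j = Poly_Mapping.lookup (\<Sum>i\<le>n div 4. omega i (Poly_Mapping.lookup z i)) j"
    using assms [of j] by (simp add: sum.delta')
qed

lemma sum_closed_induct:
  assumes "finite S" "P 0" "\<And>x y. P x \<Longrightarrow> P y \<Longrightarrow> P (x + y)" "\<And>i. i \<in> S \<Longrightarrow> P (g i)"
  shows "P (sum g S)"
  using assms(1,4) by (induction rule: finite_induct) (auto intro: assms(2,3))

lemma res_carr_induct [consumes 1, case_names add omega]: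
  fixes z :: "'k::field res"
  assumes z: "z \<in> carr (res_bimod n)"
    and add: "\<And>y z. P y \<Longrightarrow> P z \<Longrightarrow> P (y + z)"
    and omega: "\<And>i x m y. 4 * i \<le> n \<Longrightarrow> m \<in> fkd_basis (n - 4 * i) \<Longrightarrow> P (omega i (kos x (dual_mon m) y))"
  shows "P z"
proof -
  have "P (omega i t)" if "4 * i \<le> n" "t \<in> carr (kos_bimod (n - 4 * i))" for i t
    using that(2)
  proof (induction rule: kos_carr_induct)
    case (add s t)
    then show ?case by (simp add: single_add assms(2))
  qed (rule omega [OF that(1)])
  then have *: "P (omega i (Poly_Mapping.lookup z i))" if "i \<in> {..n div 4}" for i
    using lookup_carr_res [OF z, of i] that by force
  have zero: "P 0"
    using omega [of 0 "replicate n La" 0 0] by (simp add: fkd_basis_def)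
  have "P (\<Sum>i\<le>n div 4. omega i (Poly_Mapping.lookup z i))"
    by (rule sum_closed_induct [OF finite_atMost]) (fact zero add *)+
  then show ?thesis
    using res_sum_omega [of n z] lookup_carr_res_0 [OF z] by simp
qed

text \<open>The generator \<omega>_i 1|u|1 has internal degree (n - 4i) + 6i = n + 2i.\<close>

lemma res_deg_induct [consumes 1, case_names add omega]:
  fixes z :: "'k::field res"
  assumes z: "z \<in> res_deg n N"
    and add: "\<And>y z. P y \<Longrightarrow> P z \<Longrightarrow> P (y + z)"
    and omega: "\<And>i x m y s t. 4 * i \<le> n \<Longrightarrow> m \<in> fkd_basis (n - 4 * i) \<Longrightarrow> x \<in> fk_deg s \<Longrightarrow> y \<in> fk_deg t \<Longrightarrow>
      s + t + int n + 2 * int i = N \<Longrightarrow> P (omega i (kos x (dual_mon m) y))"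
  shows "P z"
proof -
  have "P (omega i t)" if "4 * i \<le> n" "t \<in> kos_deg (n - 4 * i) (N - 6 * int i)" for i t
    using that(2)
  proof (induction rule: kos_deg_induct)
    case (add s t)
    then show ?case by (simp add: single_add assms(2))
  next
    case (kos x m y j k)
    then show ?case using that(1) by (intro omega [where s = j and t = k]) auto
  qed
  then have *: "P (omega i (Poly_Mapping.lookup z i))" if "i \<in> {..n div 4}" for i
    using z that unfolding res_deg_iff by force
  have zero: "P 0"
    using omega [of 0 "replicate n La" 0 "N - int n" 0 0] by (simp add: fkd_basis_def fk_deg_zero)
  have "Poly_Mapping.lookup z i = 0" if "n < 4 * i" for i
    using lookup_carr_res_0 [OF res_deg_carr [OF z] that] .
  moreover have "P (\<Sum>i\<le>n div 4. omega i (Poly_Mapping.lookup z i))"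
    by (rule sum_closed_induct [OF finite_atMost]) (fact zero add *)+
  ultimately show ?thesis
    using res_sum_omega [of n z] by simp
qed

lemma res_deg_add: "z \<in> res_deg n N \<Longrightarrow> z' \<in> res_deg n N \<Longrightarrow> z + z' \<in> res_deg n N"
  by (force simp: res_deg_iff lookup_add intro: kos_deg_add)

lemma omega_kos_in_deg:
  assumes "4 * i \<le> n" "m \<in> fkd_basis (n - 4 * i)" "x \<in> fk_deg s" "y \<in> fk_deg t"
  shows "omega i (kos x (dual_mon m) y) \<in> res_deg n (s + t + int n + 2 * int i)"
  using assms by (intro omega_in_deg kos_in_deg [OF _ _ dual_mon_in_dual]) auto

text \<open>Reduces additive statements on \<open>P\<close> to homogeneous elements, on which the
  Euler operators are scalars.\<close>

lemma res_hom_induct [consumes 1, case_names add hom]: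
  fixes z :: "'k::field res"
  assumes z: "z \<in> carr (res_bimod n)"
    and add: "\<And>y z. y \<in> carr (res_bimod n) \<Longrightarrow> z \<in> carr (res_bimod n) \<Longrightarrow> P y \<Longrightarrow> P z \<Longrightarrow> P (y + z)"
    and hom: "\<And>N z. z \<in> res_deg n N \<Longrightarrow> P z"
  shows "P z"
proof -
  interpret fk_bimodule res_scale "res_bimod n :: ('k fk, 'k res) bimodule" by (rule fk_bimodule_res)
  have "z \<in> carr (res_bimod n) \<and> P z"
    using z
  proof (induction rule: res_carr_induct)
    case (omega i x m y)
    note im = this
    show ?case
    proof (induction x rule: fk_deg_induct)
      case (add x x')
      then show ?case by (simp add: kos_add_left single_add assms(2) add_carr)
    next
      case (hom s x)
      note x = this
      show ?case
      proof (induction y rule: fk_deg_induct)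
        case (add y y')
        then show ?case by (simp add: kos_add_right single_add assms(2) add_carr)
      next
        case (hom t y)
        show ?case
          using omega_kos_in_deg [OF im x hom] assms(3) res_deg_carr by blast
      qed
    qed
  qed (auto intro: add add_carr)
  then show ?thesis by simp
qed

section \<open>The differential and its homogeneity\<close>

lemma trilinear_add:
  assumes "vector_space sc" "trilinear sc \<phi>" "trilinear sc \<psi>"
  shows "trilinear sc (\<lambda>x u y. \<phi> x u y + \<psi> x u y)"
proof -
  interpret vector_space sc by fact
  show ?thesis
    using assms(2,3) unfolding trilinear_def by (simp add: scale_right_distrib algebra_simps)
qed

lemma trilinear_sum:
  assumes "vector_space sc" "\<And>i. i \<in> I \<Longrightarrow> trilinear sc (\<phi> i)"
  shows "trilinear sc (\<lambda>x u y. \<Sum>i\<in>I. \<phi> i x u y)"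
proof -
  interpret vector_space sc by fact
  show ?thesis
    using assms(2) unfolding trilinear_def by (simp add: sum.distrib scale_sum_right)
qed

lemma trilinear_scale:
  assumes "vector_space sc" "trilinear sc \<phi>"
  shows "trilinear sc (\<lambda>x u y. sc c (\<phi> x u y))"
proof -
  interpret vector_space sc by fact
  show ?thesis
    using assms(2) unfolding trilinear_def by (simp add: scale_right_distrib mult.commute)
qed

lemma
  fixes x y :: "'k::field fk"
  shows linear_kos_diff: "Vector_Spaces.linear kos_scale kos_scale (kos_diff n :: 'k kos \<Rightarrow> 'k kos)"
    and kos_diff_kos: "kos_diff n (kos x u y) = (\<Sum>l\<in>letters.
      kos_scale ((-1) ^ n) (kos (x * fk_mon [l]) (\<lambda>w. u (fkd_mon [l] * w)) y)
      + kos x (\<lambda>w. u (w * fkd_mon [l])) (fk_mon [l] * y))"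
proof -
  have 1: "trilinear kos_scale (\<lambda>(x :: 'k fk) u y. kos (x * fk_mon [l]) (\<lambda>w. u (fkd_mon [l] * w)) y)" for l
    by (rule trilinear_fk_maps [OF trilinear_kos linear_fk_mult_right linear_ident [OF fk_vs],
        where k = "\<lambda>u w. u (fkd_mon [l] * w)"]) simp_all
  have 2: "trilinear kos_scale (\<lambda>(x :: 'k fk) u y. kos x (\<lambda>w. u (w * fkd_mon [l])) (fk_mon [l] * y))" for l
    by (rule trilinear_fk_maps [OF trilinear_kos linear_ident [OF fk_vs] linear_fk_mult_left,
        where k = "\<lambda>u w. u (w * fkd_mon [l])"]) simp_all
  have "trilinear kos_scale (\<lambda>(x :: 'k fk) u y. \<Sum>l\<in>letters.
      kos_scale ((-1) ^ n) (kos (x * fk_mon [l]) (\<lambda>w. u (fkd_mon [l] * w)) y)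
      + kos x (\<lambda>w. u (w * fkd_mon [l])) (fk_mon [l] * y))"
    by (intro trilinear_sum trilinear_add trilinear_scale kos_vs 1 2)
  from linear_kos_lift [OF kos_vs this] kos_lift_kos [OF kos_vs this]
  show "Vector_Spaces.linear kos_scale kos_scale (kos_diff n :: 'k kos \<Rightarrow> 'k kos)"
    "kos_diff n (kos x u y) = (\<Sum>l\<in>letters.
      kos_scale ((-1) ^ n) (kos (x * fk_mon [l]) (\<lambda>w. u (fkd_mon [l] * w)) y)
      + kos x (\<lambda>w. u (w * fkd_mon [l])) (fk_mon [l] * y))"
    by (simp_all add: kos_diff_def [abs_def])
qed

lemma
  fixes u :: "'k::field fkd \<Rightarrow> 'k"
  assumes "u \<in> fkd_dual n"
  shows fkd_dual_linear: "Vector_Spaces.linear fkd_scale (*) u"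
    and fkd_dual_0: "length w \<noteq> n \<Longrightarrow> u (fkd_mon w) = 0"
  using assms by (auto simp: fkd_dual_def)

lemma
  fixes u :: "'k::field fkd \<Rightarrow> 'k"
  assumes u: "u \<in> fkd_dual (Suc n)"
  shows fkd_dual_shift_left: "(\<lambda>w. u (fkd_mon [l] * w)) \<in> fkd_dual n"
    and fkd_dual_shift_right: "(\<lambda>w. u (w * fkd_mon [l])) \<in> fkd_dual n"
  unfolding fkd_dual_def using fkd_dual_linear [OF u] fkd_dual_0 [OF u]
  by (auto intro!: linearI [OF fkd_vs vector_space_mult]
      simp: distrib_left distrib_right linearD_add fkd_scale_mult_left fkd_scale_mult_right linearD_scale
      simp flip: fkd_mon_append)

lemma
  fixes u :: "'k::field fkd \<Rightarrow> 'k"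
  assumes u: "u \<in> fkd_dual 0"
  shows fkd_dual_shift_left_0: "(\<lambda>w. u (fkd_mon [l] * w)) = (\<lambda>w. 0)"
    and fkd_dual_shift_right_0: "(\<lambda>w. u (w * fkd_mon [l])) = (\<lambda>w. 0)"
proof -
  note lin = fkd_dual_linear [OF u]
  have zero: "Vector_Spaces.linear fkd_scale (*) (\<lambda>w :: 'k fkd. 0 :: 'k)"
    by (rule linearI [OF fkd_vs vector_space_mult]) simp_all
  have "u (fkd_mon [l] * w) = 0" for w
  proof (rule fkd_linear_eqI [OF _ zero, where h = "\<lambda>w. u (fkd_mon [l] * w)"])
    show "Vector_Spaces.linear fkd_scale (*) (\<lambda>w. u (fkd_mon [l] * w))"
      by (rule linearI [OF fkd_vs vector_space_mult])
        (simp_all add: distrib_left linearD_add [OF lin] fkd_scale_mult_right linearD_scale [OF lin])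
  qed (simp add: fkd_dual_0 [OF u] flip: fkd_mon_append)
  then show "(\<lambda>w. u (fkd_mon [l] * w)) = (\<lambda>w. 0)" by auto
  have "u (w * fkd_mon [l]) = 0" for w
  proof (rule fkd_linear_eqI [OF _ zero, where h = "\<lambda>w. u (w * fkd_mon [l])"])
    show "Vector_Spaces.linear fkd_scale (*) (\<lambda>w. u (w * fkd_mon [l]))"
      by (rule linearI [OF fkd_vs vector_space_mult])
        (simp_all add: distrib_right linearD_add [OF lin] fkd_scale_mult_left linearD_scale [OF lin])
  qed (simp add: fkd_dual_0 [OF u] flip: fkd_mon_append)
  then show "(\<lambda>w. u (w * fkd_mon [l])) = (\<lambda>w. 0)" by auto
qed

text \<open>The sum in \<open>res_diff\<close> includes the summand with n = 4i, whose Koszul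
  bimodule is \<open>K_0\<close>. There is no target for it, so the formula has to give 0.\<close>

lemma kos_diff_0: 
  fixes t :: "'k::field kos"
  assumes "t \<in> carr (kos_bimod 0)"
  shows "kos_diff 0 t = 0"
  using assms
  by (induction rule: kos_carr_induct)
    (simp_all add: linearD_add [OF linear_kos_diff] kos_diff_kos fkd_dual_shift_left_0 [OF dual_mon_in_dual]
      fkd_dual_shift_right_0 [OF dual_mon_in_dual])

lemma kos_diff_lact: "kos_diff n (lact (kos_bimod k) a t) = lact (kos_bimod k) a (kos_diff n t)"
  and kos_diff_ract: "kos_diff n (ract (kos_bimod k) t a) = ract (kos_bimod k) (kos_diff n t) a"
proof (induction t rule: kos_induct)
  case (add s t)
  {
    case 1
    then show ?case using add by (simp add: linearD_add [OF linear_kos_diff] kos_act_simps)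
  next
    case 2
    then show ?case using add by (simp add: linearD_add [OF linear_kos_diff] kos_act_simps)
  }
next
  case (kos x u y)
  {
    case 1
    then show ?case
      by (simp add: kos_diff_kos kos_act_simps linearD_sum [OF linear_kos_lact] linearD_scale [OF linear_kos_lact]
          mult.assoc)
  next
    case 2
    then show ?case
      by (simp add: kos_diff_kos kos_act_simps linearD_sum [OF linear_kos_ract] linearD_scale [OF linear_kos_ract]
          mult.assoc)
  }
qed

lemma kos_diff_deg:
  fixes t :: "'k::field kos"
  assumes "t \<in> kos_deg (Suc n) N"
  shows "kos_diff (Suc n) t \<in> kos_deg n N"
  using assms
proof (induction rule: kos_deg_induct)
  case (kos x m y i j)
  note u = dual_mon_in_dual [OF kos(1), where 'k = 'k]
  have xl: "x * fk_mon [l] \<in> fk_deg (i + 1)" "fk_mon [l] * y \<in> fk_deg (1 + j)" for l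
    using fk_deg_mult [OF kos(2) fk_deg_mon [of "[l]"]] fk_deg_mult [OF fk_deg_mon [of "[l]"] kos(3)] by simp_all
  have "kos (x * fk_mon [l]) (\<lambda>w. dual_mon m (fkd_mon [l] * w)) y \<in> kos_deg n N"
    "kos x (\<lambda>w. dual_mon m (w * fkd_mon [l])) (fk_mon [l] * y) \<in> kos_deg n N" for l
    using kos(4) by (auto intro!: kos_in_deg [OF xl(1) kos(3) fkd_dual_shift_left [OF u]]
        kos_in_deg [OF kos(2) xl(2) fkd_dual_shift_right [OF u]])
  then show ?case
    unfolding kos_diff_kos kos_deg_def by (intro kos.span_sum kos.span_add kos.span_scale)
qed (simp add: linearD_add [OF linear_kos_diff] kos_deg_add)

lemma lookup_res_diff:
  "Poly_Mapping.lookup (res_diff f n z) j =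
    (if 4 * j \<le> n then kos_diff (n - 4 * j) (Poly_Mapping.lookup z j) else 0)
    + (if 4 * Suc j \<le> n then f (n - 4 * Suc j) (Poly_Mapping.lookup z (Suc j)) else 0)"
proof -
  let ?k = "\<lambda>i. kos_diff (n - 4 * i) (Poly_Mapping.lookup z i)"
  let ?f = "\<lambda>i. f (n - 4 * i) (Poly_Mapping.lookup z i)"
  have "Poly_Mapping.lookup (res_diff f n z) j =
      (\<Sum>i\<le>n div 4. (if i = j then ?k i else 0) + (if i = Suc j then ?f i else 0))"
    unfolding res_diff_def lookup_sum
    by (intro sum.cong) (auto simp: lookup_add lookup_single when_def)
  also have "\<dots> = (if j \<le> n div 4 then ?k j else 0) + (if Suc j \<le> n div 4 then ?f (Suc j) else 0)"
    by (simp add: sum.distrib sum.delta)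
  moreover have "j \<le> n div 4 \<longleftrightarrow> 4 * j \<le> n" "Suc j \<le> n div 4 \<longleftrightarrow> 4 * Suc j \<le> n"
    by auto
  ultimately show ?thesis by simp
qed

text \<open>The algebraic half of \<open>fk_resolution\<close>, kept apart from exactness: it makes
  the differential a homogeneous bimodule map, and the lifting of the Euler derivation rests on this
  alone.\<close>

definition periodicity_maps :: "(nat \<Rightarrow> 'k::field kos \<Rightarrow> 'k kos) \<Rightarrow> bool"
  where "periodicity_maps f \<longleftrightarrow>
    (\<forall>j. bimod_hom (kos_bimod j) (kos_bimod (j + 3)) (f j)) \<and>
    (\<forall>j N. \<forall>t\<in>kos_deg j N. f j t \<in> kos_deg (j + 3) (N + 6))"

lemma periodicity_shift_arith:
  assumes "4 * Suc j \<le> Suc n"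
  shows "Suc n - 4 * Suc j + 3 = n - 4 * j" "N - 6 * int (Suc j) + 6 = N - 6 * int j"
proof -
  have "4 * j + 3 \<le> n" using assms by simp
  then obtain k where "n = 4 * j + 3 + k" using le_Suc_ex by blast
  then show "Suc n - 4 * Suc j + 3 = n - 4 * j" by simp
qed simp

lemma res_diff_deg:
  fixes f :: "nat \<Rightarrow> 'k::field kos \<Rightarrow> 'k kos"
  assumes f: "periodicity_maps f" and z: "z \<in> res_deg (Suc n) N"
  shows "res_diff f (Suc n) z \<in> res_deg n N"
  unfolding res_deg_iff
proof
  fix j
  have zj: "Poly_Mapping.lookup z j \<in> kos_deg (Suc n - 4 * j) (N - 6 * int j)" if "4 * j \<le> Suc n" for j
    using z [unfolded res_deg_iff, THEN spec, of j] unfolding if_P [OF that] .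
  \<comment> \<open>Passing from \<omega>_(j+1) to \<omega>_j loses 6 in internal degree, which
    \<open>f\<close> restores; the homological degree falls by 4 and rises by 3.\<close>
  have "f (Suc n - 4 * Suc j) (Poly_Mapping.lookup z (Suc j)) \<in> kos_deg (n - 4 * j) (N - 6 * int j)"
    if "4 * Suc j \<le> Suc n"
  proof -
    have "f (Suc n - 4 * Suc j) (Poly_Mapping.lookup z (Suc j)) \<in>
        kos_deg (Suc n - 4 * Suc j + 3) (N - 6 * int (Suc j) + 6)"
      using f zj [OF that] unfolding periodicity_maps_def by blast
    then show ?thesis
      by (simp only: periodicity_shift_arith [OF that])
  qed
  moreover have "kos_diff (Suc n - 4 * j) (Poly_Mapping.lookup z j) \<in> kos_deg (n - 4 * j) (N - 6 * int j)"
    if "4 * j \<le> n"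
  proof -
    have "Suc n - 4 * j = Suc (n - 4 * j)" using that by simp
    then show ?thesis using zj [of j] kos_diff_deg that by fastforce
  qed
  \<comment> \<open>The top summand is a copy of \<open>K_0\<close>, whose component has no room one
    degree lower.\<close>
  moreover have "kos_diff (Suc n - 4 * j) (Poly_Mapping.lookup z j) = 0" if "4 * j = Suc n"
    using zj [of j] that kos_deg_carr by (auto intro!: kos_diff_0)
  ultimately show "if 4 * j \<le> n then Poly_Mapping.lookup (res_diff f (Suc n) z) j \<in> kos_deg (n - 4 * j) (N - 6 * int j)
      else Poly_Mapping.lookup (res_diff f (Suc n) z) j = 0"
    unfolding lookup_res_diff by (auto simp: kos_deg_zero kos_deg_add le_Suc_eq)
qed

lemma bimod_hom_res_diff:
  fixes f :: "nat \<Rightarrow> 'k::field kos \<Rightarrow> 'k kos"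
  assumes f: "periodicity_maps f"
  shows "bimod_hom (res_bimod (Suc n)) (res_bimod n) (res_diff f (Suc n))"
proof -
  interpret R: fk_bimodule res_scale "res_bimod m :: ('k fk, 'k res) bimodule" for m
    by (rule fk_bimodule_res)
  have hom: "bimod_hom (kos_bimod j) (kos_bimod (j + 3)) (f j)" for j
    using f by (simp add: periodicity_maps_def)
  \<comment> \<open>Terms of one component come from Koszul bimodules with different indices; their
    actions are nevertheless the same functions.\<close>
  have act: "lact (kos_bimod k) = lact (kos_bimod 0)" "ract (kos_bimod k) = ract (kos_bimod 0)" for k
    by (simp_all add: kos_bimod_def)
  have add: "res_diff f (Suc n) (z + z') = res_diff f (Suc n) z + res_diff f (Suc n) z'"
    if z: "z \<in> carr (res_bimod (Suc n))" "z' \<in> carr (res_bimod (Suc n))" for z z'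
  proof (rule poly_mapping_eqI)
    fix j
    have "f (Suc n - 4 * Suc j) (Poly_Mapping.lookup z (Suc j) + Poly_Mapping.lookup z' (Suc j)) =
        f (Suc n - 4 * Suc j) (Poly_Mapping.lookup z (Suc j)) + f (Suc n - 4 * Suc j) (Poly_Mapping.lookup z' (Suc j))"
      if "4 * Suc j \<le> Suc n"
      by (rule bimod_hom_add [OF hom lookup_carr_res [OF z(1) that] lookup_carr_res [OF z(2) that]])
    then show "Poly_Mapping.lookup (res_diff f (Suc n) (z + z')) j =
        Poly_Mapping.lookup (res_diff f (Suc n) z + res_diff f (Suc n) z') j"
      unfolding lookup_add lookup_res_diff linearD_add [OF linear_kos_diff]
      by (cases "4 * Suc j \<le> Suc n"; cases "4 * j \<le> Suc n")
        (simp_all only: if_True if_False simp_thms add_ac add_0_left add_0_right)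
  qed
  have "res_diff f (Suc n) z \<in> carr (res_bimod n)" if "z \<in> carr (res_bimod (Suc n))" for z
    using that
    by (induction rule: res_hom_induct) (auto simp: add R.add_carr intro: res_deg_carr res_diff_deg [OF f])
  moreover have "res_diff f (Suc n) (lact (res_bimod (Suc n)) x z) = lact (res_bimod n) x (res_diff f (Suc n) z) \<and>
      res_diff f (Suc n) (ract (res_bimod (Suc n)) z x) = ract (res_bimod n) (res_diff f (Suc n) z) x"
    if z: "z \<in> carr (res_bimod (Suc n))" for x z
  proof (intro conjI poly_mapping_eqI)
    fix j
    have "f (Suc n - 4 * Suc j) (lact (kos_bimod 0) x (Poly_Mapping.lookup z (Suc j))) =
        lact (kos_bimod 0) x (f (Suc n - 4 * Suc j) (Poly_Mapping.lookup z (Suc j)))"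
      if "4 * Suc j \<le> Suc n"
      using bimod_hom_lact [OF hom lookup_carr_res [OF z that], of x]
      unfolding act [of "Suc n - 4 * Suc j"] act [of "Suc n - 4 * Suc j + 3"] .
    then show "Poly_Mapping.lookup (res_diff f (Suc n) (lact (res_bimod (Suc n)) x z)) j =
        Poly_Mapping.lookup (lact (res_bimod n) x (res_diff f (Suc n) z)) j"
      unfolding lookup_res_diff lookup_res_lact [where k = 0] kos_diff_lact linearD_add [OF linear_kos_lact]
      by (cases "4 * Suc j \<le> Suc n"; cases "4 * j \<le> Suc n")
        (simp_all only: if_True if_False simp_thms linearD_zero [OF linear_kos_lact])
    have "f (Suc n - 4 * Suc j) (ract (kos_bimod 0) (Poly_Mapping.lookup z (Suc j)) x) =
        ract (kos_bimod 0) (f (Suc n - 4 * Suc j) (Poly_Mapping.lookup z (Suc j))) x"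
      if "4 * Suc j \<le> Suc n"
      using bimod_hom_ract [OF hom lookup_carr_res [OF z that], of x]
      unfolding act [of "Suc n - 4 * Suc j"] act [of "Suc n - 4 * Suc j + 3"] .
    then show "Poly_Mapping.lookup (res_diff f (Suc n) (ract (res_bimod (Suc n)) z x)) j =
        Poly_Mapping.lookup (ract (res_bimod n) (res_diff f (Suc n) z) x) j"
      unfolding lookup_res_diff lookup_res_ract [where k = 0] kos_diff_ract linearD_add [OF linear_kos_ract]
      by (cases "4 * Suc j \<le> Suc n"; cases "4 * j \<le> Suc n")
        (simp_all only: if_True if_False simp_thms linearD_zero [OF linear_kos_ract])
  qed
  ultimately show ?thesis
    using add by (simp add: bimod_hom_def)
qed

lemma
  fixes f :: "nat \<Rightarrow> 'k::field kos \<Rightarrow> 'k kos"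
  assumes f: "fk_resolution f"
  shows fk_resolution_periodicity: "periodicity_maps f"
    and fk_resolution_f0: "f 0 (kos 1 (dual_mon []) 1) = f0_value"
    and res_diff_diff: "z \<in> carr (res_bimod (Suc (Suc n))) \<Longrightarrow> res_diff f (Suc n) (res_diff f (Suc (Suc n)) z) = 0"
    and res_diff_exact: "z \<in> carr (res_bimod (Suc n)) \<Longrightarrow> res_diff f (Suc n) z = 0 \<Longrightarrow>
      z \<in> res_diff f (Suc (Suc n)) ` carr (res_bimod (Suc (Suc n)))"
    and res_aug_exact: "z \<in> carr (res_bimod 0) \<Longrightarrow> res_aug z = 0 \<Longrightarrow> z \<in> res_diff f 1 ` carr (res_bimod 1)"
    and res_aug_surj: "res_aug ` carr (res_bimod 0) = (UNIV :: 'k fk set)"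
proof -
  have ex: "{z \<in> carr (res_bimod (Suc n)). res_diff f (Suc n) z = 0} =
      res_diff f (Suc (Suc n)) ` carr (res_bimod (Suc (Suc n)))" for n
  proof -
    have "\<forall>n\<ge>1. {z \<in> carr (res_bimod n). res_diff f n z = 0} = res_diff f (n + 1) ` carr (res_bimod (n + 1))"
      using f unfolding fk_resolution_def by (elim conjE) assumption
    from this [THEN spec, of "Suc n"] show ?thesis by simp
  qed
  have ex0: "{z \<in> carr (res_bimod 0). res_aug z = 0} = res_diff f 1 ` carr (res_bimod 1)"
    using f unfolding fk_resolution_def by (elim conjE) assumption
  show "periodicity_maps f" "f 0 (kos 1 (dual_mon []) 1) = f0_value"
    "res_aug ` carr (res_bimod 0) = (UNIV :: 'k fk set)"
    using f unfolding fk_resolution_def periodicity_maps_def by simp_all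
  show "z \<in> carr (res_bimod (Suc (Suc n))) \<Longrightarrow> res_diff f (Suc n) (res_diff f (Suc (Suc n)) z) = 0"
    "z \<in> carr (res_bimod (Suc n)) \<Longrightarrow> res_diff f (Suc n) z = 0 \<Longrightarrow>
      z \<in> res_diff f (Suc (Suc n)) ` carr (res_bimod (Suc (Suc n)))"
    using ex [of n] by blast+
  show "z \<in> carr (res_bimod 0) \<Longrightarrow> res_aug z = 0 \<Longrightarrow> z \<in> res_diff f 1 ` carr (res_bimod 1)"
    using ex0 by blast+
qed


subsection \<open>Freeness\<close>

lemma omega_kos_eq_act:
  "omega i (kos x u y) = lact (res_bimod n) x (ract (res_bimod n) (omega i (kos 1 u 1)) y)"
  by (simp add: res_lact_omega [where k = 0] res_ract_omega [where k = 0] kos_act_simps)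

lemma generator_in_carr:
  "4 * i \<le> n \<Longrightarrow> m \<in> fkd_basis (n - 4 * i) \<Longrightarrow> omega i (kos x (dual_mon m) y) \<in> carr (res_bimod n)"
  by (intro omega_in_carr kos_in_carr dual_mon_in_dual)

lemma res_hom_eqI:
  fixes h h' :: "'k::field res \<Rightarrow> 'n::ab_group_add"
  assumes h: "bimod_hom (res_bimod n) N h" and h': "bimod_hom (res_bimod n) N h'"
    and gen: "\<And>i m. 4 * i \<le> n \<Longrightarrow> m \<in> fkd_basis (n - 4 * i) \<Longrightarrow>
      h (omega i (kos 1 (dual_mon m) 1)) = h' (omega i (kos 1 (dual_mon m) 1))"
    and z: "z \<in> carr (res_bimod n)"
  shows "h z = h' z"
proof -
  interpret fk_bimodule res_scale "res_bimod n :: ('k fk, 'k res) bimodule" by (rule fk_bimodule_res)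
  have "z \<in> carr (res_bimod n) \<and> h z = h' z"
    using z
  proof (induction rule: res_carr_induct)
    case (add y z)
    then show ?case by (simp add: add_carr bimod_hom_add [OF h] bimod_hom_add [OF h'])
  next
    case (omega i x m y)
    note g = generator_in_carr [OF omega]
    show ?case
      unfolding omega_kos_eq_act [of i x "dual_mon m" y n]
      by (simp add: bimod_hom_lact [OF h] bimod_hom_lact [OF h'] bimod_hom_ract [OF h] bimod_hom_ract [OF h']
          g lact_carr ract_carr gen [OF omega])
  qed
  then show ?thesis by simp
qed

text \<open>The universal property of a free bimodule: a functional \<open>u\<close> is recorded by
  its values on the basis monomials, which serve as the coefficients of the prescribed images.
  Duality of the two bases returns \<open>v i m\<close> on the generators.\<close>

lemma res_hom_exists:
  fixes v :: "nat \<Rightarrow> letter list \<Rightarrow> 'n::ab_group_add" and s :: "'k::field \<Rightarrow> 'n \<Rightarrow> 'n"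
  assumes N: "fk_bimodule s N" and v: "\<And>i m. v i m \<in> carr N"
  shows "\<exists>h. bimod_hom (res_bimod n) N h \<and>
    (\<forall>i m. 4 * i \<le> n \<longrightarrow> m \<in> fkd_basis (n - 4 * i) \<longrightarrow> h (omega i (kos 1 (dual_mon m) 1)) = v i m)"
proof -
  interpret N: fk_bimodule s N by fact
  note vs = N.vector_space_axioms
  let ?\<phi> = "\<lambda>i x u y. \<Sum>m\<in>fkd_basis (n - 4 * i). s (u (fkd_mon m)) (lact N x (ract N (v i m) y))"
  have tri: "trilinear s (?\<phi> i)" for i
  proof (rule trilinear_sum [OF vs])
    fix m
    note c = v [of i m] N.ract_carr [OF v [of i m]]
    show "trilinear s (\<lambda>x u y. s (u (fkd_mon m)) (lact N x (ract N (v i m) y)))"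
      unfolding trilinear_def
      by (simp add: c N.lact_add_left N.lact_add_right N.ract_add_right N.lact_scale_left N.lact_scale_right
          N.ract_scale_right N.scale_right_distrib N.scale_left_distrib mult.commute)
  qed
  note lin = linear_kos_lift [OF vs tri] and on_kos = kos_lift_kos [OF vs tri]
  have lact: "kos_lift s (?\<phi> i) (lact (kos_bimod 0) a t) = lact N a (kos_lift s (?\<phi> i) t)"
    and ract: "kos_lift s (?\<phi> i) (ract (kos_bimod 0) t a) = ract N (kos_lift s (?\<phi> i) t) a"
    and carr: "kos_lift s (?\<phi> i) t \<in> carr N" for i a t
  proof (induction t rule: kos_induct)
    case (add t t')
    {
      case 1
      then show ?case using add by (simp add: kos_act_simps linearD_add [OF lin] N.lact_add_right)
    next
      case 2
      then show ?case using add by (simp add: kos_act_simps linearD_add [OF lin] N.ract_add_left)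
    next
      case 3
      then show ?case using add by (simp add: linearD_add [OF lin] N.add_carr)
    }
  next
    case (kos x u y)
    have c: "lact N x (ract N (v i m) y) \<in> carr N" "ract N (v i m) y \<in> carr N" for m
      by (simp_all add: N.lact_carr N.ract_carr v)
    have "lact N a (\<Sum>m\<in>F. s (u (fkd_mon m)) (lact N x (ract N (v i m) y))) =
        (\<Sum>m\<in>F. s (u (fkd_mon m)) (lact N (a * x) (ract N (v i m) y)))" for F
      by (induction F rule: infinite_finite_induct)
        (simp_all add: N.lact_zero N.lact_add_right N.lact_scale_right N.lact_lact c N.scale_carr N.sum_carr)
    moreover have "ract N (\<Sum>m\<in>F. s (u (fkd_mon m)) (lact N x (ract N (v i m) y))) a =
        (\<Sum>m\<in>F. s (u (fkd_mon m)) (lact N x (ract N (v i m) (y * a))))" for F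
      by (induction F rule: infinite_finite_induct)
        (simp_all add: N.ract_zero N.ract_add_left N.ract_scale_left N.ract_lact N.ract_ract c v N.scale_carr N.sum_carr)
    ultimately show
      "kos_lift s (?\<phi> i) (lact (kos_bimod 0) a (kos x u y)) = lact N a (kos_lift s (?\<phi> i) (kos x u y))"
      "kos_lift s (?\<phi> i) (ract (kos_bimod 0) (kos x u y) a) = ract N (kos_lift s (?\<phi> i) (kos x u y)) a"
      "kos_lift s (?\<phi> i) (kos x u y) \<in> carr N"
      by (simp_all add: kos_act_simps on_kos c N.sum_carr N.scale_carr)
  qed
  define h where "h z = (\<Sum>i\<le>n div 4. kos_lift s (?\<phi> i) (Poly_Mapping.lookup z i))" for z
  have hl: "lact N a (\<Sum>i\<in>F. kos_lift s (?\<phi> i) (t i)) = (\<Sum>i\<in>F. lact N a (kos_lift s (?\<phi> i) (t i)))" for a F t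
    by (induction F rule: infinite_finite_induct) (simp_all add: N.lact_zero N.lact_add_right carr N.sum_carr)
  have hr: "ract N (\<Sum>i\<in>F. kos_lift s (?\<phi> i) (t i)) a = (\<Sum>i\<in>F. ract N (kos_lift s (?\<phi> i) (t i)) a)" for a F t
    by (induction F rule: infinite_finite_induct) (simp_all add: N.ract_zero N.ract_add_left carr N.sum_carr)
  have "bimod_hom (res_bimod n) N h"
    unfolding bimod_hom_def h_def
    by (simp add: N.sum_carr carr lookup_add linearD_add [OF lin] sum.distrib hl hr lact ract
        lookup_res_lact [where k = 0] lookup_res_ract [where k = 0])
  moreover have "h (omega i (kos 1 (dual_mon m) 1)) = v i m" if i: "4 * i \<le> n" and m: "m \<in> fkd_basis (n - 4 * i)" for i m
  proof -
    have "h (omega i (kos 1 (dual_mon m) 1)) =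
        (\<Sum>j\<le>n div 4. if j = i then kos_lift s (?\<phi> i) (kos 1 (dual_mon m) 1) else 0)"
      unfolding h_def by (intro sum.cong) (auto simp: lookup_single when_def linearD_zero [OF lin])
    also have "\<dots> = kos_lift s (?\<phi> i) (kos 1 (dual_mon m) 1)"
    proof -
      have "i \<le> n div 4" using i by auto
      then show ?thesis by (simp add: sum.delta)
    qed
    also have "\<dots> = (\<Sum>m'\<in>fkd_basis (n - 4 * i). if m' = m then v i m else 0)"
      unfolding on_kos
      by (intro sum.cong) (auto simp: dual_mon_basis [OF m] N.lact_one N.ract_one v)
    finally show ?thesis using m by (simp add: sum.delta')
  qed
  ultimately show ?thesis by blast
qed

text \<open>Projectivity: preimages under \<open>q\<close> are chosen for the free generators only,
  and \<open>res_hom_eqI\<close> extends the equation to the whole module.\<close>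

lemma res_lift:
  fixes h :: "'k::field res \<Rightarrow> 'n::ab_group_add" and q :: "'l::ab_group_add \<Rightarrow> 'n"
    and s' :: "'k \<Rightarrow> 'l \<Rightarrow> 'l"
  assumes L: "fk_bimodule s' L" and q: "bimod_hom L N q"
    and h: "bimod_hom (res_bimod n) N h" and im: "\<And>z. z \<in> carr (res_bimod n) \<Longrightarrow> h z \<in> q ` carr L"
  shows "\<exists>h'. bimod_hom (res_bimod n) L h' \<and> (\<forall>z\<in>carr (res_bimod n). q (h' z) = h z)"
proof -
  let ?e = "\<lambda>i m. omega i (kos 1 (dual_mon m) 1) :: 'k res"
  \<comment> \<open>The value 0 at indices without a generator keeps \<open>v i m\<close> in the
    carrier for all \<open>i\<close> and \<open>m\<close>, as \<open>res_hom_exists\<close>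
    demands.\<close>
  define v where "v i m = (if 4 * i \<le> n \<and> m \<in> fkd_basis (n - 4 * i)
    then SOME l. l \<in> carr L \<and> q l = h (?e i m) else 0)" for i m
  have v: "v i m \<in> carr L \<and> q (v i m) = h (?e i m)" if "4 * i \<le> n" "m \<in> fkd_basis (n - 4 * i)" for i m
  proof -
    have "\<exists>l. l \<in> carr L \<and> q l = h (?e i m)"
      using im [OF generator_in_carr [OF that, of 1 1]] by force
    from someI_ex [OF this] show ?thesis using that by (simp add: v_def)
  qed
  have "v i m \<in> carr L" for i m
    using v [of i m] fk_bimodule.zero_carr [OF L] by (cases "4 * i \<le> n \<and> m \<in> fkd_basis (n - 4 * i)") (auto simp: v_def)
  from res_hom_exists [where v = v, OF L this, of n] obtain h' where h': "bimod_hom (res_bimod n) L h'"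
    and gen: "\<And>i m. 4 * i \<le> n \<Longrightarrow> m \<in> fkd_basis (n - 4 * i) \<Longrightarrow> h' (?e i m) = v i m" by blast
  have "q (h' z) = h z" if "z \<in> carr (res_bimod n)" for z
    by (rule res_hom_eqI [OF bimod_hom_compose [OF h' q] h _ that]) (simp add: gen v)
  then show ?thesis using h' by blast
qed

text \<open>A chain map that lifts 0 into an exact complex is null homotopic. The target stays
  abstract because the lemma is applied both to the bar resolution and to \<open>P\<close>
  itself.\<close>

lemma res_null_homotopic:
  fixes N :: "nat \<Rightarrow> ('k::field fk, 'n::ab_group_add) bimodule" and s :: "'k \<Rightarrow> 'n \<Rightarrow> 'n"
    and D :: "nat \<Rightarrow> 'n \<Rightarrow> 'n" and aug :: "'n \<Rightarrow> 'r::zero" and \<Psi> :: "nat \<Rightarrow> 'k res \<Rightarrow> 'n"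
  assumes f: "fk_resolution f"
    and N: "\<And>n. fk_bimodule s (N n)"
    and D: "\<And>n. bimod_hom (N (Suc n)) (N n) (D (Suc n))"
    and exact: "\<And>n t. t \<in> carr (N (Suc n)) \<Longrightarrow> D (Suc n) t = 0 \<Longrightarrow> t \<in> D (Suc (Suc n)) ` carr (N (Suc (Suc n)))"
    and exact0: "\<And>t. t \<in> carr (N 0) \<Longrightarrow> aug t = 0 \<Longrightarrow> t \<in> D (Suc 0) ` carr (N (Suc 0))"
    and \<Psi>: "\<And>n. bimod_hom (res_bimod n) (N n) (\<Psi> n)"
    and chain: "\<And>n z. z \<in> carr (res_bimod (Suc n)) \<Longrightarrow> D (Suc n) (\<Psi> (Suc n) z) = \<Psi> n (res_diff f (Suc n) z)"
    and aug: "\<And>z. z \<in> carr (res_bimod 0) \<Longrightarrow> aug (\<Psi> 0 z) = 0"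
  shows "\<exists>S. (\<forall>n. bimod_hom (res_bimod n) (N (Suc n)) (S n)) \<and>
    (\<forall>z\<in>carr (res_bimod 0). \<Psi> 0 z = D (Suc 0) (S 0 z)) \<and>
    (\<forall>n. \<forall>z\<in>carr (res_bimod (Suc n)).
      \<Psi> (Suc n) z = D (Suc (Suc n)) (S (Suc n) z) + S n (res_diff f (Suc n) z))"
proof -
  note per = fk_resolution_periodicity [OF f]
  note d = bimod_hom_res_diff [OF per]
  \<comment> \<open>The last conjunct is the homotopy identity on boundaries, where the term with
    the previous map drops out because the differential squares to 0. It thus constrains a single
    map, as dependent choice requires, and it makes the next obstruction a cycle.\<close>
  let ?P = "\<lambda>n S. bimod_hom (res_bimod n) (N (Suc n)) S \<and>
    (n = 0 \<longrightarrow> (\<forall>z\<in>carr (res_bimod 0). \<Psi> 0 z = D (Suc 0) (S z))) \<and>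
    (\<forall>z\<in>carr (res_bimod (Suc n)). D (Suc n) (S (res_diff f (Suc n) z)) = \<Psi> n (res_diff f (Suc n) z))"
  let ?Q = "\<lambda>n S S'. \<forall>z\<in>carr (res_bimod (Suc n)). \<Psi> (Suc n) z = D (Suc (Suc n)) (S' z) + S (res_diff f (Suc n) z)"
  have "\<exists>S. \<forall>n. ?P n (S n) \<and> ?Q n (S n) (S (Suc n))"
  proof (rule dependent_nat_choice)
    have "\<Psi> 0 z \<in> D (Suc 0) ` carr (N (Suc 0))" if "z \<in> carr (res_bimod 0)" for z
      by (rule exact0 [OF bimod_hom_carr [OF \<Psi> that] aug [OF that]])
    from res_lift [OF N D \<Psi> this] obtain S where
      S: "bimod_hom (res_bimod 0) (N (Suc 0)) S" "\<And>z. z \<in> carr (res_bimod 0) \<Longrightarrow> D (Suc 0) (S z) = \<Psi> 0 z"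
      by blast
    then have "?P 0 S" using bimod_hom_carr [OF d] by auto
    then show "\<exists>S. ?P 0 S" by (rule exI [of _ S])
  next
    fix S n
    assume "?P n S"
    then have S: "bimod_hom (res_bimod n) (N (Suc n)) S"
      and *: "\<And>z. z \<in> carr (res_bimod (Suc n)) \<Longrightarrow> D (Suc n) (S (res_diff f (Suc n) z)) = \<Psi> n (res_diff f (Suc n) z)"
      by blast+
    let ?h = "\<lambda>z. \<Psi> (Suc n) z - S (res_diff f (Suc n) z)"
    have h: "bimod_hom (res_bimod (Suc n)) (N (Suc n)) ?h"
      by (rule bimod_hom_minus [OF \<Psi> bimod_hom_compose [OF d S] N])
    have "?h z \<in> D (Suc (Suc n)) ` carr (N (Suc (Suc n)))" if z: "z \<in> carr (res_bimod (Suc n))" for z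
    proof (rule exact [OF bimod_hom_carr [OF h z]])
      show "D (Suc n) (?h z) = 0"
        by (subst bimod_hom_diff [OF D N N])
          (simp_all add: bimod_hom_carr [OF \<Psi>] bimod_hom_carr [OF S] bimod_hom_carr [OF d] z chain *)
    qed
    from res_lift [OF N D h this] obtain S' where S': "bimod_hom (res_bimod (Suc n)) (N (Suc (Suc n))) S'"
      and eq: "\<And>z. z \<in> carr (res_bimod (Suc n)) \<Longrightarrow> D (Suc (Suc n)) (S' z) = ?h z" by blast
    have "D (Suc (Suc n)) (S' (res_diff f (Suc (Suc n)) z)) = \<Psi> (Suc n) (res_diff f (Suc (Suc n)) z)"
      if z: "z \<in> carr (res_bimod (Suc (Suc n)))" for z
      using bimod_hom_zero [OF S fk_bimodule_res N]
      by (simp add: eq bimod_hom_carr [OF d] z res_diff_diff [OF f])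
    then have "?P (Suc n) S' \<and> ?Q n S S'" using S' eq by auto
    then show "\<exists>S'. ?P (Suc n) S' \<and> ?Q n S S'" by (rule exI [of _ S'])
  qed
  then obtain S where S: "\<forall>n. ?P n (S n) \<and> ?Q n (S n) (S (Suc n))" by (elim exE)
  show ?thesis
  proof (intro exI [of _ S] conjI allI)
    show "bimod_hom (res_bimod n) (N (Suc n)) (S n)" for n
      using S [THEN spec, of n] by (elim conjE)
    show "\<forall>z\<in>carr (res_bimod 0). \<Psi> 0 z = D (Suc 0) (S 0 z)"
      using S [THEN spec, of 0] by (elim conjE) simp
    show "?Q n (S n) (S (Suc n))" for n
      using S [THEN spec, of n] by (elim conjE)
  qed
qed

section \<open>Tensor powers\<close>

lemma
  fixes x :: "'k::field fk"
  shows tens_add: "tens (xs @ (x + y) # ys) = tens (xs @ x # ys) + tens (xs @ y # ys)"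
    and tens_scale: "tens (xs @ fk_scale c x # ys) = ten_scale c (tens (xs @ x # ys))"
proof -
  have *: "abs_ten p = abs_ten q" if "p - q \<in> ten_rels" for p q :: "'k fk list \<Rightarrow>\<^sub>0 'k"
    using pm.span_base [OF that] Quotient3_rel_abs [OF Quotient3_ten, of p q] by blast
  show "tens (xs @ (x + y) # ys) = tens (xs @ x # ys) + tens (xs @ y # ys)"
    unfolding tens_def plus_ten.abs_eq
  proof (rule *)
    show "Poly_Mapping.single (xs @ (x + y) # ys) 1 -
        (Poly_Mapping.single (xs @ x # ys) 1 + Poly_Mapping.single (xs @ y # ys) 1) \<in> ten_rels"
      unfolding ten_rels_def diff_diff_add [symmetric]
      by (rule UnI1, rule CollectI, rule exI [of _ xs], rule exI [of _ x], rule exI [of _ y],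
          rule exI [of _ ys]) simp
  qed
  show "tens (xs @ fk_scale c x # ys) = ten_scale c (tens (xs @ x # ys))"
    unfolding tens_def ten_scale.abs_eq pm_scale_single mult_1_right
  proof (rule *)
    show "Poly_Mapping.single (xs @ fk_scale c x # ys) 1 - Poly_Mapping.single (xs @ x # ys) c \<in> ten_rels"
      unfolding ten_rels_def
      by (rule UnI2, rule CollectI, rule exI [of _ xs], rule exI [of _ c], rule exI [of _ x],
          rule exI [of _ ys]) simp
  qed
qed

lemma multilinearI:
  assumes "\<And>xs ys x y. length xs + 1 + length ys = n \<Longrightarrow> \<phi> (xs @ (x + y) # ys) = \<phi> (xs @ x # ys) + \<phi> (xs @ y # ys)"
    and "\<And>xs ys c x. length xs + 1 + length ys = n \<Longrightarrow> \<phi> (xs @ fk_scale c x # ys) = sc c (\<phi> (xs @ x # ys))"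
  shows "multilinear n sc \<phi>"
  using assms by (simp add: multilinear_def)

lemma
  assumes "multilinear n sc \<phi>" "length xs + 1 + length ys = n"
  shows multilinear_add: "\<phi> (xs @ (x + y) # ys) = \<phi> (xs @ x # ys) + \<phi> (xs @ y # ys)"
    and multilinear_scale: "\<phi> (xs @ fk_scale c x # ys) = sc c (\<phi> (xs @ x # ys))"
  using assms by (simp_all add: multilinear_def)

lemma ten_power_tens: "length xs = n \<Longrightarrow> tens xs \<in> ten_power n"
  unfolding ten_power_def by (rule ten.span_base) blast

lemma ten_power_zero: "0 \<in> ten_power n"
  and ten_power_add: "s \<in> ten_power n \<Longrightarrow> t \<in> ten_power n \<Longrightarrow> s + t \<in> ten_power n"
  and ten_power_diff: "s \<in> ten_power n \<Longrightarrow> t \<in> ten_power n \<Longrightarrow> s - t \<in> ten_power n"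
  and ten_power_scale: "t \<in> ten_power n \<Longrightarrow> ten_scale c t \<in> ten_power n"
  and ten_power_sum: "(\<And>i. i \<in> I \<Longrightarrow> h i \<in> ten_power n) \<Longrightarrow> sum h I \<in> ten_power n"
  by (simp_all add: ten_power_def ten.span_zero ten.span_add ten.span_diff ten.span_scale ten.span_sum)

text \<open>With at least one factor, the first one can absorb scalars, so no scalar case
  arises.\<close>

lemma ten_power_induct [consumes 1, case_names add tens]:
  fixes t :: "'k::field ten"
  assumes t: "t \<in> ten_power (Suc n)"
    and add: "\<And>s t. s \<in> ten_power (Suc n) \<Longrightarrow> t \<in> ten_power (Suc n) \<Longrightarrow> P s \<Longrightarrow> P t \<Longrightarrow> P (s + t)"
    and tens: "\<And>x xs. length xs = n \<Longrightarrow> P (tens (x # xs))"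
  shows "P t"
  using t unfolding ten_power_def
proof (induction rule: ten.span_induct_scaled)
  case (scaled c t)
  then obtain xs where xs: "t = tens xs" "length xs = Suc n" by blast
  then obtain x ys where "xs = x # ys" by (cases xs) auto
  with xs have "ten_scale c t = tens (fk_scale c x # ys)"
    using tens_scale [of "[]" c x ys] by simp
  then show ?case using \<open>xs = x # ys\<close> xs by force
next
  case zero
  have "tens (0 # replicate n 0) = (0 :: 'k ten)"
    using tens_add [of "[]" "0 :: 'k fk" 0 "replicate n 0"] by simp
  then show ?case using tens [of "replicate n 0" 0] by simp
next
  case (add s t)
  then show ?case using assms(2) by (simp add: ten_power_def)
next
  case (base t)
  then obtain xs where xs: "t = tens xs" "length xs = Suc n" by blast
  then show ?case using tens by (cases xs) auto
qed

lemma ten_power_2_hom_induct [consumes 1, case_names add tens]: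
  fixes t :: "'k::field ten"
  assumes t: "t \<in> ten_power 2"
    and add: "\<And>s t. s \<in> ten_power 2 \<Longrightarrow> t \<in> ten_power 2 \<Longrightarrow> P s \<Longrightarrow> P t \<Longrightarrow> P (s + t)"
    and tens: "\<And>x y i j. x \<in> fk_deg i \<Longrightarrow> y \<in> fk_deg j \<Longrightarrow> P (tens [x, y])"
  shows "P t"
proof -
  have two: "(2::nat) = Suc (Suc 0)" by simp
  show ?thesis
    using t unfolding two
  proof (induction rule: ten_power_induct)
    case (tens x xs)
    then obtain y where xs: "xs = [y]" by (cases xs) auto
    have mem: "tens [x, y] \<in> ten_power 2" for x y :: "'k fk" by (rule ten_power_tens) simp
    have "P (tens [x, y])"
    proof (induction x rule: fk_deg_induct)
      case (add x x')
      then show ?case using tens_add [of "[]" x x' "[y]"] by (simp add: assms(2) mem)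
    next
      case (hom i x)
      note x = this
      show ?case
      proof (induction y rule: fk_deg_induct)
        case (add y y')
        then show ?case using tens_add [of "[x]" y y' "[]"] by (simp add: assms(2) mem)
      next
        case (hom j y)
        show ?case by (rule assms(3) [OF x hom])
      qed
    qed
    then show ?case by (simp add: xs)
  qed (use add in \<open>simp add: two\<close>)
qed

section \<open>The enveloping algebra: its action and its derivation\<close>

lemma two_cases:
  assumes "length xs + 1 + length ys = 2"
  obtains y where "xs = []" "ys = [y]" | x where "xs = [x]" "ys = []"
  using assms by (cases xs; cases ys) auto

lemma
  fixes z :: "'k::field res"
  assumes z: "z \<in> carr (res_bimod n)"
  shows env_act_add: "env_act (res_bimod n) (s + t) z = env_act (res_bimod n) s z + env_act (res_bimod n) t z"
    and env_act_tens: "env_act (res_bimod n) (tens [x, y]) z = lact (res_bimod n) x (ract (res_bimod n) z y)"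
proof -
  interpret fk_bimodule res_scale "res_bimod n :: ('k fk, 'k res) bimodule" by (rule fk_bimodule_res)
  \<comment> \<open>\<open>env_act\<close> scales through the left action of
    \<open>fk_scale c 1\<close>. On the whole type this is \<open>res_scale\<close>, so
    \<open>ten_lift\<close> has a vector space as its target.\<close>
  have sc: "(\<lambda>c. lact (res_bimod n) (fk_scale c 1)) = (res_scale :: 'k \<Rightarrow> 'k res \<Rightarrow> 'k res)"
    by (intro ext poly_mapping_eqI) (simp add: lookup_res_lact [where k = 0] kos_bimod_arith)
  have ml: "multilinear 2 res_scale (\<lambda>xs. lact (res_bimod n) (xs ! 0) (ract (res_bimod n) z (xs ! 1)))"
    by (rule multilinearI; erule two_cases)
      (simp_all add: z ract_carr lact_add_left lact_add_right ract_add_right lact_scale_left lact_scale_right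
        ract_scale_right)
  note lin = linear_ten_lift [OF res_vs ml]
  show "env_act (res_bimod n) (s + t) z = env_act (res_bimod n) s z + env_act (res_bimod n) t z"
    "env_act (res_bimod n) (tens [x, y]) z = lact (res_bimod n) x (ract (res_bimod n) z y)"
    unfolding env_act_def sc
    by (rule linearD_add [OF lin], subst ten_lift_tens [OF res_vs ml], simp)
qed

lemma
  assumes "Vector_Spaces.linear fk_scale fk_scale \<rho>"
  shows linear_env_derivation: "Vector_Spaces.linear ten_scale ten_scale (env_derivation \<rho>)"
    and env_derivation_tens: "env_derivation \<rho> (tens [x, y]) = tens [\<rho> x, y] + tens [x, \<rho> y]"
proof -
  have ml: "multilinear 2 ten_scale (\<lambda>xs. tens [\<rho> (xs ! 0), xs ! 1] + tens [xs ! 0, \<rho> (xs ! 1)])"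
  proof (rule multilinearI; erule two_cases)
    fix xs ys x y and c and z
    note l = linearD_add [OF assms] linearD_scale [OF assms]
    note t = tens_add [of "[]" _ _ "[_]", simplified] tens_add [of "[_]" _ _ "[]", simplified]
      tens_scale [of "[]" _ _ "[_]", simplified] tens_scale [of "[_]" _ _ "[]", simplified]
    show "tens [\<rho> ((xs @ (x + y) # ys) ! 0), (xs @ (x + y) # ys) ! 1] + tens [(xs @ (x + y) # ys) ! 0, \<rho> ((xs @ (x + y) # ys) ! 1)] =
      tens [\<rho> ((xs @ x # ys) ! 0), (xs @ x # ys) ! 1] + tens [(xs @ x # ys) ! 0, \<rho> ((xs @ x # ys) ! 1)] +
      (tens [\<rho> ((xs @ y # ys) ! 0), (xs @ y # ys) ! 1] + tens [(xs @ y # ys) ! 0, \<rho> ((xs @ y # ys) ! 1)])"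
      if "xs = []" "ys = [z]" using that by (simp add: l t)
    show "tens [\<rho> ((xs @ (x + y) # ys) ! 0), (xs @ (x + y) # ys) ! 1] + tens [(xs @ (x + y) # ys) ! 0, \<rho> ((xs @ (x + y) # ys) ! 1)] =
      tens [\<rho> ((xs @ x # ys) ! 0), (xs @ x # ys) ! 1] + tens [(xs @ x # ys) ! 0, \<rho> ((xs @ x # ys) ! 1)] +
      (tens [\<rho> ((xs @ y # ys) ! 0), (xs @ y # ys) ! 1] + tens [(xs @ y # ys) ! 0, \<rho> ((xs @ y # ys) ! 1)])"
      if "xs = [z]" "ys = []" using that by (simp add: l t)
    show "tens [\<rho> ((xs @ fk_scale c x # ys) ! 0), (xs @ fk_scale c x # ys) ! 1] + tens [(xs @ fk_scale c x # ys) ! 0, \<rho> ((xs @ fk_scale c x # ys) ! 1)] =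
      ten_scale c (tens [\<rho> ((xs @ x # ys) ! 0), (xs @ x # ys) ! 1] + tens [(xs @ x # ys) ! 0, \<rho> ((xs @ x # ys) ! 1)])"
      if "xs = []" "ys = [z]" using that by (simp add: l t ten.scale_right_distrib)
    show "tens [\<rho> ((xs @ fk_scale c x # ys) ! 0), (xs @ fk_scale c x # ys) ! 1] + tens [(xs @ fk_scale c x # ys) ! 0, \<rho> ((xs @ fk_scale c x # ys) ! 1)] =
      ten_scale c (tens [\<rho> ((xs @ x # ys) ! 0), (xs @ x # ys) ! 1] + tens [(xs @ x # ys) ! 0, \<rho> ((xs @ x # ys) ! 1)])"
      if "xs = [z]" "ys = []" using that by (simp add: l t ten.scale_right_distrib)
  qed
  show "Vector_Spaces.linear ten_scale ten_scale (env_derivation \<rho>)"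
    "env_derivation \<rho> (tens [x, y]) = tens [\<rho> x, y] + tens [x, \<rho> y]"
    unfolding env_derivation_def
    by (rule linear_ten_lift [OF ten_vs ml], subst ten_lift_tens [OF ten_vs ml], simp)
qed

section \<open>The lifting of the Euler derivation\<close>

text \<open>The Leibniz rule on the outer factors plus the internal degree of the generator, which
  is the parameter \<open>c\<close> because it depends on the summand \<omega>_i.\<close>

definition kos_euler :: "'k::field \<Rightarrow> 'k kos \<Rightarrow> 'k kos"
  where "kos_euler c = kos_lift kos_scale (\<lambda>x u y. kos (euler x) u y + kos x u (euler y) + kos_scale c (kos x u y))"

lemma
  shows linear_kos_euler: "Vector_Spaces.linear kos_scale kos_scale (kos_euler c)"
    and kos_euler_kos: "kos_euler c (kos x u y) = kos (euler x) u y + kos x u (euler y) + kos_scale c (kos x u y)"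
proof -
  have 1: "trilinear kos_scale (\<lambda>(x :: 'a fk) u y. kos (euler x) u y)"
    by (rule trilinear_fk_maps [OF trilinear_kos linear_euler linear_ident [OF fk_vs], where k = "\<lambda>u. u"]) simp_all
  have 2: "trilinear kos_scale (\<lambda>(x :: 'a fk) u y. kos x u (euler y))"
    by (rule trilinear_fk_maps [OF trilinear_kos linear_ident [OF fk_vs] linear_euler, where k = "\<lambda>u. u"]) simp_all
  have "trilinear kos_scale (\<lambda>(x :: 'a fk) u y. kos (euler x) u y + kos x u (euler y) + kos_scale c (kos x u y))"
    by (intro trilinear_add trilinear_scale kos_vs 1 2 trilinear_kos)
  from linear_kos_lift [OF kos_vs this] kos_lift_kos [OF kos_vs this]
  show "Vector_Spaces.linear kos_scale kos_scale (kos_euler c)"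
    "kos_euler c (kos x u y) = kos (euler x) u y + kos x u (euler y) + kos_scale c (kos x u y)"
    by (simp_all add: kos_euler_def [abs_def])
qed

definition res_euler :: "nat \<Rightarrow> 'k::field res \<Rightarrow> 'k res"
  where "res_euler n z = (\<Sum>i\<le>n div 4. omega i (kos_euler (of_nat (n + 2 * i)) (Poly_Mapping.lookup z i)))"

lemma res_euler_omega:
  assumes "4 * i \<le> n"
  shows "res_euler n (omega i t) = omega i (kos_euler (of_nat (n + 2 * i)) t)"
proof -
  have "res_euler n (omega i t) = (\<Sum>j\<le>n div 4. if j = i then omega i (kos_euler (of_nat (n + 2 * i)) t) else 0)"
    unfolding res_euler_def
    by (intro sum.cong) (auto simp: lookup_single when_def linearD_zero [OF linear_kos_euler])
  moreover have "i \<le> n div 4" using assms by auto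
  ultimately show ?thesis by simp
qed

lemma linear_res_euler: "Vector_Spaces.linear res_scale res_scale (res_euler n)"
  by (rule linearI [OF res_vs res_vs])
    (simp_all add: res_euler_def lookup_add linearD_add [OF linear_kos_euler] linearD_scale [OF linear_kos_euler]
      single_add sum.distrib res.scale_sum_right res_scale_omega)

lemma res_linear_res_euler: "res_linear n (res_euler n :: 'k::field res \<Rightarrow> 'k res)"
proof -
  interpret fk_bimodule res_scale "res_bimod n :: ('k fk, 'k res) bimodule" by (rule fk_bimodule_res)
  interpret K: fk_bimodule kos_scale "kos_bimod j :: ('k fk, 'k kos) bimodule" for j by (rule fk_bimodule_kos)
  have "res_euler n z \<in> carr (res_bimod n)" if "z \<in> carr (res_bimod n)" for z :: "'k res"
    using that
  proof (induction rule: res_carr_induct)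
    case (omega i x m y)
    then show ?case
      by (simp add: res_euler_omega kos_euler_kos omega_in_carr K.add_carr K.scale_carr kos_in_carr dual_mon_in_dual)
  qed (simp add: linearD_add [OF linear_res_euler] add_carr)
  then show ?thesis
    by (simp add: res_linear_def linearD_add [OF linear_res_euler] linearD_scale [OF linear_res_euler])
qed

text \<open>Written through \<open>euler\<close>, the prescribed operators exist as linear maps at
  once, with no extension of values from a basis.\<close>

lemma euler_maps_res_euler: "euler_maps (res_euler :: nat \<Rightarrow> 'k::field res \<Rightarrow> 'k res)"
  unfolding euler_maps_def
proof (intro conjI allI impI res_linear_res_euler)
  fix n i :: nat and v w m
  assume i: "i \<le> n div 4"
  then have "4 * i \<le> n" by auto
  then show "res_euler n (omega i (kos (fk_mon v) (dual_mon m) (fk_mon w) :: 'k kos)) =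
      res_scale (of_nat (length v + length w + n + 2 * i)) (omega i (kos (fk_mon v) (dual_mon m) (fk_mon w)))"
    by (simp add: res_euler_omega kos_euler_kos euler_mon kos_scale_left kos_scale_right res_scale_omega
        kos.scale_left_distrib algebra_simps)
qed

lemma res_linear_add:
  assumes "res_linear n R" "y \<in> carr (res_bimod n)" "z \<in> carr (res_bimod n)"
  shows "R (y + z) = R y + R z"
  using assms by (simp add: res_linear_def)

text \<open>The operators are given only on tensors of basis words. Since the words of the matching
  length span each homogeneous part of \<open>FK(3)\<close>, the eigenvalue extends to the right
  factor for a fixed left word, and then to the left factor.\<close>

lemma euler_maps_deg:
  fixes R :: "nat \<Rightarrow> 'k::field res \<Rightarrow> 'k res"
  assumes R: "euler_maps R" and z: "z \<in> res_deg n N"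
  shows "R n z = res_scale (of_int N) z"
proof -
  interpret fk_bimodule res_scale "res_bimod n :: ('k fk, 'k res) bimodule" by (rule fk_bimodule_res)
  have lin: "res_linear n (R n)"
    and eig: "\<And>i v w m. i \<le> n div 4 \<Longrightarrow> v \<in> fk_basis \<Longrightarrow> w \<in> fk_basis \<Longrightarrow> m \<in> fkd_basis (n - 4 * i) \<Longrightarrow>
        R n (omega i (kos (fk_mon v) (dual_mon m) (fk_mon w))) =
          res_scale (of_nat (length v + length w + n + 2 * i))
            (omega i (kos (fk_mon v) (dual_mon m) (fk_mon w)))"
    using R by (simp_all add: euler_maps_def)
  have zero: "R n 0 = 0"
    using res_linear_add [OF lin zero_carr zero_carr] by simp
  have scale: "R n (res_scale c y) = res_scale c (R n y)" if "y \<in> carr (res_bimod n)" for c y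
    using lin that by (simp add: res_linear_def)
  have "z \<in> carr (res_bimod n) \<and> R n z = res_scale (of_int N) z"
    using z
  proof (induction rule: res_deg_induct)
    case (add y z)
    then show ?case
      by (simp add: res_linear_add [OF lin] add_carr res.scale_right_distrib)
  next
    case (omega i x m y s t)
    note g = generator_in_carr [OF omega(1,2)]
    have i: "i \<le> n div 4" using omega(1) by auto
    have 1: "R n (omega i (kos (fk_mon v) (dual_mon m) y)) = res_scale (of_int N) (omega i (kos (fk_mon v) (dual_mon m) y))"
      if v: "v \<in> fk_basis" "int (length v) = s" for v
      using fk_deg_span_basis [OF omega(4)]
    proof (induction rule: fk.span_induct_alt)
      case base
      then show ?case by (simp add: zero)
    next
      case (step c y y')
      then obtain w where w: "w \<in> fk_basis" "int (length w) = t" "y = fk_mon w" by blast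
      have N: "N = int (length v + length w + n + 2 * i)"
        using omega(5) v(2) w(2) by simp
      have "R n (omega i (kos (fk_mon v) (dual_mon m) y)) = res_scale (of_int N) (omega i (kos (fk_mon v) (dual_mon m) y))"
        using eig [OF i v(1) w(1) omega(2)] unfolding w(3) N of_int_of_nat_eq .
      then show ?case
        using step(2)
        by (simp add: kos_add_right kos_scale_right single_add res_linear_add [OF lin] g scale_carr scale
            res.scale_right_distrib mult.commute flip: res_scale_omega)
    qed
    show ?case
    proof (intro conjI g)
      show "R n (omega i (kos x (dual_mon m) y)) = res_scale (of_int N) (omega i (kos x (dual_mon m) y))"
        using fk_deg_span_basis [OF omega(3)]
      proof (induction rule: fk.span_induct_alt)
        case base
        then show ?case by (simp add: zero)
      next
        case (step c x x')
        then obtain v where v: "v \<in> fk_basis" "int (length v) = s" "x = fk_mon v" by blast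
        then show ?case
          using step 1 [OF v(1,2)]
          by (simp add: kos_add_left kos_scale_left single_add res_linear_add [OF lin] g scale_carr scale
              res.scale_right_distrib mult.commute flip: res_scale_omega)
      qed
    qed
  qed
  then show ?thesis by simp
qed

section \<open>Euler operators, module actions, augmentation and differential\<close>

lemma res_deg_lact:
  fixes z :: "'k::field res"
  assumes "z \<in> res_deg n N" "a \<in> fk_deg i"
  shows "lact (res_bimod n) a z \<in> res_deg n (i + N)"
  using assms(1)
proof (induction rule: res_deg_induct)
  case (add y z)
  have "lact (res_bimod n) a (y + z) = lact (res_bimod n) a y + lact (res_bimod n) a z"
    by (rule poly_mapping_eqI) (simp add: lookup_res_lact [where k = 0] lookup_add kos_act_simps)
  then show ?case using add by (simp add: res_deg_add)
next
  case (omega j x m y s t)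
  have "i + s + t + int n + 2 * int j = i + N" using omega(5) by simp
  then show ?case
    using omega_kos_in_deg [OF omega(1,2) fk_deg_mult [OF assms(2) omega(3)] omega(4)]
    by (simp only: res_lact_omega [where k = 0] kos_lact_kos)
qed

lemma res_deg_ract:
  fixes z :: "'k::field res"
  assumes "z \<in> res_deg n N" "a \<in> fk_deg i"
  shows "ract (res_bimod n) z a \<in> res_deg n (N + i)"
  using assms(1)
proof (induction rule: res_deg_induct)
  case (add y z)
  have "ract (res_bimod n) (y + z) a = ract (res_bimod n) y a + ract (res_bimod n) z a"
    by (rule poly_mapping_eqI) (simp add: lookup_res_ract [where k = 0] lookup_add kos_act_simps)
  then show ?case using add by (simp add: res_deg_add)
next
  case (omega j x m y s t)
  have "s + (t + i) + int n + 2 * int j = N + i" using omega(5) by simp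
  then show ?case
    using omega_kos_in_deg [OF omega(1,2,3) fk_deg_mult [OF omega(4) assms(2)]]
    by (simp only: res_ract_omega [where k = 0] kos_ract_kos)
qed

lemma
  fixes z :: "'k::field res"
  shows res_aug_add: "res_aug (z + z') = res_aug z + res_aug z'"
    and res_aug_omega: "res_aug (omega 0 (kos x u y) :: 'k res) = fk_scale (u 1) (x * y)"
proof -
  have tri: "trilinear fk_scale (\<lambda>(x :: 'k fk) u y. fk_scale (u 1) (x * y))"
    unfolding trilinear_def
    by (simp add: distrib_left distrib_right fk.scale_right_distrib fk.scale_left_distrib fk_scale_mult_left
        fk_scale_mult_right mult.commute)
  show "res_aug (z + z') = res_aug z + res_aug z'"
    by (simp add: res_aug_def lookup_add linearD_add [OF linear_kos_lift [OF fk_vs tri]])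
  show "res_aug (omega 0 (kos x u y) :: 'k res) = fk_scale (u 1) (x * y)"
    by (simp add: res_aug_def kos_lift_kos [OF fk_vs tri])
qed

lemma bimod_hom_res_aug: "bimod_hom (res_bimod 0) fk_bimod (res_aug :: 'k::field res \<Rightarrow> 'k fk)"
proof -
  interpret fk_bimodule res_scale "res_bimod 0 :: ('k fk, 'k res) bimodule" by (rule fk_bimodule_res)
  have "res_aug (lact (res_bimod 0) a z) = a * res_aug z \<and> res_aug (ract (res_bimod 0) z a) = res_aug z * a"
    if "z \<in> carr (res_bimod 0)" for z :: "'k res" and a
  proof -
    have "z \<in> carr (res_bimod 0) \<and> ?thesis"
      using that
    proof (induction rule: res_carr_induct)
      case (omega i x m y)
      then show ?case
        using generator_in_carr [OF omega]
        by (simp add: res_lact_omega [where k = 0] res_ract_omega [where k = 0] kos_act_simps res_aug_omega mult.assoc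
            fk_scale_mult_left fk_scale_mult_right)
    qed (simp add: lact_add_right ract_add_left res_aug_add distrib_left distrib_right add_carr)
    then show ?thesis by simp
  qed
  then show ?thesis by (simp add: bimod_hom_def res_aug_add)
qed

lemma res_aug_deg:
  fixes z :: "'k::field res"
  assumes "z \<in> res_deg 0 N"
  shows "res_aug z \<in> fk_deg N"
  using assms
proof (induction rule: res_deg_induct)
  case (omega i x m y s t)
  then show ?case
    using fk_deg_mult [OF omega(3,4)] by (simp add: res_aug_omega fk_deg_scale)
qed (simp add: res_aug_add fk_deg_add)

text \<open>On a homogeneous element both composites multiply the boundary by the same degree, as
  the differential preserves internal degree.\<close>

lemma euler_maps_commute:
  fixes f :: "nat \<Rightarrow> 'k::field kos \<Rightarrow> 'k kos"
  assumes f: "periodicity_maps f" and R: "euler_maps R" and z: "z \<in> carr (res_bimod (Suc n))"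
  shows "res_diff f (Suc n) (R (Suc n) z) = R n (res_diff f (Suc n) z)"
proof -
  note d = bimod_hom_res_diff [OF f, of n]
  have lin: "res_linear m (R m)" for m using R by (simp add: euler_maps_def)
  show ?thesis
    using z
  proof (induction rule: res_hom_induct)
    case (add y z)
    have "R (Suc n) y \<in> carr (res_bimod (Suc n))" "R (Suc n) z \<in> carr (res_bimod (Suc n))"
      using lin [of "Suc n"] add(1,2) by (auto simp: res_linear_def)
    then show ?case
      using add by (simp add: res_linear_add [OF lin] bimod_hom_add [OF d] bimod_hom_carr [OF d])
  next
    case (hom N z)
    then show ?case
      using bimod_hom_scale [OF d fk_bimodule_res fk_bimodule_res res_deg_carr [OF hom]]
      by (simp add: euler_maps_deg [OF R hom] euler_maps_deg [OF R res_diff_deg [OF f hom]])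
  qed
qed

text \<open>All three arguments enter additively; on homogeneous ones both sides are i + N + j times
  the same element.\<close>

lemma euler_maps_act:
  fixes R :: "nat \<Rightarrow> 'k::field res \<Rightarrow> 'k res"
  assumes R: "euler_maps R" and z: "z \<in> carr (res_bimod n)"
  shows "R n (lact (res_bimod n) x (ract (res_bimod n) z y)) =
    lact (res_bimod n) (euler x) (ract (res_bimod n) z y) + lact (res_bimod n) x (ract (res_bimod n) z (euler y))
    + lact (res_bimod n) x (ract (res_bimod n) (R n z) y)"
proof -
  interpret fk_bimodule res_scale "res_bimod n :: ('k fk, 'k res) bimodule" by (rule fk_bimodule_res)
  have lin: "res_linear n (R n)" using R by (simp add: euler_maps_def)
  have Rc: "R n z \<in> carr (res_bimod n)" if "z \<in> carr (res_bimod n)" for z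
    using lin that by (simp add: res_linear_def)
  note eu = linearD_add [OF linear_euler]
  show ?thesis
  proof (induction x rule: fk_deg_induct)
    case (add x x')
    then show ?case
      by (simp add: eu lact_add_left ract_carr lact_carr z Rc res_linear_add [OF lin])
  next
    case (hom i x)
    note x = this
    show ?case
    proof (induction y rule: fk_deg_induct)
      case (add y y')
      then show ?case
        by (simp add: eu ract_add_right lact_add_right ract_carr lact_carr z Rc res_linear_add [OF lin])
    next
      case (hom j y)
      note y = this
      show ?case
        using z
      proof (induction rule: res_hom_induct)
        case (add z z')
        then show ?case
          by (simp add: ract_add_left lact_add_right ract_carr lact_carr Rc res_linear_add [OF lin])
      next
        case (hom N z)
        note c = res_deg_carr [OF hom]
        have "lact (res_bimod n) x (ract (res_bimod n) z y) \<in> res_deg n (i + (N + j))"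
          by (intro res_deg_lact res_deg_ract hom x y)
        from euler_maps_deg [OF R this] show ?case
          by (simp add: euler_maps_deg [OF R hom] euler_deg [OF x] euler_deg [OF y] c ract_carr lact_scale_left
              lact_scale_right ract_scale_left ract_scale_right res.scale_left_distrib)
      qed
    qed
  qed
qed

lemma derivation_operator_euler:
  fixes R :: "nat \<Rightarrow> 'k::field res \<Rightarrow> 'k res"
  assumes R: "euler_maps R"
  shows "derivation_operator euler n (R n)"
proof -
  interpret fk_bimodule res_scale "res_bimod n :: ('k fk, 'k res) bimodule" by (rule fk_bimodule_res)
  have lin: "res_linear n (R n)" using R by (simp add: euler_maps_def)
  have Rc: "R n z \<in> carr (res_bimod n)" if "z \<in> carr (res_bimod n)" for z
    using lin that by (simp add: res_linear_def)
  have "R n (env_act (res_bimod n) s z) =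
      env_act (res_bimod n) (env_derivation euler s) z + env_act (res_bimod n) s (R n z) \<and>
      env_act (res_bimod n) s z \<in> carr (res_bimod n)"
    if s: "s \<in> ten_power 2" and z: "z \<in> carr (res_bimod n)" for s z
    using s
  proof (induction rule: ten_power_2_hom_induct)
    case (add s t)
    then show ?case
      by (simp add: env_act_add z Rc linearD_add [OF linear_env_derivation [OF linear_euler]] add_carr
          res_linear_add [OF lin])
  next
    case (tens x y i j)
    show ?case
      using euler_maps_act [OF R z]
      by (simp add: env_act_tens env_act_add z Rc env_derivation_tens [OF linear_euler] lact_carr ract_carr)
  qed
  then show ?thesis
    using lin by (simp add: derivation_operator_def)
qed

lemma derivation_lifting_euler:
  fixes f :: "nat \<Rightarrow> 'k::field kos \<Rightarrow> 'k kos"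
  assumes f: "periodicity_maps f" and R: "euler_maps R"
  shows "derivation_lifting f euler R"
proof -
  interpret fk_bimodule res_scale "res_bimod 0 :: ('k fk, 'k res) bimodule" by (rule fk_bimodule_res)
  have lin: "res_linear 0 (R 0)" using R by (simp add: euler_maps_def)
  have "res_aug (R 0 z) = euler (res_aug z)" if "z \<in> carr (res_bimod 0)" for z
    using that
  proof (induction rule: res_hom_induct)
    case (hom N z)
    then show ?case
      using bimod_hom_scale [OF bimod_hom_res_aug fk_bimodule_res fk_bimodule_fk res_deg_carr [OF hom]]
      by (simp add: euler_maps_deg [OF R hom] euler_deg [OF res_aug_deg [OF hom]])
  qed (simp add: res_linear_add [OF lin] res_aug_add linearD_add [OF linear_euler])
  moreover have "res_diff f n (R n z) = R (n - 1) (res_diff f n z)" if "n \<ge> 1" "z \<in> carr (res_bimod n)" for n z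
    using that euler_maps_commute [OF f R, of z "n - 1"] by (cases n) auto
  ultimately show ?thesis
    unfolding derivation_lifting_def using derivation_operator_euler [OF R] by blast
qed

section \<open>The bar resolution\<close>

text \<open>
  Prepending the factor \<open>1\<close> is a contracting homotopy of the bar complex.  The operator \<open>ten_cons n a\<close> also serves
  for recursion: the bar differential, the actions and derivations are determined by how they commute with it.
\<close>

definition ten_cons :: "nat \<Rightarrow> 'k::field fk \<Rightarrow> 'k ten \<Rightarrow> 'k ten"
  where "ten_cons n a = ten_lift n ten_scale (\<lambda>xs. tens (a # xs))"

definition ten_lact :: "nat \<Rightarrow> 'k::field fk \<Rightarrow> 'k ten \<Rightarrow> 'k ten"
  where "ten_lact n a = ten_lift n ten_scale (\<lambda>xs. tens ((a * hd xs) # tl xs))"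

definition ten_ract :: "nat \<Rightarrow> 'k::field ten \<Rightarrow> 'k fk \<Rightarrow> 'k ten"
  where "ten_ract n t a = ten_lift n ten_scale (\<lambda>xs. tens (butlast xs @ [last xs * a])) t"

definition ten_der :: "nat \<Rightarrow> ('k::field fk \<Rightarrow> 'k fk) \<Rightarrow> 'k ten \<Rightarrow> 'k ten"
  where "ten_der n g = ten_lift n ten_scale (\<lambda>xs. \<Sum>j<n. tens (xs[j := g (xs ! j)]))"

lemma
  shows linear_ten_cons: "Vector_Spaces.linear ten_scale ten_scale (ten_cons n a)"
    and ten_cons_tens: "length xs = n \<Longrightarrow> ten_cons n a (tens xs) = tens (a # xs)"
proof -
  have ml: "multilinear n ten_scale (\<lambda>xs. tens (a # xs))"
    by (rule multilinearI) (simp_all flip: append_Cons add: tens_add tens_scale)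
  show "Vector_Spaces.linear ten_scale ten_scale (ten_cons n a)"
    "length xs = n \<Longrightarrow> ten_cons n a (tens xs) = tens (a # xs)"
    unfolding ten_cons_def by (rule linear_ten_lift [OF ten_vs ml]) (simp add: ten_lift_tens [OF ten_vs ml])
qed

lemma
  shows linear_ten_lact: "Vector_Spaces.linear ten_scale ten_scale (ten_lact n a)"
    and ten_lact_tens: "length xs = n \<Longrightarrow> ten_lact (Suc n) a (tens (x # xs)) = tens ((a * x) # xs)"
proof -
  have ml: "multilinear n ten_scale (\<lambda>xs. tens ((a * hd xs) # tl xs))" for n
  proof (rule multilinearI)
    fix xs ys :: "'a fk list" and x y and c
    show "tens ((a * hd (xs @ (x + y) # ys)) # tl (xs @ (x + y) # ys)) =
        tens ((a * hd (xs @ x # ys)) # tl (xs @ x # ys)) + tens ((a * hd (xs @ y # ys)) # tl (xs @ y # ys))"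
      using tens_add [of "[]"] tens_add [of "(a * hd xs) # tl xs"] by (cases xs) (simp_all add: distrib_left)
    show "tens ((a * hd (xs @ fk_scale c x # ys)) # tl (xs @ fk_scale c x # ys)) =
        ten_scale c (tens ((a * hd (xs @ x # ys)) # tl (xs @ x # ys)))"
      using tens_scale [of "[]"] tens_scale [of "(a * hd xs) # tl xs"] by (cases xs) (simp_all add: fk_scale_mult_right)
  qed
  show "Vector_Spaces.linear ten_scale ten_scale (ten_lact n a)"
    "length xs = n \<Longrightarrow> ten_lact (Suc n) a (tens (x # xs)) = tens ((a * x) # xs)"
    unfolding ten_lact_def by (rule linear_ten_lift [OF ten_vs ml]) (simp add: ten_lift_tens [OF ten_vs ml])
qed

lemma
  shows linear_ten_ract: "Vector_Spaces.linear ten_scale ten_scale (\<lambda>t. ten_ract n t a)"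
    and ten_ract_tens: "length xs = n \<Longrightarrow> ten_ract (Suc n) (tens (xs @ [x])) a = tens (xs @ [x * a])"
proof -
  have ml: "multilinear n ten_scale (\<lambda>xs. tens (butlast xs @ [last xs * a]))" for n
  proof (rule multilinearI)
    fix xs ys :: "'a fk list" and x y and c
    show "tens (butlast (xs @ (x + y) # ys) @ [last (xs @ (x + y) # ys) * a]) =
        tens (butlast (xs @ x # ys) @ [last (xs @ x # ys) * a]) + tens (butlast (xs @ y # ys) @ [last (xs @ y # ys) * a])"
      using tens_add [of xs _ _ "[]"] tens_add [of xs _ _ "butlast ys @ [last ys * a]"]
      by (cases ys) (simp_all add: distrib_right butlast_append)
    show "tens (butlast (xs @ fk_scale c x # ys) @ [last (xs @ fk_scale c x # ys) * a]) =
        ten_scale c (tens (butlast (xs @ x # ys) @ [last (xs @ x # ys) * a]))"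
      using tens_scale [of xs _ _ "[]"] tens_scale [of xs _ _ "butlast ys @ [last ys * a]"]
      by (cases ys) (simp_all add: fk_scale_mult_left butlast_append)
  qed
  show "Vector_Spaces.linear ten_scale ten_scale (\<lambda>t. ten_ract n t a)"
    "length xs = n \<Longrightarrow> ten_ract (Suc n) (tens (xs @ [x])) a = tens (xs @ [x * a])"
    unfolding ten_ract_def by (rule linear_ten_lift [OF ten_vs ml]) (simp add: ten_lift_tens [OF ten_vs ml])
qed

lemma multilinear_tens_sum:
  assumes "\<And>j. j \<in> J \<Longrightarrow> multilinear n ten_scale (\<phi> j)"
  shows "multilinear n ten_scale (\<lambda>xs. \<Sum>j\<in>J. \<phi> j xs)"
  by (rule multilinearI)
    (simp_all add: multilinear_add [OF assms] multilinear_scale [OF assms] sum.distrib ten.scale_sum_right)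

lemma
  assumes g: "Vector_Spaces.linear fk_scale fk_scale g"
  shows linear_ten_der: "Vector_Spaces.linear ten_scale ten_scale (ten_der n g)"
    and ten_der_tens: "length xs = n \<Longrightarrow> ten_der n g (tens xs) = (\<Sum>j<n. tens (xs[j := g (xs ! j)]))"
proof -
  have ml: "multilinear n ten_scale (\<lambda>xs. \<Sum>j<n. tens (xs[j := g (xs ! j)]))"
  proof (intro multilinear_tens_sum multilinearI)
    fix j and xs ys :: "'a fk list" and x y and c
    assume "j \<in> {..<n}" "length xs + 1 + length ys = n"
    consider "j < length xs" | "j = length xs" | i where "j = length xs + 1 + i"
      by (metis Suc_eq_plus1 less_imp_Suc_add linorder_less_linear add_Suc)
    note cases = this
    \<comment> \<open>The replaced position lies before, at or after the slot whose linearity is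
      tested; only in the second case does linearity of \<open>g\<close> enter.\<close>
    have upd: "(xs @ x # ys)[j := g ((xs @ x # ys) ! j)] =
      (if j < length xs then xs[j := g (xs ! j)] @ x # ys else if j = length xs then xs @ g x # ys
       else xs @ x # ys[j - Suc (length xs) := g (ys ! (j - Suc (length xs)))])" for x
      by (cases rule: cases) (auto simp: list_update_append nth_append)
    show "tens ((xs @ (x + y) # ys)[j := g ((xs @ (x + y) # ys) ! j)]) =
        tens ((xs @ x # ys)[j := g ((xs @ x # ys) ! j)]) + tens ((xs @ y # ys)[j := g ((xs @ y # ys) ! j)])"
      unfolding upd by (simp add: tens_add linearD_add [OF g])
    show "tens ((xs @ fk_scale c x # ys)[j := g ((xs @ fk_scale c x # ys) ! j)]) =
        ten_scale c (tens ((xs @ x # ys)[j := g ((xs @ x # ys) ! j)]))"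
      unfolding upd by (simp add: tens_scale linearD_scale [OF g])
  qed
  show "Vector_Spaces.linear ten_scale ten_scale (ten_der n g)"
    "length xs = n \<Longrightarrow> ten_der n g (tens xs) = (\<Sum>j<n. tens (xs[j := g (xs ! j)]))"
    unfolding ten_der_def by (rule linear_ten_lift [OF ten_vs ml]) (simp add: ten_lift_tens [OF ten_vs ml])
qed

lemma
  fixes xs :: "'k::field fk list"
  shows linear_bar_diff: "Vector_Spaces.linear ten_scale ten_scale (bar_diff n :: 'k ten \<Rightarrow> 'k ten)"
    and bar_diff_tens: "length xs = n + 2 \<Longrightarrow> bar_diff n (tens xs) =
      (\<Sum>j\<le>n. ten_scale ((-1) ^ j) (tens (take j xs @ [xs ! j * xs ! (j + 1)] @ drop (j + 2) xs)))"
proof -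
  have ml: "multilinear (n + 2) ten_scale
      (\<lambda>xs :: 'k fk list. \<Sum>j\<le>n. ten_scale ((-1) ^ j) (tens (take j xs @ [xs ! j * xs ! (j + 1)] @ drop (j + 2) xs)))"
  proof (intro multilinear_tens_sum multilinearI)
    fix j and xs ys :: "'k fk list" and x y and c
    assume j: "j \<in> {..n}" "length xs + 1 + length ys = n + 2"
    consider "j + 1 < length xs" | "j + 1 = length xs" | "j = length xs" | "j > length xs"
      by linarith
    note cases = this
    let ?\<phi> = "\<lambda>xs. tens (take j xs @ [xs ! j * xs ! (j + 1)] @ drop (j + 2) xs) :: 'k ten"
    \<comment> \<open>The multiplied pair of neighbours lies before the tested slot, has it as right
      or as left factor, or lies after it.\<close>
    have split: "?\<phi> (xs @ x # ys) =
      (if j + 1 < length xs then tens ((take j xs @ [xs ! j * xs ! (j + 1)] @ drop (j + 2) xs) @ x # ys)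
       else if j + 1 = length xs then tens (take j xs @ (xs ! j * x) # ys)
       else if j = length xs then tens (xs @ (x * ys ! 0) # tl ys)
       else tens (xs @ x # (take (j - Suc (length xs)) ys @ [ys ! (j - Suc (length xs)) * ys ! (j - length xs)]
          @ drop (Suc j - length xs) ys)))" for x
      using j
      by (cases rule: cases)
        (auto simp: nth_append take_Cons' drop_Cons' Suc_diff_Suc drop_Suc numeral_2_eq_2
          less_Suc_eq_le Suc_diff_le nth_Cons')
    have "?\<phi> (xs @ (x + y) # ys) = ?\<phi> (xs @ x # ys) + ?\<phi> (xs @ y # ys)"
      unfolding split by (simp add: tens_add distrib_left distrib_right del: append_assoc)
    from arg_cong [OF this, of "ten_scale ((-1) ^ j)"]
    show "ten_scale ((-1) ^ j) (?\<phi> (xs @ (x + y) # ys)) =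
        ten_scale ((-1) ^ j) (?\<phi> (xs @ x # ys)) + ten_scale ((-1) ^ j) (?\<phi> (xs @ y # ys))"
      unfolding ten.scale_right_distrib .
    have "?\<phi> (xs @ fk_scale c x # ys) = ten_scale c (?\<phi> (xs @ x # ys))"
      unfolding split by (simp add: tens_scale fk_scale_mult_left fk_scale_mult_right del: append_assoc)
    then show "ten_scale ((-1) ^ j) (?\<phi> (xs @ fk_scale c x # ys)) = ten_scale c (ten_scale ((-1) ^ j) (?\<phi> (xs @ x # ys)))"
      by (simp only: ten.scale_left_commute)
  qed
  show "Vector_Spaces.linear ten_scale ten_scale (bar_diff n :: 'k ten \<Rightarrow> 'k ten)"
    "length xs = n + 2 \<Longrightarrow> bar_diff n (tens xs) =
      (\<Sum>j\<le>n. ten_scale ((-1) ^ j) (tens (take j xs @ [xs ! j * xs ! (j + 1)] @ drop (j + 2) xs)))"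
    unfolding bar_diff_def
    by (rule linear_ten_lift [OF ten_vs ml]) (simp only: ten_lift_tens [OF ten_vs ml] refl if_True)
qed


section \<open>Recursion along the first tensor factor\<close>

lemma ten_power_cons_induct [consumes 1, case_names add cons]:
  fixes t :: "'k::field ten"
  assumes t: "t \<in> ten_power (Suc n)"
    and add: "\<And>s t. s \<in> ten_power (Suc n) \<Longrightarrow> t \<in> ten_power (Suc n) \<Longrightarrow> P s \<Longrightarrow> P t \<Longrightarrow> P (s + t)"
    and cons: "\<And>x s. s \<in> ten_power n \<Longrightarrow> P (ten_cons n x s)"
  shows "P t"
  using t
proof (induction rule: ten_power_induct)
  case (tens x xs)
  then show ?case
    using cons [OF ten_power_tens [OF tens], of x] by (simp add: ten_cons_tens)
qed (rule add)

lemma ten_power_linear_eqI: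
  assumes "Vector_Spaces.linear ten_scale sc h" "Vector_Spaces.linear ten_scale sc h'"
    and "\<And>xs. length xs = n \<Longrightarrow> h (tens xs) = h' (tens xs)" and "t \<in> ten_power n"
  shows "h t = h' t"
  using assms(4) unfolding ten_power_def
  by (induction rule: ten.span_induct_alt)
    (auto simp: linearD_zero [OF assms(1)] linearD_zero [OF assms(2)] linearD_add [OF assms(1)]
      linearD_add [OF assms(2)] linearD_scale [OF assms(1)] linearD_scale [OF assms(2)] assms(3))

lemma ten_power_linear_mem:
  fixes h :: "'k::field ten \<Rightarrow> 'k ten"
  assumes "Vector_Spaces.linear ten_scale ten_scale h"
    and "\<And>xs. length xs = n \<Longrightarrow> h (tens xs) \<in> ten_power m" and "t \<in> ten_power n"
  shows "h t \<in> ten_power m"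
  using assms(3) unfolding ten_power_def [of n]
  by (induction rule: ten.span_induct_alt)
    (auto simp: linearD_zero [OF assms(1)] linearD_add [OF assms(1)] linearD_scale [OF assms(1)] assms(2)
      intro!: ten_power_zero ten_power_add ten_power_scale)

lemma ten_cons_mem: "t \<in> ten_power n \<Longrightarrow> ten_cons n a t \<in> ten_power (Suc n)"
  by (erule ten_power_linear_mem [OF linear_ten_cons, rotated]) (simp add: ten_cons_tens ten_power_tens)

lemma ten_lact_mem: "t \<in> ten_power (Suc n) \<Longrightarrow> ten_lact (Suc n) a t \<in> ten_power (Suc n)"
  by (erule ten_power_linear_mem [OF linear_ten_lact, rotated])
    (auto simp: ten_lact_tens ten_power_tens length_Suc_conv)

lemma ten_ract_mem: "t \<in> ten_power (Suc n) \<Longrightarrow> ten_ract (Suc n) t a \<in> ten_power (Suc n)"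
proof (erule ten_power_linear_mem [OF linear_ten_ract, rotated])
  fix xs :: "'a fk list"
  assume "length xs = Suc n"
  then show "ten_ract (Suc n) (tens xs) a \<in> ten_power (Suc n)"
    by (cases xs rule: rev_cases) (auto simp: ten_ract_tens ten_power_tens)
qed

lemma ten_der_mem:
  "Vector_Spaces.linear fk_scale fk_scale g \<Longrightarrow> t \<in> ten_power n \<Longrightarrow> ten_der n g t \<in> ten_power n"
  by (rule ten_power_linear_mem [OF linear_ten_der])
    (auto simp: ten_der_tens intro!: ten_power_sum ten_power_tens)

lemma bar_diff_mem: "t \<in> ten_power (n + 2) \<Longrightarrow> bar_diff n t \<in> ten_power (n + 1)"
  by (erule ten_power_linear_mem [OF linear_bar_diff, rotated])
    (auto simp: bar_diff_tens intro!: ten_power_sum ten_power_scale ten_power_tens)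

lemma linear_ten_cons_arg: "Vector_Spaces.linear fk_scale ten_scale (\<lambda>a. ten_cons n a t)" if "t \<in> ten_power n"
proof -
  have "ten_cons n (x + y) t = ten_cons n x t + ten_cons n y t" for x y
    by (rule ten_power_linear_eqI [OF linear_ten_cons _ _ that, where h' = "\<lambda>t. ten_cons n x t + ten_cons n y t"])
      (auto intro!: linearI [OF ten_vs ten_vs] simp: linearD_add [OF linear_ten_cons] linearD_scale [OF linear_ten_cons]
        ten.scale_right_distrib ten_cons_tens tens_add [of "[]", simplified])
  moreover have "ten_cons n (fk_scale c x) t = ten_scale c (ten_cons n x t)" for c x
    by (rule ten_power_linear_eqI [OF linear_ten_cons _ _ that, where h' = "\<lambda>t. ten_scale c (ten_cons n x t)"])
      (auto intro!: linearI [OF ten_vs ten_vs] simp: linearD_add [OF linear_ten_cons] linearD_scale [OF linear_ten_cons]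
        ten.scale_right_distrib ten_cons_tens tens_scale [of "[]", simplified] mult.commute)
  ultimately show ?thesis by (intro linearI [OF fk_vs ten_vs])
qed

lemma ten_lact_cons:
  assumes "t \<in> ten_power n"
  shows "ten_lact (Suc n) a (ten_cons n x t) = ten_cons n (a * x) t"
  by (rule ten_power_linear_eqI [OF linear_compose [OF linear_ten_cons linear_ten_lact] linear_ten_cons _ assms])
    (simp add: ten_cons_tens ten_lact_tens)

lemma ten_ract_cons:
  assumes "t \<in> ten_power (Suc n)"
  shows "ten_ract (Suc (Suc n)) (ten_cons (Suc n) x t) a = ten_cons (Suc n) x (ten_ract (Suc n) t a)"
proof (rule ten_power_linear_eqI [OF linear_compose [OF linear_ten_cons linear_ten_ract]
      linear_compose [OF linear_ten_ract linear_ten_cons] _ assms])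
  fix xs :: "'a fk list"
  assume "length xs = Suc n"
  then obtain ys y where "xs = ys @ [y]" "length ys = n" by (cases xs rule: rev_cases) auto
  then show "ten_ract (Suc (Suc n)) (ten_cons (Suc n) x (tens xs)) a = ten_cons (Suc n) x (ten_ract (Suc n) (tens xs) a)"
    using ten_ract_tens [of "x # ys" "Suc n" y a] by (simp add: ten_cons_tens ten_ract_tens)
qed

lemma ten_der_cons:
  assumes g: "Vector_Spaces.linear fk_scale fk_scale g" and t: "t \<in> ten_power n"
  shows "ten_der (Suc n) g (ten_cons n x t) = ten_cons n (g x) t + ten_cons n x (ten_der n g t)"
proof (rule ten_power_linear_eqI [OF linear_compose [OF linear_ten_cons linear_ten_der [OF g]] _ _ t])
  show "Vector_Spaces.linear ten_scale ten_scale (\<lambda>t. ten_cons n (g x) t + ten_cons n x (ten_der n g t))"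
    by (rule linearI [OF ten_vs ten_vs])
      (simp_all add: linearD_add [OF linear_ten_cons] linearD_scale [OF linear_ten_cons]
        linearD_add [OF linear_ten_der [OF g]] linearD_scale [OF linear_ten_der [OF g]] ten.scale_right_distrib)
  fix xs :: "'a fk list"
  assume "length xs = n"
  then show "ten_der (Suc n) g (ten_cons n x (tens xs)) = ten_cons n (g x) (tens xs) + ten_cons n x (ten_der n g (tens xs))"
    by (simp add: ten_cons_tens ten_der_tens [OF g] sum.lessThan_Suc_shift linearD_sum [OF linear_ten_cons]
        del: sum.lessThan_Suc)
qed

text \<open>The summand j = 0 multiplies \<open>x\<close> into \<open>t\<close>; in all others
  \<open>x\<close> is a spectator and the shift of the index flips the sign.\<close>

lemma bar_diff_cons:
  assumes t: "t \<in> ten_power (n + 2)"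
  shows "bar_diff (Suc n) (ten_cons (n + 2) x t) = ten_lact (n + 2) x t - ten_cons (n + 1) x (bar_diff n t)"
proof (rule ten_power_linear_eqI [OF linear_compose [OF linear_ten_cons linear_bar_diff] _ _ t])
  show "Vector_Spaces.linear ten_scale ten_scale (\<lambda>t. ten_lact (n + 2) x t - ten_cons (n + 1) x (bar_diff n t))"
    by (rule linearI [OF ten_vs ten_vs])
      (simp_all add: linearD_add [OF linear_ten_cons] linearD_scale [OF linear_ten_cons]
        linearD_add [OF linear_bar_diff] linearD_scale [OF linear_bar_diff]
        linearD_add [OF linear_ten_lact] linearD_scale [OF linear_ten_lact] ten.scale_right_diff_distrib)
  fix xs :: "'a fk list"
  assume l: "length xs = n + 2"
  then obtain y ys where xs: "xs = y # ys" "length ys = Suc n" by (cases xs) auto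
  have neg: "ten_scale ((- 1) ^ Suc j) s = - ten_scale ((- 1) ^ j) s" for j and s :: "'a ten"
    by (simp add: ten.scale_minus_left)
  have "bar_diff (Suc n) (tens (x # xs)) = tens ((x * y) # ys) -
      (\<Sum>j\<le>n. ten_scale ((- 1) ^ j) (tens (x # (take j xs @ [xs ! j * xs ! (j + 1)] @ drop (j + 2) xs))))"
    using l by (subst bar_diff_tens) (simp_all add: sum.atMost_Suc_shift neg xs(1) sum_negf
        ten.scale_minus_left del: sum.atMost_Suc power_Suc)
  also have "\<dots> = ten_lact (n + 2) x (tens xs) - ten_cons (n + 1) x (bar_diff n (tens xs))"
    using l xs by (simp add: bar_diff_tens linearD_sum [OF linear_ten_cons] linearD_scale [OF linear_ten_cons]
        ten_cons_tens ten_lact_tens)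
  finally show "bar_diff (Suc n) (ten_cons (n + 2) x (tens xs)) =
      ten_lact (n + 2) x (tens xs) - ten_cons (n + 1) x (bar_diff n (tens xs))"
    using l by (simp add: ten_cons_tens)
qed

section \<open>The bar complex as an exact complex of bimodules\<close>

lemma bar_diff_0_tens: "bar_diff 0 (tens [x, y]) = tens [x * y]"
  by (simp add: bar_diff_tens)

lemma carr_bar [simp]: "carr (bar_bimod n) = ten_power (Suc (Suc n))"
  and lact_bar [simp]: "lact (bar_bimod n) = ten_lact (Suc (Suc n))"
  and ract_bar [simp]: "ract (bar_bimod n) = ten_ract (Suc (Suc n))"
  by (simp_all add: bar_bimod_def ten_lact_def [abs_def] ten_ract_def [abs_def])

lemma bar_induct [consumes 1, case_names add tens]:
  fixes t :: "'k::field ten"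
  assumes t: "t \<in> ten_power (Suc (Suc n))"
    and add: "\<And>s t. s \<in> ten_power (Suc (Suc n)) \<Longrightarrow> t \<in> ten_power (Suc (Suc n)) \<Longrightarrow> P s \<Longrightarrow> P t \<Longrightarrow> P (s + t)"
    and tens: "\<And>x ys y. length ys = n \<Longrightarrow> P (tens (x # ys @ [y]))"
  shows "P t"
  using t
proof (induction rule: ten_power_induct)
  case (tens x xs)
  then obtain ys y where "xs = ys @ [y]" "length ys = n" by (cases xs rule: rev_cases) auto
  then show ?case using assms(3) by simp
qed (rule add)

lemma bar_lact_tens: "length ys = n \<Longrightarrow> ten_lact (Suc (Suc n)) a (tens (x # ys @ [y])) = tens ((a * x) # ys @ [y])"
  by (simp add: ten_lact_tens)

lemma bar_ract_tens: "length ys = n \<Longrightarrow> ten_ract (Suc (Suc n)) (tens (x # ys @ [y])) a = tens (x # ys @ [y * a])"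
  using ten_ract_tens [of "x # ys" "Suc n" y a] by simp

lemma tens_add_hd: "tens ((x + x') # xs) = tens (x # xs) + tens (x' # xs)"
  and tens_add_last: "tens (x # ys @ [y + y']) = tens (x # ys @ [y]) + tens (x # ys @ [y'])"
  and tens_scale_hd: "tens (fk_scale c x # xs) = ten_scale c (tens (x # xs))"
  and tens_scale_last: "tens (x # ys @ [fk_scale c y]) = ten_scale c (tens (x # ys @ [y]))"
  using tens_add [of "[]" x x' xs] tens_add [of "x # ys" y y' "[]"]
    tens_scale [of "[]" c x xs] tens_scale [of "x # ys" c y "[]"] by simp_all

lemma fk_bimodule_bar: "fk_bimodule ten_scale (bar_bimod n :: ('k::field fk, 'k ten) bimodule)"
proof (rule fk_bimodule.intro [OF ten_vs], unfold_locales, unfold carr_bar lact_bar ract_bar)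
  fix m m' :: "'k ten" and x y :: "'k fk" and c :: 'k
  note add = linearD_add [OF linear_ten_lact] linearD_add [OF linear_ten_ract]
  show "0 \<in> ten_power (Suc (Suc n))" by (rule ten_power_zero)
  assume m: "m \<in> ten_power (Suc (Suc n))"
  show "m + m' \<in> ten_power (Suc (Suc n))" if "m' \<in> ten_power (Suc (Suc n))"
    using m that by (rule ten_power_add)
  show "ten_lact (Suc (Suc n)) x m \<in> ten_power (Suc (Suc n))" "ten_ract (Suc (Suc n)) m x \<in> ten_power (Suc (Suc n))"
    using m by (simp_all add: ten_lact_mem ten_ract_mem)
  show "ten_lact (Suc (Suc n)) x (m + m') = ten_lact (Suc (Suc n)) x m + ten_lact (Suc (Suc n)) x m'"
    "ten_ract (Suc (Suc n)) (m + m') x = ten_ract (Suc (Suc n)) m x + ten_ract (Suc (Suc n)) m' x"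
    by (simp_all add: add)
  show "ten_lact (Suc (Suc n)) (x + y) m = ten_lact (Suc (Suc n)) x m + ten_lact (Suc (Suc n)) y m"
    "ten_ract (Suc (Suc n)) m (x + y) = ten_ract (Suc (Suc n)) m x + ten_ract (Suc (Suc n)) m y"
    "ten_lact (Suc (Suc n)) x (ten_lact (Suc (Suc n)) y m) = ten_lact (Suc (Suc n)) (x * y) m"
    "ten_ract (Suc (Suc n)) (ten_ract (Suc (Suc n)) m x) y = ten_ract (Suc (Suc n)) m (x * y)"
    "ten_ract (Suc (Suc n)) (ten_lact (Suc (Suc n)) x m) y = ten_lact (Suc (Suc n)) x (ten_ract (Suc (Suc n)) m y)"
    "ten_lact (Suc (Suc n)) (fk_scale c 1) m = ten_scale c m"
    "ten_ract (Suc (Suc n)) m (fk_scale c 1) = ten_scale c m"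
    using m
    by (induction rule: bar_induct)
      (simp_all add: add bar_lact_tens bar_ract_tens distrib_left distrib_right tens_add_hd tens_add_last mult.assoc
        fk_scale_mult_left fk_scale_mult_right tens_scale_hd tens_scale_last ten.scale_right_distrib algebra_simps)
qed

lemma bar_diff_lact:
  assumes "t \<in> ten_power (Suc (Suc (Suc n)))"
  shows "bar_diff (Suc n) (ten_lact (Suc (Suc (Suc n))) a t) = ten_lact (Suc (Suc n)) a (bar_diff (Suc n) t)"
  using assms
proof (induction rule: ten_power_cons_induct)
  case (add s t)
  then show ?case by (simp add: linearD_add [OF linear_ten_lact] linearD_add [OF linear_bar_diff])
next
  case (cons x s)
  then show ?case
    using bar_diff_cons [of s n] bar_diff_mem [of s n] fk_bimodule.lact_lact [OF fk_bimodule_bar, of s n]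
    by (simp add: ten_lact_cons linearD_diff [OF linear_ten_lact])
qed

lemma bar_diff_ract:
  assumes "t \<in> ten_power (Suc (Suc n))"
  shows "bar_diff n (ten_ract (Suc (Suc n)) t a) = ten_ract (Suc n) (bar_diff n t) a"
  using assms
proof (induction n arbitrary: t)
  case 0
  then show ?case
  proof (induction rule: bar_induct)
    case (tens x ys y)
    then show ?case
      using ten_ract_tens [of "[]" 0 "x * y" a] bar_ract_tens [of "[]" 0 x y a]
      by (simp add: bar_diff_0_tens mult.assoc)
  qed (simp add: linearD_add [OF linear_ten_ract] linearD_add [OF linear_bar_diff])
next
  case (Suc n)
  show ?case
    using Suc.prems
  proof (induction rule: ten_power_cons_induct)
    case (add s t)
    then show ?case by (simp add: linearD_add [OF linear_ten_ract] linearD_add [OF linear_bar_diff])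
  next
    case (cons x s)
    then show ?case
      using bar_diff_cons [of s n] bar_diff_cons [of "ten_ract (Suc (Suc n)) s a" n] bar_diff_mem [of s n] ten_ract_mem [of s "Suc n" a]
        fk_bimodule.ract_lact [OF fk_bimodule_bar, of s n x a] Suc.IH [OF cons]
      by (simp add: ten_ract_cons linearD_diff [OF linear_ten_ract])
  qed
qed

lemma bimod_hom_bar_diff: "bimod_hom (bar_bimod (Suc n)) (bar_bimod n) (bar_diff (Suc n))"
  by (simp add: bimod_hom_def linearD_add [OF linear_bar_diff] bar_diff_lact bar_diff_ract
      bar_diff_mem [where n = "Suc n", simplified])

text \<open>By the recursion, d(d(x|s)) = d(x s) - x d(s) + x|d(d(s)). The first two terms cancel
  since d is left linear, and the last vanishes by induction; the base case is
  associativity.\<close>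

lemma bar_diff_diff:
  assumes "t \<in> ten_power (Suc (Suc (Suc n)))"
  shows "bar_diff n (bar_diff (Suc n) t) = 0"
  using assms
proof (induction n arbitrary: t)
  case 0
  then show ?case
  proof (induction rule: ten_power_cons_induct)
    case (cons x s)
    then show ?case
    proof (induction rule: bar_induct)
      case (add s t)
      then show ?case
        by (simp add: linearD_add [OF linear_ten_cons] linearD_add [OF linear_bar_diff])
    next
      case (tens y ys z)
      have "bar_diff (Suc 0) (ten_cons (0 + 2) x (tens [y, z])) = tens [x * y, z] - tens [x, y * z]"
        using ten_lact_tens [of "[z]" 1 x y] ten_cons_tens [of "[y * z]" 1 x]
        by (subst bar_diff_cons) (simp_all add: ten_power_tens numeral_2_eq_2 bar_diff_0_tens)
      then show ?case
        using tens by (simp add: linearD_diff [OF linear_bar_diff] bar_diff_0_tens numeral_2_eq_2 mult.assoc)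
    qed
  qed (simp add: linearD_add [OF linear_bar_diff])
next
  case (Suc n)
  show ?case
    using Suc.prems
  proof (induction rule: ten_power_cons_induct)
    case (cons x s)
    then show ?case
      using bar_diff_cons [of s "Suc n" x] bar_diff_cons [of "bar_diff (Suc n) s" n x] bar_diff_mem [of s "Suc n"] Suc.IH [OF cons]
      by (simp add: linearD_diff [OF linear_bar_diff] bar_diff_lact linearD_zero [OF linear_ten_cons])
  qed (simp add: linearD_add [OF linear_bar_diff])
qed

lemma bar_diff_exact:
  assumes t: "t \<in> ten_power (Suc (Suc n))" and zero: "bar_diff n t = 0"
  shows "t \<in> bar_diff (Suc n) ` ten_power (Suc (Suc (Suc n)))"
proof
  show "t = bar_diff (Suc n) (ten_cons (Suc (Suc n)) 1 t)"
    using bar_diff_cons [of t n 1] t zero fk_bimodule.lact_one [OF fk_bimodule_bar, of t n]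
    by (simp add: linearD_zero [OF linear_ten_cons])
qed (rule ten_cons_mem [OF t])

lemma
  fixes x y :: "'k::field fk"
  shows linear_bar_aug: "Vector_Spaces.linear ten_scale fk_scale (bar_aug :: 'k ten \<Rightarrow> 'k fk)"
    and bar_aug_tens: "bar_aug (tens [x, y]) = x * y"
proof -
  have ml: "multilinear 2 fk_scale (\<lambda>xs :: 'k fk list. xs ! 0 * xs ! 1)"
    by (rule multilinearI; erule two_cases) (simp_all add: distrib_left distrib_right fk_scale_mult_left fk_scale_mult_right)
  show "Vector_Spaces.linear ten_scale fk_scale (bar_aug :: 'k ten \<Rightarrow> 'k fk)" "bar_aug (tens [x, y]) = x * y"
    unfolding bar_aug_def by (rule linear_ten_lift [OF fk_vs ml], subst ten_lift_tens [OF fk_vs ml], simp)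
qed

text \<open>In degree 0 the bar differential is the augmentation, so exactness at the augmentation
  is the case n = 0 of \<open>bar_diff_exact\<close>.\<close>

lemma bar_diff_0: "t \<in> ten_power (Suc (Suc 0)) \<Longrightarrow> bar_diff 0 t = tens [bar_aug t]"
  by (induction rule: bar_induct)
    (simp_all add: linearD_add [OF linear_bar_diff] linearD_add [OF linear_bar_aug] tens_add_hd bar_aug_tens bar_diff_0_tens)

lemma tens_zero: "tens [0] = 0"
  using tens_add_hd [of 0 0 "[]"] by simp

lemma bar_aug_exact:
  assumes "t \<in> ten_power (Suc (Suc 0))" "bar_aug t = 0"
  shows "t \<in> bar_diff (Suc 0) ` ten_power (Suc (Suc (Suc 0)))"
  using bar_diff_exact [of t 0] assms by (simp add: bar_diff_0 tens_zero)

lemma bimod_hom_bar_aug: "bimod_hom (bar_bimod 0) fk_bimod bar_aug"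
proof -
  have "bar_aug (ten_lact (Suc (Suc 0)) a t) = a * bar_aug t" "bar_aug (ten_ract (Suc (Suc 0)) t a) = bar_aug t * a"
    if "t \<in> ten_power (Suc (Suc 0))" for a and t :: "'a ten"
    using that
    by (induction rule: bar_induct)
      (simp_all add: linearD_add [OF linear_bar_aug] linearD_add [OF linear_ten_lact] linearD_add [OF linear_ten_ract]
        distrib_left distrib_right bar_lact_tens [of "[]", simplified] bar_ract_tens [of "[]", simplified] bar_aug_tens
        mult.assoc)
  then show ?thesis by (simp add: bimod_hom_def linearD_add [OF linear_bar_aug])
qed

lemma bar_aug_diff:
  assumes "t \<in> ten_power (Suc (Suc (Suc 0)))"
  shows "bar_aug (bar_diff (Suc 0) t) = 0"
  using assms
proof (induction rule: bar_induct)
  case (tens x ys z)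
  then obtain y where "ys = [y]" by (cases ys) auto
  then show ?case
    by (simp add: bar_diff_tens linearD_add [OF linear_bar_aug] linearD_diff [OF linear_bar_aug] linearD_scale [OF linear_bar_aug] bar_aug_tens mult.assoc
        fk.scale_minus_left)
qed (simp add: linearD_add [OF linear_bar_diff] linearD_add [OF linear_bar_aug])

section \<open>Maps out of the bar bimodules and their projectivity\<close>

lemma bar_sandwich:
  fixes \<psi> :: "'k::field fk list \<Rightarrow> 'l::ab_group_add" and s :: "'k \<Rightarrow> 'l \<Rightarrow> 'l"
  assumes L: "fk_bimodule s L" and \<psi>: "multilinear n s \<psi>" and carr: "\<And>ys. length ys = n \<Longrightarrow> \<psi> ys \<in> carr L"
  defines "H \<equiv> ten_lift (n + 2) s (\<lambda>xs. lact L (hd xs) (ract L (\<psi> (butlast (tl xs))) (last xs)))"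
  shows "bimod_hom (bar_bimod n) L H"
    and "length ys = n \<Longrightarrow> H (tens (x # ys @ [y])) = lact L x (ract L (\<psi> ys) y)"
    and "Vector_Spaces.linear ten_scale s H"
proof -
  interpret L: fk_bimodule s L by fact
  let ?\<phi> = "\<lambda>xs. lact L (hd xs) (ract L (\<psi> (butlast (tl xs))) (last xs))"
  have ml: "multilinear (n + 2) s ?\<phi>"
  proof (rule multilinearI)
    fix xs ys :: "'k fk list" and x y and c
    assume l: "length xs + 1 + length ys = n + 2"
    \<comment> \<open>The tested slot is the left outer factor, the right outer factor or an
      argument of \<open>\<psi>\<close>.\<close>
    consider "xs = []" | u us where "xs = u # us" "ys = []" | u us v vs where "xs = u # us" "ys = vs @ [v]"
      by (cases xs; cases ys rule: rev_cases) auto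
    then have "?\<phi> (xs @ (x + y) # ys) = ?\<phi> (xs @ x # ys) + ?\<phi> (xs @ y # ys) \<and>
        ?\<phi> (xs @ fk_scale c x # ys) = s c (?\<phi> (xs @ x # ys))"
    proof cases
      case 1
      with l have "ys \<noteq> []" by auto
      have "\<psi> (butlast ys) \<in> carr L" using 1 l by (intro carr) auto
      then show ?thesis using 1 \<open>ys \<noteq> []\<close>
        by (simp add: L.lact_add_left L.lact_scale_left L.ract_carr)
    next
      case 2
      then have "\<psi> us \<in> carr L" using l by (intro carr) auto
      then show ?thesis using 2
        by (simp add: butlast_append L.ract_add_right L.ract_scale_right L.lact_add_right L.lact_scale_right L.ract_carr)
    next
      case 3
      then have "\<psi> (us @ z # vs) \<in> carr L" for z using l by (intro carr) auto
      moreover have "length us + 1 + length vs = n" using 3 l by simp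
      ultimately show ?thesis using 3
        by (simp add: butlast_append multilinear_add [OF \<psi>] multilinear_scale [OF \<psi>] L.ract_add_left L.ract_scale_left
            L.lact_add_right L.lact_scale_right L.ract_carr L.scale_carr)
    qed
    then show "?\<phi> (xs @ (x + y) # ys) = ?\<phi> (xs @ x # ys) + ?\<phi> (xs @ y # ys)"
      "?\<phi> (xs @ fk_scale c x # ys) = s c (?\<phi> (xs @ x # ys))" by blast+
  qed
  show lin: "Vector_Spaces.linear ten_scale s H"
    unfolding H_def by (rule linear_ten_lift [OF L.vector_space_axioms ml])
  show tens: "H (tens (x # ys @ [y])) = lact L x (ract L (\<psi> ys) y)" if "length ys = n" for x ys y
    using that unfolding H_def by (subst ten_lift_tens [OF L.vector_space_axioms ml]) simp
  have "H t \<in> carr L \<and> H (ten_lact (Suc (Suc n)) a t) = lact L a (H t) \<and>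
      H (ten_ract (Suc (Suc n)) t a) = ract L (H t) a"
    if "t \<in> ten_power (Suc (Suc n))" for a t
    using that
  proof (induction rule: bar_induct)
    case (add s t)
    then show ?case
      by (simp add: linearD_add [OF lin] linearD_add [OF linear_ten_lact] linearD_add [OF linear_ten_ract] L.add_carr
          L.lact_add_right L.ract_add_left)
  next
    case (tens x ys y)
    then show ?case
      using carr [OF tens]
      by (simp add: bar_lact_tens bar_ract_tens \<open>\<And>ys y x. length ys = n \<Longrightarrow> H (tens (x # ys @ [y])) = lact L x (ract L (\<psi> ys) y)\<close>
          L.lact_carr L.ract_carr L.lact_lact L.ract_lact L.ract_ract)
  qed
  then show "bimod_hom (bar_bimod n) L H"
    by (simp add: bimod_hom_def linearD_add [OF lin])
qed

text \<open>Turns pointwise solvability into a linear choice: solutions are picked on a basis, found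
  as a maximal independent subset, and \<open>step\<close> allows them to be combined
  linearly.\<close>

lemma ten_power_basis_extension:
  fixes P :: "'k::field ten \<Rightarrow> 'm::ab_group_add \<Rightarrow> bool" and s :: "'k \<Rightarrow> 'm \<Rightarrow> 'm"
  assumes vs: "vector_space s"
    and ex: "\<And>t. t \<in> ten_power n \<Longrightarrow> \<exists>l. P t l"
    and zero: "P 0 0"
    and step: "\<And>c t t' l l'. t \<in> ten_power n \<Longrightarrow> t' \<in> ten_power n \<Longrightarrow> P t l \<Longrightarrow> P t' l' \<Longrightarrow> P (ten_scale c t + t') (s c l + l')"
  shows "\<exists>\<sigma>. Vector_Spaces.linear ten_scale s \<sigma> \<and> (\<forall>t\<in>ten_power n. P t (\<sigma> t))"
proof -
  interpret vector_space s by fact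
  interpret vp: vector_space_pair ten_scale s ..
  obtain B :: "'k ten set" where B: "B \<subseteq> ten_power n" "ten.independent B" "ten_power n \<subseteq> ten.span B"
    using ten.maximal_independent_subset by blast
  define \<sigma> where "\<sigma> = vp.construct B (\<lambda>t. SOME l. P t l)"
  have lin: "Vector_Spaces.linear ten_scale s \<sigma>"
    unfolding \<sigma>_def by (rule vp.linear_construct [OF B(2)])
  have base: "P t (\<sigma> t)" if "t \<in> B" for t
    unfolding \<sigma>_def vp.construct_basis [OF B(2) that]
    by (rule someI_ex) (use that B(1) ex in blast)
  have sub: "ten.span B \<subseteq> ten_power n"
    using B(1) by (simp add: ten_power_def ten.span_minimal ten.subspace_span)
  have "t \<in> ten_power n \<and> P t (\<sigma> t)" if "t \<in> ten.span B" for t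
    using that
  proof (induction rule: ten.span_induct_alt)
    case base
    then show ?case using zero by (simp add: ten_power_zero linearD_zero [OF lin])
  next
    case (step c x y)
    then show ?case
      using B(1) base [OF step(1)] assms(4) [of x y "\<sigma> x" "\<sigma> y" c]
      by (auto simp: linearD_add [OF lin] linearD_scale [OF lin] intro!: ten_power_add ten_power_scale)
  qed
  then show ?thesis using lin B(3) by blast
qed

lemma linear_tens_frame:
  fixes T :: "'k::field ten \<Rightarrow> 'm::ab_group_add"
  assumes "Vector_Spaces.linear ten_scale s T"
  shows "multilinear n s (\<lambda>ys. T (tens (x # ys @ [y])))"
  using tens_add [of "x # _" _ _ "_ @ [y]"] tens_scale [of "x # _" _ _ "_ @ [y]"]
  by (intro multilinearI) (simp_all add: linearD_add [OF assms] linearD_scale [OF assms])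

lemma bar_hom_eqI:
  fixes h h' :: "'k::field ten \<Rightarrow> 'm::ab_group_add"
  assumes h: "bimod_hom (bar_bimod n) N h" and h': "bimod_hom (bar_bimod n) N h'"
    and eq: "\<And>ys. length ys = n \<Longrightarrow> h (tens (1 # ys @ [1])) = h' (tens (1 # ys @ [1]))"
    and t: "t \<in> ten_power (Suc (Suc n))"
  shows "h t = h' t"
  using t
proof (induction rule: bar_induct)
  case (add s t)
  then show ?case using bimod_hom_add [OF h] bimod_hom_add [OF h'] by simp
next
  case (tens x ys y)
  have mem: "tens (1 # ys @ [z]) \<in> carr (bar_bimod n)" for z :: "'k fk"
    using tens by (simp add: ten_power_tens)
  have "tens (x # ys @ [y]) = lact (bar_bimod n) x (ract (bar_bimod n) (tens (1 # ys @ [1])) y)"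
    using tens by (simp add: bar_lact_tens bar_ract_tens)
  moreover have "ract (bar_bimod n) (tens (1 # ys @ [1])) y \<in> carr (bar_bimod n)"
    using mem [of 1] by (simp add: ten_ract_mem)
  ultimately show ?case
    using eq [OF tens] mem [of 1]
    by (simp only: bimod_hom_lact [OF h] bimod_hom_lact [OF h'] bimod_hom_ract [OF h] bimod_hom_ract [OF h'])
qed

text \<open>A bar bimodule is free on the inner tensor power. Lifting its generators linearly is a
  choice problem on a vector space, settled by \<open>ten_power_basis_extension\<close>.\<close>

lemma bar_lift:
  fixes h :: "'k::field ten \<Rightarrow> 'n::ab_group_add" and q :: "'l::ab_group_add \<Rightarrow> 'n"
    and s :: "'k \<Rightarrow> 'n \<Rightarrow> 'n" and s' :: "'k \<Rightarrow> 'l \<Rightarrow> 'l"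
  assumes N: "fk_bimodule s N" and L: "fk_bimodule s' L" and q: "bimod_hom L N q"
    and h: "bimod_hom (bar_bimod n) N h" and im: "\<And>t. t \<in> ten_power (Suc (Suc n)) \<Longrightarrow> h t \<in> q ` carr L"
  shows "\<exists>h'. bimod_hom (bar_bimod n) L h' \<and> (\<forall>t\<in>ten_power (Suc (Suc n)). q (h' t) = h t)"
proof -
  interpret N: fk_bimodule s N by fact
  interpret L: fk_bimodule s' L by fact
  \<comment> \<open>\<open>J t\<close> is 1|t|1, the inclusion of the generating space.\<close>
  define J :: "'k ten \<Rightarrow> 'k ten" where "J = ten_lift n ten_scale (\<lambda>ys. tens (1 # ys @ [1]))"
  have ml: "multilinear n ten_scale (\<lambda>ys. tens (1 # ys @ [1 :: 'k fk]))"
    by (rule linear_tens_frame [OF linear_ident [OF ten_vs]])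
  have linJ: "Vector_Spaces.linear ten_scale ten_scale J"
    unfolding J_def by (rule linear_ten_lift [OF ten_vs ml])
  have J: "J (tens ys) = tens (1 # ys @ [1])" if "length ys = n" for ys
    using that by (simp add: J_def ten_lift_tens [OF ten_vs ml])
  have J_mem: "J t \<in> ten_power (Suc (Suc n))" if "t \<in> ten_power n" for t
    by (rule ten_power_linear_mem [OF linJ _ that]) (simp add: J ten_power_tens)
  have "\<exists>\<sigma>. Vector_Spaces.linear ten_scale s' \<sigma> \<and> (\<forall>t\<in>ten_power n. \<sigma> t \<in> carr L \<and> q (\<sigma> t) = h (J t))"
  proof (rule ten_power_basis_extension [OF L.vector_space_axioms])
    show "\<exists>l. l \<in> carr L \<and> q l = h (J t)" if "t \<in> ten_power n" for t
      using im [OF J_mem [OF that]] by force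
    show "0 \<in> carr L \<and> q 0 = h (J 0)"
      using bimod_hom_zero [OF q L N] bimod_hom_zero [OF h fk_bimodule_bar N]
      by (simp add: linearD_zero [OF linJ] L.zero_carr)
    fix c t t' l l'
    assume t: "t \<in> ten_power n" "t' \<in> ten_power n"
      and l: "l \<in> carr L \<and> q l = h (J t)" "l' \<in> carr L \<and> q l' = h (J t')"
    have "h (J (ten_scale c t + t')) = s c (h (J t)) + h (J t')"
      using bimod_hom_add [OF h, of "ten_scale c (J t)" "J t'"] bimod_hom_scale [OF h fk_bimodule_bar N, of "J t" c]
        J_mem [OF t(1)] J_mem [OF t(2)]
      by (simp add: linearD_add [OF linJ] linearD_scale [OF linJ] ten_power_scale)
    moreover have "q (s' c l + l') = s c (q l) + q l'"
      using bimod_hom_add [OF q, of "s' c l" l'] bimod_hom_scale [OF q L N, of l c] l by (simp add: L.scale_carr)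
    ultimately show "s' c l + l' \<in> carr L \<and> q (s' c l + l') = h (J (ten_scale c t + t'))"
      using l by (simp add: L.add_carr L.scale_carr)
  qed
  then obtain \<sigma> where lin\<sigma>: "Vector_Spaces.linear ten_scale s' \<sigma>"
    and \<sigma>: "\<And>t. t \<in> ten_power n \<Longrightarrow> \<sigma> t \<in> carr L" "\<And>t. t \<in> ten_power n \<Longrightarrow> q (\<sigma> t) = h (J t)" by blast
  have ml\<sigma>: "multilinear n s' (\<lambda>ys. \<sigma> (tens ys))"
    by (rule multilinearI) (simp_all add: tens_add tens_scale linearD_add [OF lin\<sigma>] linearD_scale [OF lin\<sigma>])
  have carr\<sigma>: "\<sigma> (tens ys) \<in> carr L" if "length ys = n" for ys
    by (rule \<sigma>(1) [OF ten_power_tens [OF that]])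
  let ?H = "ten_lift (n + 2) s' (\<lambda>xs. lact L (hd xs) (ract L (\<sigma> (tens (butlast (tl xs)))) (last xs)))"
  have H: "bimod_hom (bar_bimod n) L ?H"
    by (rule bar_sandwich(1) [OF L ml\<sigma>], rule carr\<sigma>)
  have "q (?H t) = h t" if "t \<in> ten_power (Suc (Suc n))" for t
  proof (rule bar_hom_eqI [OF bimod_hom_compose [OF H q] h _ that])
    fix ys :: "'k fk list"
    assume ys: "length ys = n"
    have "?H (tens (1 # ys @ [1])) = lact L 1 (ract L (\<sigma> (tens ys)) 1)"
      by (rule bar_sandwich(2) [OF L ml\<sigma>, OF carr\<sigma> ys])
    then show "q (?H (tens (1 # ys @ [1]))) = h (tens (1 # ys @ [1]))"
      using \<sigma> [OF ten_power_tens [OF ys]] by (simp only: L.ract_one L.lact_one J [OF ys])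
  qed
  then show ?thesis using H by blast
qed

text \<open>The comparison opposite to \<open>\<iota>\<close>, built degree by degree from
  projectivity of the bar bimodules and exactness of \<open>P\<close>.\<close>

lemma bar_to_resolution:
  fixes f :: "nat \<Rightarrow> 'k::field kos \<Rightarrow> 'k kos"
  assumes f: "fk_resolution f"
  shows "\<exists>\<pi>. (\<forall>n. bimod_hom (bar_bimod n) (res_bimod n) (\<pi> n)) \<and>
    (\<forall>t\<in>ten_power (Suc (Suc 0)). res_aug (\<pi> 0 t) = bar_aug t) \<and>
    (\<forall>n. \<forall>t\<in>ten_power (Suc (Suc (Suc n))). res_diff f (Suc n) (\<pi> (Suc n) t) = \<pi> n (bar_diff (Suc n) t))"
proof -
  note d = bimod_hom_res_diff [OF fk_resolution_periodicity [OF f]]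
  have D: "bar_diff (Suc n) t \<in> ten_power (Suc (Suc n))" if "t \<in> ten_power (Suc (Suc (Suc n)))"
    for n and t :: "'k ten"
    using bar_diff_mem [of t "Suc n"] that by simp
  \<comment> \<open>The last conjunct, that images of bar boundaries are boundaries in
    \<open>P\<close>, is exactly what lifting in the next degree needs.\<close>
  let ?P = "\<lambda>n p. bimod_hom (bar_bimod n) (res_bimod n) p \<and>
    (n = 0 \<longrightarrow> (\<forall>t\<in>ten_power (Suc (Suc 0)). res_aug (p t) = bar_aug t)) \<and>
    (\<forall>t\<in>ten_power (Suc (Suc (Suc n))). p (bar_diff (Suc n) t) \<in> res_diff f (Suc n) ` carr (res_bimod (Suc n)))"
  let ?Q = "\<lambda>n p p'. \<forall>t\<in>ten_power (Suc (Suc (Suc n))). res_diff f (Suc n) (p' t) = p (bar_diff (Suc n) t)"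
  have "\<exists>\<pi>. \<forall>n. ?P n (\<pi> n) \<and> ?Q n (\<pi> n) (\<pi> (Suc n))"
  proof (rule dependent_nat_choice)
    have "bar_aug t \<in> res_aug ` carr (res_bimod 0)" for t :: "'k ten"
      using res_aug_surj [OF f] by simp
    from bar_lift [OF fk_bimodule_fk fk_bimodule_res bimod_hom_res_aug bimod_hom_bar_aug this]
    obtain p :: "'k ten \<Rightarrow> 'k res" where p: "bimod_hom (bar_bimod 0) (res_bimod 0) p"
      "\<And>t. t \<in> ten_power (Suc (Suc 0)) \<Longrightarrow> res_aug (p t) = bar_aug t" by blast
    have "p (bar_diff (Suc 0) t) \<in> res_diff f (Suc 0) ` carr (res_bimod (Suc 0))"
      if t: "t \<in> ten_power (Suc (Suc (Suc 0)))" for t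
      using res_aug_exact [OF f, of "p (bar_diff (Suc 0) t)"] bimod_hom_carr [OF p(1)] D [OF t]
      by (simp add: p(2) bar_aug_diff t)
    then have "?P 0 p" using p by blast
    then show "\<exists>p. ?P 0 p" by (rule exI [of _ p])
  next
    fix p n
    assume P: "?P n p"
    have p: "bimod_hom (bar_bimod n) (res_bimod n) p" using P by (elim conjE)
    have "p (bar_diff (Suc n) t) \<in> res_diff f (Suc n) ` carr (res_bimod (Suc n))"
      if t: "t \<in> ten_power (Suc (Suc (Suc n)))" for t
      using P that by (elim conjE) blast
    from bar_lift [OF fk_bimodule_res fk_bimodule_res d bimod_hom_compose [OF bimod_hom_bar_diff p] this]
    obtain p' :: "'k ten \<Rightarrow> 'k res" where p': "bimod_hom (bar_bimod (Suc n)) (res_bimod (Suc n)) p'"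
      "\<And>t. t \<in> ten_power (Suc (Suc (Suc n))) \<Longrightarrow> res_diff f (Suc n) (p' t) = p (bar_diff (Suc n) t)" by blast
    have "p' (bar_diff (Suc (Suc n)) t) \<in> res_diff f (Suc (Suc n)) ` carr (res_bimod (Suc (Suc n)))"
      if t: "t \<in> ten_power (Suc (Suc (Suc (Suc n))))" for t
    proof (rule res_diff_exact [OF f])
      show "p' (bar_diff (Suc (Suc n)) t) \<in> carr (res_bimod (Suc n))"
        using bimod_hom_carr [OF p'(1)] D [OF t] by simp
      show "res_diff f (Suc n) (p' (bar_diff (Suc (Suc n)) t)) = 0"
        using bimod_hom_zero [OF p fk_bimodule_bar fk_bimodule_res] by (simp add: p'(2) D t bar_diff_diff)
    qed
    then have "?P (Suc n) p' \<and> ?Q n p p'" using p' by simp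
    then show "\<exists>p'. ?P (Suc n) p' \<and> ?Q n p p'" by (rule exI [of _ p'])
  qed
  then obtain \<pi> where \<pi>: "\<forall>n. ?P n (\<pi> n) \<and> ?Q n (\<pi> n) (\<pi> (Suc n))" by (elim exE)
  show ?thesis
  proof (intro exI [of _ \<pi>] conjI allI)
    show "bimod_hom (bar_bimod n) (res_bimod n) (\<pi> n)" for n
      using \<pi> [THEN spec, of n] by (elim conjE)
    show "\<forall>t\<in>ten_power (Suc (Suc 0)). res_aug (\<pi> 0 t) = bar_aug t"
      using \<pi> [THEN spec, of 0] by (elim conjE) simp
    show "?Q n (\<pi> n) (\<pi> (Suc n))" for n
      using \<pi> [THEN spec, of n] by (elim conjE)
  qed
qed


subsection \<open>Derivations acting on the bar resolution\<close>

lemma ten_cons_add_arg: "t \<in> ten_power n \<Longrightarrow> ten_cons n (x + y) t = ten_cons n x t + ten_cons n y t"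
  using linearD_add [OF linear_ten_cons_arg] .

lemma
  assumes g: "fk_derivation g" and t: "t \<in> ten_power (Suc n)"
  shows ten_der_lact: "ten_der (Suc n) g (ten_lact (Suc n) a t) =
    ten_lact (Suc n) (g a) t + ten_lact (Suc n) a (ten_der (Suc n) g t)"
  using t
proof (induction rule: ten_power_cons_induct)
  case (add s t)
  then show ?case
    by (simp add: linearD_add [OF linear_ten_lact] linearD_add [OF linear_ten_der [OF linear_fk_derivation [OF g]]])
next
  case (cons x s)
  then show ?case
    by (simp add: ten_lact_cons ten_der_cons [OF linear_fk_derivation [OF g]] fk_derivation_mult [OF g] ten_cons_add_arg
        linearD_add [OF linear_ten_lact] ten_der_mem [OF linear_fk_derivation [OF g]])
qed

lemma ten_der_ract:
  assumes g: "fk_derivation g" and t: "t \<in> ten_power (Suc n)"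
  shows "ten_der (Suc n) g (ten_ract (Suc n) t a) =
    ten_ract (Suc n) t (g a) + ten_ract (Suc n) (ten_der (Suc n) g t) a"
  using t
proof (induction n arbitrary: t)
  case 0
  note lin = linear_fk_derivation [OF g]
  from 0 show ?case
  proof (induction rule: ten_power_induct)
    case (add s t)
    then show ?case by (simp add: linearD_add [OF linear_ten_ract] linearD_add [OF linear_ten_der [OF lin]])
  next
    case (tens x xs)
    then show ?case
      using ten_ract_tens [of "[]" 0 x a] ten_ract_tens [of "[]" 0 x "g a"] ten_ract_tens [of "[]" 0 "g x" a] tens_add [of "[]" "g x * a" "x * g a" "[]"]
      by (simp add: ten_der_tens [OF lin] fk_derivation_mult [OF g])
  qed
next
  case (Suc n)
  note lin = linear_fk_derivation [OF g]
  show ?case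
    using Suc.prems
  proof (induction rule: ten_power_cons_induct)
    case (add s t)
    then show ?case by (simp add: linearD_add [OF linear_ten_ract] linearD_add [OF linear_ten_der [OF lin]])
  next
    case (cons x s)
    then show ?case
      using ten_der_cons [OF lin ten_ract_mem [OF cons], of x a]
      by (simp add: ten_ract_cons ten_der_cons [OF lin] Suc.IH ten_der_mem [OF lin] linearD_add [OF linear_ten_cons]
          linearD_add [OF linear_ten_ract])
  qed
qed

text \<open>The derivation acts factor by factor and the differential multiplies neighbours, so the
  Leibniz rule of \<open>g\<close> makes them commute. Peeling off the first factor avoids a
  comparison of double sums.\<close>

lemma bar_diff_ten_der:
  assumes g: "fk_derivation g" and t: "t \<in> ten_power (Suc (Suc n))"
  shows "bar_diff n (ten_der (Suc (Suc n)) g t) = ten_der (Suc n) g (bar_diff n t)"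
  using t
proof (induction n arbitrary: t)
  case 0
  note lin = linear_fk_derivation [OF g]
  from 0 show ?case
  proof (induction rule: bar_induct)
    case (add s t)
    then show ?case by (simp add: linearD_add [OF linear_bar_diff] linearD_add [OF linear_ten_der [OF lin]])
  next
    case (tens x ys y)
    then show ?case
      using tens_add [of "[]" "g x * y" "x * g y" "[]"]
      by (simp add: ten_der_tens [OF lin] bar_diff_0_tens linearD_add [OF linear_bar_diff] fk_derivation_mult [OF g])
  qed
next
  case (Suc n)
  note lin = linear_fk_derivation [OF g]
  show ?case
    using Suc.prems
  proof (induction rule: ten_power_cons_induct)
    case (add s t)
    then show ?case by (simp add: linearD_add [OF linear_bar_diff] linearD_add [OF linear_ten_der [OF lin]])
  next
    case (cons x s)
    have Ds: "bar_diff n s \<in> ten_power (Suc n)" using bar_diff_mem [of s n] cons by simp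
    have Dc: "bar_diff (Suc n) (ten_cons (Suc (Suc n)) x s) =
        ten_lact (Suc (Suc n)) x s - ten_cons (Suc n) x (bar_diff n s)"
      if "s \<in> ten_power (Suc (Suc n))" for x s
      using bar_diff_cons [of s n x] that by simp
    show ?case
      by (simp add: ten_der_cons [OF lin] cons linearD_add [OF linear_bar_diff] Dc ten_der_mem [OF lin] Suc.IH
          linearD_diff [OF linear_ten_der [OF lin]] ten_der_lact [OF g] Ds)
  qed
qed

lemma bar_aug_ten_der:
  assumes g: "fk_derivation g" and t: "t \<in> ten_power (Suc (Suc 0))"
  shows "bar_aug (ten_der (Suc (Suc 0)) g t) = g (bar_aug t)"
  using t
proof (induction rule: bar_induct)
  case (add s t)
  then show ?case
    by (simp add: linearD_add [OF linear_bar_aug] linearD_add [OF linear_ten_der [OF linear_fk_derivation [OF g]]]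
        linearD_add [OF linear_fk_derivation [OF g]])
next
  case (tens x ys y)
  then show ?case
    by (simp add: ten_der_tens [OF linear_fk_derivation [OF g]] bar_aug_tens linearD_add [OF linear_bar_aug]
        fk_derivation_mult [OF g])
qed

section \<open>The bracket with a derivation on the bar resolution\<close>

lemma
  fixes h :: "'k::field fk list \<Rightarrow> 'k fk"
  assumes h: "multilinear n fk_scale h"
  shows bimod_hom_bar_hom: "bimod_hom (bar_bimod n) fk_bimod (bar_hom n h)"
    and bar_hom_tens: "length ys = n \<Longrightarrow> bar_hom n h (tens (x # ys @ [y])) = x * h ys * y"
    and linear_bar_hom: "Vector_Spaces.linear ten_scale fk_scale (bar_hom n h)"
proof -
  have eq: "bar_hom n h = ten_lift (n + 2) fk_scale (\<lambda>xs. lact fk_bimod (hd xs) (ract fk_bimod (h (butlast (tl xs))) (last xs)))"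
    by (simp add: bar_hom_def mult.assoc)
  show "bimod_hom (bar_bimod n) fk_bimod (bar_hom n h)"
    "length ys = n \<Longrightarrow> bar_hom n h (tens (x # ys @ [y])) = x * h ys * y"
    "Vector_Spaces.linear ten_scale fk_scale (bar_hom n h)"
    unfolding eq using bar_sandwich [OF fk_bimodule_fk h] by (simp_all add: mult.assoc)
qed

text \<open>Arity one makes the exponents of all signs even: 2 (i - 1) for the insertions of
  \<open>g\<close>, and 2 (n + 1) between the two circle products.\<close>

lemma gbracket_1:
  assumes "length ys = n"
  shows "gbracket 1 n g h ys = g [h ys] - (\<Sum>j<n. h (ys[j := g [ys ! j]]))"
proof -
  have "gcirc n 1 h g ys = (\<Sum>j<n. h (ys[j := g [ys ! j]]))"
  proof -
    have "gcirc n 1 h g ys = (\<Sum>i=1..n. h (ys[i - 1 := g [ys ! (i - 1)]]))"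
      unfolding gcirc_def
    proof (rule sum.cong)
      fix i assume "i \<in> {1..n}"
      then have i: "i - 1 < length ys" using assms by auto
      then have "take 1 (drop (i - 1) ys) = [ys ! (i - 1)]"
        by (simp add: take_Suc hd_drop_conv_nth)
      then show "(-1) ^ ((1 + 1) * (i - 1)) * h (take (i - 1) ys @ [g (take 1 (drop (i - 1) ys))] @ drop (i - 1 + 1) ys) =
          h (ys[i - 1 := g [ys ! (i - 1)]])"
        using i by (simp add: upd_conv_take_nth_drop power_mult)
    qed simp
    also have "\<dots> = (\<Sum>j<n. h (ys[j := g [ys ! j]]))"
      by (rule sum.reindex_bij_witness [of _ Suc "\<lambda>i. i - 1"]) auto
    finally show ?thesis .
  qed
  moreover have "gcirc 1 n g h ys = g [h ys]"
    using assms by (simp add: gcirc_def)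
  ultimately show ?thesis
    by (simp add: gbracket_def power_mult)
qed

text \<open>On 1|ys|1 the derivation reaches only the inner factors, since it kills 1; there the
  identity is \<open>gbracket_1\<close>. Both sides are bimodule maps, so these generators
  decide.\<close>

lemma bar_hom_gbracket:
  fixes g h :: "'k::field fk list \<Rightarrow> 'k fk"
  assumes g: "fk_derivation (\<lambda>x. g [x])" and h: "multilinear n fk_scale h" and t: "t \<in> ten_power (Suc (Suc n))"
  shows "bar_hom n (gbracket 1 n g h) t =
    g [bar_hom n h t] - bar_hom n h (ten_der (Suc (Suc n)) (\<lambda>x. g [x]) t)"
proof -
  let ?g = "\<lambda>x. g [x]"
  note lin = linear_fk_derivation [OF g] and bh = bimod_hom_bar_hom [OF h]
  let ?T = "\<lambda>t. ?g (bar_hom n h t) - bar_hom n h (ten_der (Suc (Suc n)) ?g t)"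
  have T: "?T (tens (1 # ys @ [1])) = gbracket 1 n g h ys" if l: "length ys = n" for ys
  proof -
    have "ten_der (Suc (Suc n)) ?g (tens (1 # ys @ [1])) = (\<Sum>j<n. tens (1 # ys[j := g [ys ! j]] @ [1]))"
    proof -
      let ?X = "\<lambda>j. tens ((1 # ys @ [1])[j := g [(1 # ys @ [1]) ! j]])"
      have "ten_der (Suc (Suc n)) ?g (tens (1 # ys @ [1])) = (\<Sum>j<Suc (Suc n). ?X j)"
        using l by (simp only: ten_der_tens [OF lin] length_Cons length_append list.size add_0_right add_Suc_right)
      moreover have "(\<Sum>j<Suc (Suc n). ?X j) = ?X 0 + ((\<Sum>j<n. ?X (Suc j)) + ?X (Suc n))"
        by (subst sum.lessThan_Suc_shift, subst sum.lessThan_Suc) (rule refl)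
      moreover have "?X 0 = 0" "?X (Suc n) = 0"
        using l fk_derivation_one [OF g] tens_scale_hd [of 0 1 "ys @ [1]"] tens_scale_last [of 1 ys 0 1]
        by (simp_all add: nth_append list_update_append)
      moreover have "(\<Sum>j<n. ?X (Suc j)) = (\<Sum>j<n. tens (1 # ys[j := g [ys ! j]] @ [1]))"
        using l by (intro sum.cong) (auto simp: nth_append list_update_append)
      ultimately show ?thesis by simp
    qed
    moreover have "bar_hom n h (\<Sum>j<n. tens (1 # ys[j := g [ys ! j]] @ [1])) = (\<Sum>j<n. h (ys[j := g [ys ! j]]))"
      using l by (simp add: linearD_sum [OF linear_bar_hom [OF h]] bar_hom_tens [OF h])
    ultimately show ?thesis
      unfolding gbracket_1 [OF l] by (simp add: l bar_hom_tens [OF h])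
  qed
  have linT: "Vector_Spaces.linear ten_scale fk_scale ?T"
    by (rule linearI [OF ten_vs fk_vs])
      (simp_all add: linearD_add [OF lin] linearD_scale [OF lin] linearD_add [OF linear_bar_hom [OF h]]
        linearD_scale [OF linear_bar_hom [OF h]] linearD_add [OF linear_ten_der [OF lin]]
        linearD_scale [OF linear_ten_der [OF lin]] fk.scale_right_diff_distrib)
  \<comment> \<open>Multilinearity of the bracket is inherited from the linear map \<open>?T\<close>
    through its values on 1|ys|1.\<close>
  have ml: "multilinear n fk_scale (gbracket 1 n g h)"
  proof (rule multilinearI)
    fix xs ys :: "'k fk list" and x y c
    assume l: "length xs + 1 + length ys = n"
    then have "length (xs @ z # ys) = n" for z by simp
    note T' = T [OF this, symmetric]
    show "gbracket 1 n g h (xs @ (x + y) # ys) = gbracket 1 n g h (xs @ x # ys) + gbracket 1 n g h (xs @ y # ys)"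
      "gbracket 1 n g h (xs @ fk_scale c x # ys) = fk_scale c (gbracket 1 n g h (xs @ x # ys))"
      unfolding T' using multilinear_add [OF linear_tens_frame [OF linT] l] multilinear_scale [OF linear_tens_frame [OF linT] l]
      by simp_all
  qed
  \<comment> \<open>Neither composite is a bimodule map, but both produce the same Leibniz term with
    \<open>g [x]\<close>, which cancels in the difference.\<close>
  have "bimod_hom (bar_bimod n) fk_bimod ?T"
    unfolding bimod_hom_def
  proof (intro conjI ballI allI)
    fix t t' :: "'k ten" and x
    assume t: "t \<in> carr (bar_bimod n)"
    show "?T t \<in> carr fk_bimod" by simp
    show "?T (t + t') = ?T t + ?T t'" by (rule linearD_add [OF linT])
    have "bar_hom n h (lact (bar_bimod n) x s) = x * bar_hom n h s" "bar_hom n h (ract (bar_bimod n) s x) = bar_hom n h s * x"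
      if "s \<in> ten_power (Suc (Suc n))" for s x
      using bimod_hom_lact [OF bh] bimod_hom_ract [OF bh] that by simp_all
    then show "?T (lact (bar_bimod n) x t) = lact fk_bimod x (?T t)" "?T (ract (bar_bimod n) t x) = ract fk_bimod (?T t) x"
      using t
      by (simp_all add: ten_der_lact [OF g] ten_der_ract [OF g] ten_der_mem [OF lin] linearD_add [OF linear_bar_hom [OF h]]
          fk_derivation_mult [OF g] algebra_simps)
  qed
  then show ?thesis
  proof (rule bar_hom_eqI [OF bimod_hom_bar_hom [OF ml] _ _ t])
    fix ys :: "'k fk list"
    assume ys: "length ys = n"
    show "bar_hom n (gbracket 1 n g h) (tens (1 # ys @ [1])) = ?T (tens (1 # ys @ [1]))"
      unfolding T [OF ys] bar_hom_tens [OF ml ys] by simp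
  qed
qed

section \<open>Hochschild cohomology\<close>

lemma hom_coboundary_cong:
  assumes "\<And>z. z \<in> carr (res_bimod n) \<Longrightarrow> \<phi> z = \<psi> z" "hom_coboundary f n \<phi>"
  shows "hom_coboundary f n \<psi>"
  using assms unfolding hom_coboundary_def by (simp split: if_splits)

lemma hom_coboundary_Suc:
  assumes "bimod_hom (res_bimod n) fk_bimod h" "\<And>z. z \<in> carr (res_bimod (Suc n)) \<Longrightarrow> \<phi> z = h (res_diff f (Suc n) z)"
  shows "hom_coboundary f (Suc n) \<phi>"
  using assms unfolding hom_coboundary_def by auto

lemma hom_coboundary_SucE:
  assumes "hom_coboundary f (Suc n) \<phi>"
  obtains h where "bimod_hom (res_bimod n) fk_bimod h" "\<And>z. z \<in> carr (res_bimod (Suc n)) \<Longrightarrow> \<phi> z = h (res_diff f (Suc n) z)"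
  using assms unfolding hom_coboundary_def by auto

lemma hom_coboundary_add:
  fixes f :: "nat \<Rightarrow> 'k::field kos \<Rightarrow> 'k kos"
  assumes "hom_coboundary f n \<phi>" "hom_coboundary f n \<psi>"
  shows "hom_coboundary f n (\<lambda>z. \<phi> z + \<psi> z)"
proof (cases n)
  case 0
  then show ?thesis using assms by (simp add: hom_coboundary_def)
next
  case (Suc m)
  from assms [unfolded Suc] obtain h h' where "bimod_hom (res_bimod m) fk_bimod h" "bimod_hom (res_bimod m) fk_bimod h'"
    "\<And>z. z \<in> carr (res_bimod (Suc m)) \<Longrightarrow> \<phi> z = h (res_diff f (Suc m) z)"
    "\<And>z. z \<in> carr (res_bimod (Suc m)) \<Longrightarrow> \<psi> z = h' (res_diff f (Suc m) z)"
    by (elim hom_coboundary_SucE) blast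
  then show ?thesis
    unfolding Suc by (intro hom_coboundary_Suc [OF bimod_hom_plus [OF _ _ fk_bimodule_fk, of _ h h']]) simp_all
qed

lemma hom_coboundary_scale:
  fixes f :: "nat \<Rightarrow> 'k::field kos \<Rightarrow> 'k kos"
  assumes "hom_coboundary f n \<phi>"
  shows "hom_coboundary f n (\<lambda>z. fk_scale c (\<phi> z))"
proof (cases n)
  case 0
  then show ?thesis using assms by (simp add: hom_coboundary_def)
next
  case (Suc m)
  from assms [unfolded Suc] obtain h where "bimod_hom (res_bimod m) fk_bimod h"
    "\<And>z. z \<in> carr (res_bimod (Suc m)) \<Longrightarrow> \<phi> z = h (res_diff f (Suc m) z)"
    by (elim hom_coboundary_SucE) blast
  then show ?thesis
    unfolding Suc by (intro hom_coboundary_Suc [OF bimod_hom_scale_hom [OF _ fk_bimodule_fk, where h = h and c = c]]) simp_all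
qed

lemma hom_coboundary_uminus: "hom_coboundary f n \<phi> \<Longrightarrow> hom_coboundary f n (\<lambda>z. - \<phi> z)"
  using hom_coboundary_scale [of f n \<phi> "- 1"] by (simp add: fk.scale_minus_left)

lemma hom_coboundary_zero:
  fixes f :: "nat \<Rightarrow> 'k::field kos \<Rightarrow> 'k kos"
  shows "hom_coboundary f n (\<lambda>z. 0)"
proof (cases n)
  case (Suc m)
  have "bimod_hom (res_bimod m) fk_bimod (\<lambda>z :: 'k res. 0 :: 'k fk)"
    by (simp add: bimod_hom_def)
  then show ?thesis unfolding Suc by (rule hom_coboundary_Suc) simp
qed (simp add: hom_coboundary_def)

lemma hh_class_eqI:
  assumes "hom_coboundary f n (\<lambda>z. \<phi> z - \<psi> z)"
  shows "hh_class f n \<phi> = hh_class f n \<psi>"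
proof -
  have "hom_coboundary f n (\<lambda>z. \<chi> z - \<psi> z)" if "hom_coboundary f n (\<lambda>z. \<chi> z - \<phi> z)" for \<chi>
    using hom_coboundary_add [OF that assms] by simp
  moreover have "hom_coboundary f n (\<lambda>z. \<chi> z - \<phi> z)" if "hom_coboundary f n (\<lambda>z. \<chi> z - \<psi> z)" for \<chi>
    using hom_coboundary_add [OF that hom_coboundary_uminus [OF assms]] by simp
  ultimately show ?thesis unfolding hh_class_def by blast
qed

lemma hh_class_cong:
  assumes "\<And>z. z \<in> carr (res_bimod n) \<Longrightarrow> \<phi> z = \<psi> z"
  shows "hh_class f n \<phi> = hh_class f n \<psi>"
  by (rule hh_class_eqI, rule hom_coboundary_cong [OF _ hom_coboundary_zero]) (simp add: assms)

lemma hh_class_self: "bimod_hom (res_bimod n) fk_bimod \<phi> \<Longrightarrow> \<phi> \<in> hh_class f n \<phi>"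
  by (simp add: hh_class_def hom_coboundary_zero)

lemma hh_scale_class:
  fixes f :: "nat \<Rightarrow> 'k::field kos \<Rightarrow> 'k kos"
  assumes "bimod_hom (res_bimod n) fk_bimod \<phi>"
  shows "hh_scale f n c (hh_class f n \<phi>) = hh_class f n (\<lambda>z. fk_scale c (\<phi> z))"
proof -
  have "hh_class f n (\<lambda>z. fk_scale c (\<psi> z)) = hh_class f n (\<lambda>z. fk_scale c (\<phi> z))" if "\<psi> \<in> hh_class f n \<phi>" for \<psi>
    using that hom_coboundary_scale [of f n "\<lambda>z. \<psi> z - \<phi> z" c]
    by (intro hh_class_eqI) (simp add: hh_class_def fk.scale_right_diff_distrib)
  then show ?thesis
    unfolding hh_scale_def using hh_class_self [OF assms, of f] by blast
qed

section \<open>Hochschild cocycles and comparison with the bar resolution\<close>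

lemma
  fixes h :: "'k::field fk list \<Rightarrow> 'k fk"
  assumes "hochschild_cocycle n h"
  shows hochschild_cocycle_multilinear: "multilinear n fk_scale h"
    and hochschild_cocycle_diff: "t \<in> ten_power (Suc (Suc (Suc n))) \<Longrightarrow> bar_hom n h (bar_diff (Suc n) t) = 0"
  using assms by (simp_all add: hochschild_cocycle_def)

lemma bar_diff_1_tens: "bar_diff (Suc (Suc 0)) (tens [x, y, z, w]) = tens [x * y, z, w] - tens [x, y * z, w] + tens [x, y, z * w]"
  by (simp add: bar_diff_tens ten.scale_minus_left)

lemma multilinear_1: "Vector_Spaces.linear fk_scale fk_scale (\<lambda>x. g [x]) \<longleftrightarrow> multilinear (Suc 0) fk_scale g"
proof
  assume "Vector_Spaces.linear fk_scale fk_scale (\<lambda>x. g [x])"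
  from linearD_add [OF this] linearD_scale [OF this] show "multilinear (Suc 0) fk_scale g"
    by (intro multilinearI) auto
next
  assume ml: "multilinear (Suc 0) fk_scale g"
  show "Vector_Spaces.linear fk_scale fk_scale (\<lambda>x. g [x])"
    using multilinear_add [OF ml, of "[]" "[]"] multilinear_scale [OF ml, of "[]" "[]"]
    by (intro linearI [OF fk_vs fk_vs]) simp_all
qed

text \<open>On 1|x|y|1 the cocycle condition is the Leibniz rule; other outer factors only multiply
  it from both sides.\<close>

lemma hochschild_cocycle_1: "hochschild_cocycle 1 g \<longleftrightarrow> fk_derivation (\<lambda>x. g [x])"
  for g :: "'k::field fk list \<Rightarrow> 'k fk"
proof
  assume g: "hochschild_cocycle 1 g"
  then have ml: "multilinear (Suc 0) fk_scale g" using hochschild_cocycle_multilinear by fastforce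
  note bh = bar_hom_tens [OF ml, of "[_]", simplified] and lin = linear_bar_hom [OF ml]
  have "bar_hom 1 g (bar_diff (Suc (Suc 0)) (tens [1, x, y, 1])) = 0" for x y
    using hochschild_cocycle_diff [OF g] by (simp add: ten_power_tens)
  then have "g [x * y] = g [x] * y + x * g [y]" for x y
    by (simp add: bar_diff_1_tens linearD_add [OF lin] linearD_diff [OF lin] bh algebra_simps)
  then show "fk_derivation (\<lambda>x. g [x])"
    using ml by (simp add: fk_derivation_def multilinear_1)
next
  assume g: "fk_derivation (\<lambda>x. g [x])"
  then have ml: "multilinear (Suc 0) fk_scale g"
    using linear_fk_derivation [OF g] by (simp add: multilinear_1)
  note bh = bar_hom_tens [OF ml, of "[_]", simplified] and lin = linear_bar_hom [OF ml]
  have "bar_hom 1 g (bar_diff 2 t) = 0" if "t \<in> ten_power (Suc (Suc (Suc (Suc 0))))" for t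
    using that
  proof (induction rule: bar_induct)
    case (add s t)
    then show ?case by (simp add: linearD_add [OF linear_bar_diff] linearD_add [OF lin])
  next
    case (tens x ys w)
    then obtain y z where "ys = [y, z]" by (auto simp: length_Suc_conv)
    then show ?case
      by (simp add: numeral_2_eq_2 bar_diff_1_tens linearD_add [OF lin] linearD_diff [OF lin] bh
          fk_derivation_mult [OF g] algebra_simps)
  qed
  then show "hochschild_cocycle 1 g"
    using ml by (simp add: hochschild_cocycle_def numeral_2_eq_2)
qed

lemma
  fixes f :: "nat \<Rightarrow> 'k::field kos \<Rightarrow> 'k kos"
  assumes "fk_comparison f \<iota>"
  shows comparison_hom: "bimod_hom (res_bimod n) (bar_bimod n) (\<iota> n)"
    and comparison_chain: "z \<in> carr (res_bimod (Suc n)) \<Longrightarrow> bar_diff (Suc n) (\<iota> (Suc n) z) = \<iota> n (res_diff f (Suc n) z)"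
    and comparison_aug: "z \<in> carr (res_bimod 0) \<Longrightarrow> bar_aug (\<iota> 0 z) = res_aug z"
    and comparison_1: "\<iota> 1 (omega 0 (kos 1 (dual_mon [l]) 1)) = - tens [1, fk_mon [l], 1]"
proof -
  have l: "l \<in> letters" by (cases l) (simp_all add: letters_def)
  show "bimod_hom (res_bimod n) (bar_bimod n) (\<iota> n)"
    "\<iota> 1 (omega 0 (kos 1 (dual_mon [l]) 1)) = - tens [1, fk_mon [l], 1]"
    "z \<in> carr (res_bimod 0) \<Longrightarrow> bar_aug (\<iota> 0 z) = res_aug z"
    using assms l unfolding fk_comparison_def by simp_all
  have "\<forall>n\<ge>1. \<forall>z\<in>carr (res_bimod n). bar_diff n (\<iota> n z) = \<iota> (n - 1) (res_diff f n z)"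
    using assms unfolding fk_comparison_def by (elim conjE) assumption
  from this [THEN spec, of "Suc n"]
  show "z \<in> carr (res_bimod (Suc n)) \<Longrightarrow> bar_diff (Suc n) (\<iota> (Suc n) z) = \<iota> n (res_diff f (Suc n) z)"
    by simp
qed

text \<open>
  The bracket with a derivation \<open>g\<close> can be computed on the resolution, with a lifting \<open>S\<close> of \<open>g\<close>:
  \<open>\<iota> S\<close> and \<open>g \<iota>\<close> differ by a bimodule chain map that lifts \<open>0\<close>, hence is null homotopic.
\<close>

lemma gbracket_via_lifting:
  fixes f :: "nat \<Rightarrow> 'k::field kos \<Rightarrow> 'k kos" and g h :: "'k fk list \<Rightarrow> 'k fk"
    and S :: "nat \<Rightarrow> 'k res \<Rightarrow> 'k res"
  assumes f: "fk_resolution f" and \<iota>: "fk_comparison f \<iota>"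
    and g: "fk_derivation (\<lambda>x. g [x])" and h: "hochschild_cocycle n h"
    and S_carr: "\<And>n z. z \<in> carr (res_bimod n) \<Longrightarrow> S n z \<in> carr (res_bimod n)"
    and S_add: "\<And>n y z. y \<in> carr (res_bimod n) \<Longrightarrow> z \<in> carr (res_bimod n) \<Longrightarrow> S n (y + z) = S n y + S n z"
    and S_lact: "\<And>n x z. z \<in> carr (res_bimod n) \<Longrightarrow>
      S n (lact (res_bimod n) x z) = lact (res_bimod n) (g [x]) z + lact (res_bimod n) x (S n z)"
    and S_ract: "\<And>n x z. z \<in> carr (res_bimod n) \<Longrightarrow>
      S n (ract (res_bimod n) z x) = ract (res_bimod n) z (g [x]) + ract (res_bimod n) (S n z) x"
    and S_diff: "\<And>n z. z \<in> carr (res_bimod (Suc n)) \<Longrightarrow> res_diff f (Suc n) (S (Suc n) z) = S n (res_diff f (Suc n) z)"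
    and S_aug: "\<And>z. z \<in> carr (res_bimod 0) \<Longrightarrow> res_aug (S 0 z) = g [res_aug z]"
  shows "hom_coboundary f n (\<lambda>z. bar_hom n (gbracket 1 n g h) (\<iota> n z)
    - (g [bar_hom n h (\<iota> n z)] - bar_hom n h (\<iota> n (S n z))))"
proof -
  let ?g = "\<lambda>x. g [x]"
  interpret R: fk_bimodule res_scale "res_bimod j :: ('k fk, 'k res) bimodule" for j by (rule fk_bimodule_res)
  note d = bimod_hom_res_diff [OF fk_resolution_periodicity [OF f]]
  note lin = linear_fk_derivation [OF g] and \<iota>h = comparison_hom [OF \<iota>]
  have \<iota>c: "\<iota> n z \<in> ten_power (Suc (Suc n))" if "z \<in> carr (res_bimod n)" for n z
    using bimod_hom_carr [OF \<iota>h that] by simp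
  \<comment> \<open>Both composites satisfy the same twisted rule for the actions, so the terms with
    \<open>g [x]\<close> cancel and the difference is a bimodule map.\<close>
  define \<Psi> where "\<Psi> n z = \<iota> n (S n z) - ten_der (Suc (Suc n)) ?g (\<iota> n z)" for n z
  have hom: "bimod_hom (res_bimod n) (bar_bimod n) (\<Psi> n)" for n
    unfolding bimod_hom_def
  proof (intro conjI ballI allI)
    fix y z :: "'k res" and x
    assume z: "z \<in> carr (res_bimod n)"
    note c = z S_carr [OF z] R.lact_carr R.ract_carr \<iota>c ten_der_mem [OF lin]
    show "\<Psi> n z \<in> carr (bar_bimod n)"
      unfolding \<Psi>_def carr_bar by (intro ten_power_diff c)
    show "\<Psi> n (lact (res_bimod n) x z) = lact (bar_bimod n) x (\<Psi> n z)"
      unfolding \<Psi>_def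
      by (simp add: S_lact c bimod_hom_add [OF \<iota>h] bimod_hom_lact [OF \<iota>h] ten_der_lact [OF g]
          linearD_diff [OF linear_ten_lact])
    show "\<Psi> n (ract (res_bimod n) z x) = ract (bar_bimod n) (\<Psi> n z) x"
      unfolding \<Psi>_def
      by (simp add: S_ract c bimod_hom_add [OF \<iota>h] bimod_hom_ract [OF \<iota>h] ten_der_ract [OF g]
          linearD_diff [OF linear_ten_ract])
    show "\<Psi> n (z + y) = \<Psi> n z + \<Psi> n y" if "y \<in> carr (res_bimod n)"
      unfolding \<Psi>_def
      by (simp add: c that S_carr S_add bimod_hom_add [OF \<iota>h] linearD_add [OF linear_ten_der [OF lin]])
  qed
  have chain: "bar_diff (Suc n) (\<Psi> (Suc n) z) = \<Psi> n (res_diff f (Suc n) z)" if z: "z \<in> carr (res_bimod (Suc n))" for n z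
    unfolding \<Psi>_def
    by (simp add: z linearD_diff [OF linear_bar_diff] comparison_chain [OF \<iota>] S_carr S_diff bar_diff_ten_der [OF g] \<iota>c)
  have aug: "bar_aug (\<Psi> 0 z) = 0" if z: "z \<in> carr (res_bimod 0)" for z
    unfolding \<Psi>_def
    by (simp add: z linearD_diff [OF linear_bar_aug] comparison_aug [OF \<iota>] S_carr S_aug bar_aug_ten_der [OF g] \<iota>c)
  have "\<exists>K. (\<forall>n. bimod_hom (res_bimod n) (bar_bimod (Suc n)) (K n)) \<and>
    (\<forall>z\<in>carr (res_bimod 0). \<Psi> 0 z = bar_diff (Suc 0) (K 0 z)) \<and>
    (\<forall>n. \<forall>z\<in>carr (res_bimod (Suc n)).
      \<Psi> (Suc n) z = bar_diff (Suc (Suc n)) (K (Suc n) z) + K n (res_diff f (Suc n) z))"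
    by (rule res_null_homotopic [where aug = bar_aug, OF f fk_bimodule_bar bimod_hom_bar_diff _ _ hom chain aug])
      (simp_all add: bar_diff_exact bar_aug_exact)
  then obtain K where K: "\<And>n. bimod_hom (res_bimod n) (bar_bimod (Suc n)) (K n)"
    "\<And>z. z \<in> carr (res_bimod 0) \<Longrightarrow> \<Psi> 0 z = bar_diff (Suc 0) (K 0 z)"
    "\<And>n z. z \<in> carr (res_bimod (Suc n)) \<Longrightarrow>
      \<Psi> (Suc n) z = bar_diff (Suc (Suc n)) (K (Suc n) z) + K n (res_diff f (Suc n) z)" by blast
  note ml = hochschild_cocycle_multilinear [OF h]
  note linh = linear_bar_hom [OF ml]
  have Kc: "K n z \<in> ten_power (Suc (Suc (Suc n)))" if "z \<in> carr (res_bimod n)" for n z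
    using bimod_hom_carr [OF K(1) that] by simp
  have eq: "bar_hom n (gbracket 1 n g h) (\<iota> n z) - (g [bar_hom n h (\<iota> n z)] - bar_hom n h (\<iota> n (S n z))) =
      bar_hom n h (\<Psi> n z)" if z: "z \<in> carr (res_bimod n)" for z
  proof -
    have "bar_hom n (gbracket 1 n g h) (\<iota> n z) =
        g [bar_hom n h (\<iota> n z)] - bar_hom n h (ten_der (Suc (Suc n)) ?g (\<iota> n z))"
      by (rule bar_hom_gbracket [OF g ml]) (rule \<iota>c [OF z])
    then show ?thesis by (simp add: \<Psi>_def linearD_diff [OF linh])
  qed
  show ?thesis
  proof (rule hom_coboundary_cong [OF eq [symmetric]])
    \<comment> \<open>The cocycle \<open>h\<close> kills the bar boundary in the homotopy formula.
      What remains is the coboundary of \<open>h\<close> composed with \<open>K\<close>; in degree 0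
      nothing remains.\<close>
    show "hom_coboundary f n (\<lambda>z. bar_hom n h (\<Psi> n z))"
    proof (cases n)
      case 0
      then show ?thesis
        using hochschild_cocycle_diff [OF h Kc] by (simp add: hom_coboundary_def K(2))
    next
      case (Suc m)
      have "bar_hom n h (\<Psi> n z) = bar_hom n h (K m (res_diff f (Suc m) z))" if "z \<in> carr (res_bimod (Suc m))" for z
        using hochschild_cocycle_diff [OF h Kc, of z] that
        by (simp add: Suc K(3) linearD_add [OF linh, unfolded Suc])
      then show ?thesis
        unfolding Suc
        by (intro hom_coboundary_Suc [OF bimod_hom_compose [OF K(1) bimod_hom_bar_hom [OF ml, unfolded Suc]]])
          (simp add: Suc)
    qed
  qed
qed

text \<open>Keeps the union in \<open>hh_bracket\<close> from being empty. The cocycle is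
  \<open>\<phi>\<close> after a comparison map \<pi> out of the bar resolution; it returns to the
  class of \<open>\<phi>\<close> because \<pi> after \<open>\<iota>\<close> is homotopic to the
  identity.\<close>

lemma cocycle_on_bar_resolution:
  fixes f :: "nat \<Rightarrow> 'k::field kos \<Rightarrow> 'k kos"
  assumes f: "fk_resolution f" and \<iota>: "fk_comparison f \<iota>" and \<phi>: "hom_cocycle f n \<phi>"
  shows "\<exists>h. hochschild_cocycle n h \<and> bar_hom n h \<circ> \<iota> n \<in> hh_class f n \<phi>"
proof -
  have \<phi>h: "bimod_hom (res_bimod n) fk_bimod \<phi>" and \<phi>0: "\<And>z. z \<in> carr (res_bimod (Suc n)) \<Longrightarrow> \<phi> (res_diff f (Suc n) z) = 0"
    using \<phi> by (simp_all add: hom_cocycle_def)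
  note d = bimod_hom_res_diff [OF fk_resolution_periodicity [OF f]] and \<iota>h = comparison_hom [OF \<iota>]
  from bar_to_resolution [OF f] obtain \<pi> :: "nat \<Rightarrow> 'k ten \<Rightarrow> 'k res" where
    \<pi>: "\<And>n. bimod_hom (bar_bimod n) (res_bimod n) (\<pi> n)"
    and \<pi>aug: "\<And>t. t \<in> ten_power (Suc (Suc 0)) \<Longrightarrow> res_aug (\<pi> 0 t) = bar_aug t"
    and \<pi>d: "\<And>n t. t \<in> ten_power (Suc (Suc (Suc n))) \<Longrightarrow> res_diff f (Suc n) (\<pi> (Suc n) t) = \<pi> n (bar_diff (Suc n) t)"
    by blast
  have \<pi>c: "\<pi> n t \<in> carr (res_bimod n)" if "t \<in> ten_power (Suc (Suc n))" for n t
    using bimod_hom_carr [OF \<pi>] that by simp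
  have \<iota>c: "\<iota> n z \<in> ten_power (Suc (Suc n))" if "z \<in> carr (res_bimod n)" for n z
    using bimod_hom_carr [OF \<iota>h that] by simp
  \<comment> \<open>A lift of 0 from \<open>P\<close> to itself, to which
    \<open>res_null_homotopic\<close> applies with \<open>P\<close> as the exact target.\<close>
  define \<Psi> where "\<Psi> n z = \<pi> n (\<iota> n z) - z" for n z
  have id: "bimod_hom M M (\<lambda>z. z)" for M :: "('k fk, 'k res) bimodule" by (simp add: bimod_hom_def)
  have hom: "bimod_hom (res_bimod n) (res_bimod n) (\<Psi> n)" for n
    unfolding \<Psi>_def [abs_def] by (rule bimod_hom_minus [OF bimod_hom_compose [OF \<iota>h \<pi>] id fk_bimodule_res])
  have chain: "res_diff f (Suc n) (\<Psi> (Suc n) z) = \<Psi> n (res_diff f (Suc n) z)" if z: "z \<in> carr (res_bimod (Suc n))" for n z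
    unfolding \<Psi>_def
    by (subst bimod_hom_diff [OF d fk_bimodule_res fk_bimodule_res])
      (simp_all add: z \<pi>c \<iota>c \<pi>d comparison_chain [OF \<iota>])
  have aug: "res_aug (\<Psi> 0 z) = 0" if z: "z \<in> carr (res_bimod 0)" for z
    unfolding \<Psi>_def
    by (subst bimod_hom_diff [OF bimod_hom_res_aug fk_bimodule_res fk_bimodule_fk])
      (simp_all add: z \<pi>c \<iota>c \<pi>aug comparison_aug [OF \<iota>])
  have "\<exists>K. (\<forall>n. bimod_hom (res_bimod n) (res_bimod (Suc n)) (K n)) \<and>
    (\<forall>z\<in>carr (res_bimod 0). \<Psi> 0 z = res_diff f (Suc 0) (K 0 z)) \<and>
    (\<forall>n. \<forall>z\<in>carr (res_bimod (Suc n)).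
      \<Psi> (Suc n) z = res_diff f (Suc (Suc n)) (K (Suc n) z) + K n (res_diff f (Suc n) z))"
    by (rule res_null_homotopic [where aug = res_aug, OF f fk_bimodule_res d _ _ hom chain aug])
      (use res_diff_exact [OF f] res_aug_exact [OF f] in simp_all)
  then obtain K where K: "\<And>n. bimod_hom (res_bimod n) (res_bimod (Suc n)) (K n)"
    "\<And>z. z \<in> carr (res_bimod 0) \<Longrightarrow> \<Psi> 0 z = res_diff f (Suc 0) (K 0 z)"
    "\<And>n z. z \<in> carr (res_bimod (Suc n)) \<Longrightarrow>
      \<Psi> (Suc n) z = res_diff f (Suc (Suc n)) (K (Suc n) z) + K n (res_diff f (Suc n) z)" by blast
  have cob: "hom_coboundary f n (\<lambda>z. \<phi> (\<Psi> n z))"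
  proof (cases n)
    case 0
    then show ?thesis
      using \<phi>0 bimod_hom_carr [OF K(1)] by (simp add: hom_coboundary_def K(2))
  next
    case (Suc m)
    have "\<phi> (\<Psi> (Suc m) z) = \<phi> (K m (res_diff f (Suc m) z))" if z: "z \<in> carr (res_bimod (Suc m))" for z
    proof -
      have "\<phi> (\<Psi> (Suc m) z) = \<phi> (res_diff f (Suc (Suc m)) (K (Suc m) z)) + \<phi> (K m (res_diff f (Suc m) z))"
        unfolding K(3) [OF z]
        by (rule bimod_hom_add [OF \<phi>h, unfolded Suc])
          (use bimod_hom_carr [OF d] bimod_hom_carr [OF K(1)] z in simp_all)
      also have "\<phi> (res_diff f (Suc (Suc m)) (K (Suc m) z)) = 0"
        using \<phi>0 bimod_hom_carr [OF K(1) z] unfolding Suc by simp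
      finally show ?thesis by simp
    qed
    then show ?thesis
      unfolding Suc by (intro hom_coboundary_Suc [OF bimod_hom_compose [OF K(1) \<phi>h [unfolded Suc]]])
  qed
  \<comment> \<open>A cochain on tensors is recovered from a bimodule map by inserting 1 at both
    ends.\<close>
  define h where "h ys = \<phi> (\<pi> n (tens (1 # ys @ [1])))" for ys
  have h': "bimod_hom (bar_bimod n) fk_bimod (\<lambda>t. \<phi> (\<pi> n t))"
    by (rule bimod_hom_compose [OF \<pi> \<phi>h])
  have ml: "multilinear n fk_scale h"
  proof (rule multilinearI)
    fix xs ys :: "'k fk list" and x y c
    assume "length xs + 1 + length ys = n"
    then have mem: "tens (1 # (xs @ z # ys) @ [1]) \<in> carr (bar_bimod n)" for z
      by (simp add: ten_power_tens)
    show "h (xs @ (x + y) # ys) = h (xs @ x # ys) + h (xs @ y # ys)"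
      using tens_add [of "1 # xs" x y "ys @ [1]"] bimod_hom_add [OF h' mem mem, of x y] by (simp add: h_def)
    show "h (xs @ fk_scale c x # ys) = fk_scale c (h (xs @ x # ys))"
      using tens_scale [of "1 # xs" c x "ys @ [1]"] bimod_hom_scale [OF h' fk_bimodule_bar fk_bimodule_fk mem, of c x]
      by (simp add: h_def)
  qed
  have bh: "bar_hom n h t = \<phi> (\<pi> n t)" if "t \<in> ten_power (Suc (Suc n))" for t
    by (rule bar_hom_eqI [OF bimod_hom_bar_hom [OF ml] h' _ that]) (simp add: bar_hom_tens [OF ml] h_def)
  have D: "bar_diff (Suc n) t \<in> ten_power (Suc (Suc n))" if "t \<in> ten_power (Suc (Suc (Suc n)))" for t :: "'k ten"
    using bar_diff_mem [of t "Suc n"] that by simp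
  have "hochschild_cocycle n h"
    unfolding hochschild_cocycle_def
  proof (intro conjI ml ballI)
    fix t :: "'k ten"
    assume "t \<in> carr (bar_bimod (n + 1))"
    then have t: "t \<in> ten_power (Suc (Suc (Suc n)))" by simp
    have "\<phi> (\<pi> n (bar_diff (Suc n) t)) = 0"
      using \<phi>0 [OF \<pi>c [OF t]] by (simp add: \<pi>d t)
    then show "bar_hom n h (bar_diff (n + 1) t) = 0"
      by (simp add: bh D t)
  qed
  moreover have "bar_hom n h \<circ> \<iota> n \<in> hh_class f n \<phi>"
  proof -
    have "bimod_hom (res_bimod n) fk_bimod (bar_hom n h \<circ> \<iota> n)"
      using bimod_hom_compose [OF \<iota>h bimod_hom_bar_hom [OF ml]] by (simp add: comp_def)
    moreover have "hom_coboundary f n (\<lambda>z. (bar_hom n h \<circ> \<iota> n) z - \<phi> z)"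
    proof (rule hom_coboundary_cong [OF _ cob])
      fix z :: "'k res" assume z: "z \<in> carr (res_bimod n)"
      show "\<phi> (\<Psi> n z) = (bar_hom n h \<circ> \<iota> n) z - \<phi> z"
        unfolding \<Psi>_def
        by (subst bimod_hom_diff [OF \<phi>h fk_bimodule_res fk_bimodule_fk]) (simp_all add: z \<pi>c \<iota>c bh)
    qed
    ultimately show ?thesis by (simp add: hh_class_def)
  qed
  ultimately show ?thesis by blast
qed

section \<open>Cochains prescribed on one free generator\<close>

lemma trilinear_elem: "trilinear fk_scale (\<lambda>y v y'. fk_scale (v (fkd_mon w)) (y * x * y' :: 'k::field fk))"
  unfolding trilinear_def
  by (simp add: distrib_left distrib_right fk.scale_right_distrib fk.scale_left_distrib fk_scale_mult_left
      fk_scale_mult_right mult.commute)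

lemmas linear_elem_lift = linear_kos_lift [OF fk_vs trilinear_elem]

lemma elem_hom_omega:
  "elem_hom i w x (omega j (kos y v y')) = (if i = j then fk_scale (v (fkd_mon w)) (y * x * y' :: 'k::field fk) else 0)"
  by (simp add: elem_hom_def lookup_single when_def kos_lift_kos [OF fk_vs trilinear_elem]
      linearD_zero [OF linear_elem_lift])

lemma elem_hom_omega_other: "i \<noteq> j \<Longrightarrow> elem_hom i w x (omega j t) = 0"
  by (simp add: elem_hom_def lookup_single when_def linearD_zero [OF linear_elem_lift])

lemma elem_hom_add: "elem_hom i w x (z + z') = elem_hom i w x z + elem_hom i w x z'"
  by (simp add: elem_hom_def lookup_add linearD_add [OF linear_elem_lift])

lemma bimod_hom_elem_hom: "bimod_hom (res_bimod n) fk_bimod (elem_hom i w x :: 'k::field res \<Rightarrow> 'k fk)"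
proof -
  define L where "L = kos_lift fk_scale (\<lambda>y v y'. fk_scale (v (fkd_mon w)) (y * x * y'))"
  have L: "L (s + t) = L s + L t" "L (kos y v y') = fk_scale (v (fkd_mon w)) (y * (x * y'))" for s t y v y'
    unfolding L_def
    by (rule linearD_add [OF linear_elem_lift]) (simp only: kos_lift_kos [OF fk_vs trilinear_elem], simp only: mult.assoc)
  have act: "L (lact (kos_bimod 0) a t) = a * L t" "L (ract (kos_bimod 0) t a) = L t * a" for a and t :: "'k kos"
    by (induction t rule: kos_induct)
      (simp_all add: kos_act_simps L distrib_left distrib_right fk_scale_mult_left fk_scale_mult_right mult.assoc)
  have "elem_hom i w x z = L (Poly_Mapping.lookup z i)" for z
    by (simp add: elem_hom_def L_def)
  then show ?thesis
    by (simp add: bimod_hom_def lookup_add L act lookup_res_lact [where k = 0] lookup_res_ract [where k = 0])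
qed

text \<open>The generator \<omega>_i 1|u|1 has degree n + 2i, so sending it to degree s shifts
  degrees by s - n - 2i.\<close>

lemma elem_hom_deg:
  fixes x :: "'k::field fk"
  assumes "x \<in> fk_deg s" "z \<in> res_deg n N" "d = s - int n - 2 * int i"
  shows "elem_hom i w x z \<in> fk_deg (N + d)"
  using assms(2)
proof (induction rule: res_deg_induct)
  case (add y z)
  then show ?case by (simp add: elem_hom_add fk_deg_add)
next
  case (omega j y m y' p q)
  have "p + s + q = N + d" if "i = j" using omega(5) assms(3) that by simp
  then show ?case
    using fk_deg_mult [OF fk_deg_mult [OF omega(3) assms(1)] omega(4)]
    by (auto simp: elem_hom_omega fk_deg_zero intro!: fk_deg_scale)
qed

lemma elem_hom_kos_diff:
  fixes u :: "'k::field fkd \<Rightarrow> 'k"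
  shows "elem_hom i w x (omega i (kos_diff k (kos 1 u 1))) = (\<Sum>l\<in>letters.
    fk_scale ((-1) ^ k * u (fkd_mon [l] * fkd_mon w)) (fk_mon [l] * x)
    + fk_scale (u (fkd_mon w * fkd_mon [l])) (x * fk_mon [l]))"
  by (simp add: elem_hom_def kos_diff_kos linearD_sum [OF linear_elem_lift] linearD_add [OF linear_elem_lift]
      linearD_scale [OF linear_elem_lift] kos_lift_kos [OF fk_vs trilinear_elem])

lemma res_diff_omega:
  fixes f :: "nat \<Rightarrow> 'k::field kos \<Rightarrow> 'k kos"
  assumes f: "periodicity_maps f" and i: "4 * i \<le> n"
  shows "res_diff f n (omega i t) = omega i (kos_diff (n - 4 * i) t)
    + (if i = 0 then 0 else omega (i - 1) (f (n - 4 * i) t))"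
proof (rule poly_mapping_eqI)
  fix j
  have f0: "f k 0 = 0" for k
    by (rule bimod_hom_zero [OF _ fk_bimodule_kos fk_bimodule_kos]) (use f in \<open>auto simp: periodicity_maps_def\<close>)
  show "Poly_Mapping.lookup (res_diff f n (omega i t)) j =
      Poly_Mapping.lookup (omega i (kos_diff (n - 4 * i) t) + (if i = 0 then 0 else omega (i - 1) (f (n - 4 * i) t))) j"
    unfolding lookup_res_diff using i
    by (cases i) (auto simp: lookup_add lookup_single when_def linearD_zero [OF linear_kos_diff] f0)
qed

text \<open>By freeness the cocycle condition is tested on generators, where the differential splits
  into its Koszul part and its \<open>f\<close> part.\<close>

lemma hom_cocycleI:
  fixes f :: "nat \<Rightarrow> 'k::field kos \<Rightarrow> 'k kos"
  assumes f: "periodicity_maps f" and \<phi>: "bimod_hom (res_bimod n) fk_bimod \<phi>"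
    and gen: "\<And>i m. 4 * i \<le> Suc n \<Longrightarrow> m \<in> fkd_basis (Suc n - 4 * i) \<Longrightarrow>
      \<phi> (omega i (kos_diff (Suc n - 4 * i) (kos 1 (dual_mon m) 1))
        + (if i = 0 then 0 else omega (i - 1) (f (Suc n - 4 * i) (kos 1 (dual_mon m) 1)))) = 0"
  shows "hom_cocycle f n \<phi>"
proof -
  have zero: "bimod_hom (res_bimod (Suc n)) fk_bimod (\<lambda>z :: 'k res. 0 :: 'k fk)"
    by (simp add: bimod_hom_def)
  have "\<phi> (res_diff f (Suc n) z) = 0" if "z \<in> carr (res_bimod (Suc n))" for z
    by (rule res_hom_eqI [OF bimod_hom_compose [OF bimod_hom_res_diff [OF f] \<phi>] zero _ that])
      (simp only: res_diff_omega [OF f] gen)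
  then show ?thesis using \<phi> by (simp add: hom_cocycle_def)
qed

section \<open>Cocycles representing \<open>X_class f 8\<close>\<close>

lemma kos_fkd_dual_0:
  fixes u :: "'k::field fkd \<Rightarrow> 'k"
  assumes "u \<in> fkd_dual 0"
  shows "kos x u y = kos_scale (u 1) (kos x (dual_mon []) y)"
  by (subst fkd_dual_expand [OF assms]) (simp add: fkd_basis_def kos_scale_mid)

lemma dual_mon_letter: "dual_mon [l] (fkd_mon [l'] :: 'k::field fkd) = of_bool (l = l')"
proof -
  have "[l] \<in> fkd_basis 1" for l by (cases l) (simp_all add: fkd_basis_def)
  then show ?thesis using dual_mon_basis [of "[l]" 1 "[l']" 1, where 'k = 'k] by simp
qed

lemma letter_generator: "[l] \<in> fkd_basis (Suc 0)"
  by (cases l) (simp_all add: fkd_basis_def)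

lemma basis_1_cases: "m \<in> fkd_basis (Suc 0) \<Longrightarrow> \<exists>l. m = [l]"
  by (auto simp: fkd_basis_def)

lemma X_cocycle_8: "X_cocycle 8 = (\<lambda>z. elem_hom 0 [La] (fk_mon [La]) z + elem_hom 0 [Lb] (fk_mon [Lb]) z
    + elem_hom 0 [Lc] (fk_mon [Lc] :: 'k::field fk) z)"
  by (simp add: X_cocycle_def Let_def)

lemma bimod_hom_X_cocycle_8: "bimod_hom (res_bimod n) fk_bimod (X_cocycle 8 :: 'k::field res \<Rightarrow> 'k fk)"
  unfolding X_cocycle_8 by (intro bimod_hom_plus [OF _ _ fk_bimodule_fk] bimod_hom_elem_hom)

lemma X_cocycle_8_generator: "X_cocycle 8 (omega 0 (kos 1 (dual_mon [l]) 1)) = (fk_mon [l] :: 'k::field fk)"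
  by (cases l) (simp_all add: X_cocycle_8 elem_hom_omega dual_mon_letter)

lemma res_1_eqI:
  fixes \<phi> \<psi> :: "'k::field res \<Rightarrow> 'k fk"
  assumes "bimod_hom (res_bimod (Suc 0)) fk_bimod \<phi>" "bimod_hom (res_bimod (Suc 0)) fk_bimod \<psi>"
    and "\<And>l. \<phi> (omega 0 (kos 1 (dual_mon [l]) 1)) = \<psi> (omega 0 (kos 1 (dual_mon [l]) 1))"
    and "z \<in> carr (res_bimod (Suc 0))"
  shows "\<phi> z = \<psi> z"
proof (rule res_hom_eqI [OF assms(1,2) _ assms(4)])
  fix i m
  assume im: "4 * i \<le> Suc 0" "m \<in> fkd_basis (Suc 0 - 4 * i)"
  then have "i = 0" by simp
  moreover obtain l where "m = [l]" using basis_1_cases im(2) \<open>i = 0\<close> by auto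
  ultimately show "\<phi> (omega i (kos 1 (dual_mon m) 1)) = \<psi> (omega i (kos 1 (dual_mon m) 1))"
    using assms(3) by simp
qed

lemma derivation_on_letters:
  fixes f :: "nat \<Rightarrow> 'k::field kos \<Rightarrow> 'k kos"
  assumes \<iota>: "fk_comparison f \<iota>" and g: "fk_derivation (\<lambda>x. g [x])"
  shows "bar_hom 1 g (\<iota> 1 (omega 0 (kos 1 (dual_mon [l]) 1))) = - g [fk_mon [l]]"
proof -
  have ml: "multilinear (Suc 0) fk_scale g"
    using linear_fk_derivation [OF g] by (simp add: multilinear_1)
  show ?thesis
    using bar_hom_tens [OF ml, of "[fk_mon [l]]" 1 1] linearD_uminus [OF linear_bar_hom [OF ml]]
    by (simp add: comparison_1 [OF \<iota>, simplified])
qed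

text \<open>The parameter serves both signs: \<open>c = 1\<close> shows that minus the Euler
  derivation represents \<open>X_class f 8\<close>, and \<open>c = - 1\<close> computes the class of
  the Euler derivation itself.\<close>

lemma class_of_derivation:
  fixes f :: "nat \<Rightarrow> 'k::field kos \<Rightarrow> 'k kos"
  assumes \<iota>: "fk_comparison f \<iota>" and g: "fk_derivation (\<lambda>x. g [x])"
    and letter: "\<And>l. g [fk_mon [l]] = fk_scale (- c) (fk_mon [l])" and z: "z \<in> carr (res_bimod (Suc 0))"
  shows "bar_hom 1 g (\<iota> 1 z) = fk_scale c (X_cocycle 8 z)"
proof (rule res_1_eqI [OF _ _ _ z])
  have ml: "multilinear (Suc 0) fk_scale g"
    using linear_fk_derivation [OF g] by (simp add: multilinear_1)
  show "bimod_hom (res_bimod (Suc 0)) fk_bimod (\<lambda>z. bar_hom 1 g (\<iota> 1 z))"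
    using bimod_hom_compose [OF comparison_hom [OF \<iota>] bimod_hom_bar_hom [OF ml]] by simp
  show "bimod_hom (res_bimod (Suc 0)) fk_bimod (\<lambda>z. fk_scale c (X_cocycle 8 z))"
    by (rule bimod_hom_scale_hom [OF bimod_hom_X_cocycle_8 fk_bimodule_fk])
  show "bar_hom 1 g (\<iota> 1 (omega 0 (kos 1 (dual_mon [l]) 1))) =
      fk_scale c (X_cocycle 8 (omega 0 (kos 1 (dual_mon [l]) 1)))" for l
    unfolding derivation_on_letters [OF \<iota> g] letter X_cocycle_8_generator by (simp add: fk.scale_minus_left)
qed

lemma X_class_8_representative:
  fixes f :: "nat \<Rightarrow> 'k::field kos \<Rightarrow> 'k kos"
  assumes f: "fk_resolution f" and \<iota>: "fk_comparison f \<iota>"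
    and g: "hochschild_cocycle 1 g" and X: "bar_hom 1 g \<circ> \<iota> 1 \<in> X_class f 8"
  shows "\<exists>e. \<forall>x. g [x] = - euler x + (x * e - e * x)"
proof -
  note der = g [unfolded hochschild_cocycle_1]
  have "hom_coboundary f (Suc 0) (\<lambda>z. bar_hom 1 g (\<iota> 1 z) - X_cocycle 8 z)"
    using X by (simp add: X_class_def hh_class_def X_degree_def)
  then obtain k where k: "bimod_hom (res_bimod 0) fk_bimod k"
    "\<And>z. z \<in> carr (res_bimod (Suc 0)) \<Longrightarrow> bar_hom 1 g (\<iota> 1 z) - X_cocycle 8 z = k (res_diff f (Suc 0) z)"
    by (rule hom_coboundary_SucE) blast
  let ?\<epsilon> = "\<lambda>x y. omega 0 (kos x (dual_mon []) y) :: 'k res"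
  \<comment> \<open>The value on 1|\<epsilon>|1 of the 0-cochain whose coboundary is the discrepancy
    from \<open>X_cocycle 8\<close>; a bimodule map on \<open>P_0\<close> is determined by
    it.\<close>
  define e where "e = k (?\<epsilon> 1 1)"
  have mem: "?\<epsilon> x y \<in> carr (res_bimod 0)" for x y
    by (rule generator_in_carr) (simp_all add: fkd_basis_def)
  interpret fk_bimodule res_scale "res_bimod 0 :: ('k fk, 'k res) bimodule" by (rule fk_bimodule_res)
  have ke: "k (?\<epsilon> x y) = x * e * y" for x y
    unfolding omega_kos_eq_act [of 0 x "dual_mon []" y 0]
    by (simp add: bimod_hom_lact [OF k(1)] bimod_hom_ract [OF k(1)] ract_carr mem e_def mult.assoc)
  have letter: "g [fk_mon [l]] = - euler (fk_mon [l]) + (fk_mon [l] * e - e * fk_mon [l])" for l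
  proof -
    let ?z = "omega 0 (kos 1 (dual_mon [l]) 1) :: 'k res"
    have z: "?z \<in> carr (res_bimod (Suc 0))"
      by (rule generator_in_carr) (simp_all add: letter_generator)
    note u = dual_mon_in_dual [OF letter_generator [of l], where 'k = 'k]
    have "res_diff f (Suc 0) ?z = omega 0 (kos_diff (Suc 0) (kos 1 (dual_mon [l]) 1))"
      using res_diff_omega [OF fk_resolution_periodicity [OF f], of 0 "Suc 0"] by simp
    \<comment> \<open>The sign is (-1)^1. Shifting \<open>dual_mon [l]\<close> by a letter gives a
      functional of degree 0, namely \<epsilon> if the letter is \<open>l\<close> and 0
      otherwise.\<close>
    also have "kos_diff (Suc 0) (kos 1 (dual_mon [l]) 1) =
        kos 1 (dual_mon []) (fk_mon [l]) - kos (fk_mon [l]) (dual_mon []) (1 :: 'k fk)"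
    proof -
      have "kos x (\<lambda>w. dual_mon [l] (fkd_mon [l'] * w)) y = kos_scale (of_bool (l = l')) (kos x (dual_mon []) y)"
        "kos x (\<lambda>w. dual_mon [l] (w * fkd_mon [l'])) y = kos_scale (of_bool (l = l')) (kos x (dual_mon []) y)"
        for x y :: "'k fk" and l'
        using kos_fkd_dual_0 [OF fkd_dual_shift_left [OF u], of x l' y]
          kos_fkd_dual_0 [OF fkd_dual_shift_right [OF u], of x l' y]
        by (simp_all add: dual_mon_letter)
      then show ?thesis
        unfolding kos_diff_kos by (cases l) (simp_all add: letters_def kos.scale_minus_left)
    qed
    also have "omega 0 \<dots> = ?\<epsilon> 1 (fk_mon [l]) - ?\<epsilon> (fk_mon [l]) 1"
      by (simp add: single_diff)
    finally have "k (res_diff f (Suc 0) ?z) = e * fk_mon [l] - fk_mon [l] * e"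
      by (simp add: bimod_hom_diff [OF k(1) fk_bimodule_res fk_bimodule_fk mem mem] ke)
    moreover have "bar_hom 1 g (\<iota> 1 ?z) - X_cocycle 8 ?z = k (res_diff f (Suc 0) ?z)"
      by (rule k(2) [OF z])
    ultimately have eq: "e * fk_mon [l] - fk_mon [l] * e = - g [fk_mon [l]] - fk_mon [l]"
      unfolding derivation_on_letters [OF \<iota> der] X_cocycle_8_generator by simp
    have "g [fk_mon [l]] = - (e * fk_mon [l] - fk_mon [l] * e) - fk_mon [l]"
      unfolding eq by simp
    then show ?thesis by (simp add: euler_mon)
  qed
  have "fk_derivation (\<lambda>x. - euler x + (x * e - e * x))"
    unfolding fk_derivation_def
    by (auto intro!: linearI [OF fk_vs fk_vs] simp: linearD_add [OF linear_euler] linearD_scale [OF linear_euler]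
        fk_derivation_mult [OF fk_derivation_euler] fk_scale_mult_left fk_scale_mult_right
        fk.scale_right_distrib fk.scale_right_diff_distrib algebra_simps)
  from fk_derivation_eqI [OF der this letter] show ?thesis by blast
qed

section \<open>The bracket with \<open>X_class f 8\<close>\<close>

lemma
  fixes z :: "'k::field res"
  assumes z: "z \<in> carr (res_bimod n)"
  shows res_euler_carr: "res_euler n z \<in> carr (res_bimod n)"
    and res_euler_lact: "res_euler n (lact (res_bimod n) x z) =
      lact (res_bimod n) (euler x) z + lact (res_bimod n) x (res_euler n z)"
    and res_euler_ract: "res_euler n (ract (res_bimod n) z x) =
      ract (res_bimod n) z (euler x) + ract (res_bimod n) (res_euler n z) x"
proof -
  interpret fk_bimodule res_scale "res_bimod n :: ('k fk, 'k res) bimodule" by (rule fk_bimodule_res)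
  show c: "res_euler n z \<in> carr (res_bimod n)"
    using res_linear_res_euler [of n, where 'k = 'k] z by (simp add: res_linear_def)
  show "res_euler n (lact (res_bimod n) x z) =
      lact (res_bimod n) (euler x) z + lact (res_bimod n) x (res_euler n z)"
    "res_euler n (ract (res_bimod n) z x) =
      ract (res_bimod n) z (euler x) + ract (res_bimod n) (res_euler n z) x"
    using euler_maps_act [OF euler_maps_res_euler z, of x 1] euler_maps_act [OF euler_maps_res_euler z, of 1 x]
    by (simp_all add: fk_derivation_one [OF fk_derivation_euler] ract_one z c lact_one ract_carr lact_zero_left ract_zero_right lact_zero)
qed

text \<open>Stated for arbitrary representatives \<open>g\<close> and \<open>h\<close>, since the
  bracket is the union over all of them.\<close>

lemma gbracket_class:
  fixes f :: "nat \<Rightarrow> 'k::field kos \<Rightarrow> 'k kos"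
  assumes f: "fk_resolution f" and \<iota>: "fk_comparison f \<iota>" and \<phi>: "hom_cocycle f n \<phi>"
    and deg: "\<And>N z. z \<in> res_deg n N \<Longrightarrow> \<phi> z \<in> fk_deg (N + d)"
    and g: "hochschild_cocycle 1 g" and X: "bar_hom 1 g \<circ> \<iota> 1 \<in> X_class f 8"
    and h: "hochschild_cocycle n h" and h\<phi>: "bar_hom n h \<circ> \<iota> n \<in> hh_class f n \<phi>"
  shows "hh_class f n (bar_hom n (gbracket 1 n g h) \<circ> \<iota> n) = hh_class f n (\<lambda>z. fk_scale (- of_int d) (\<phi> z))"
proof -
  interpret R: fk_bimodule res_scale "res_bimod j :: ('k fk, 'k res) bimodule" for j by (rule fk_bimodule_res)
  note per = fk_resolution_periodicity [OF f]
  note dh = bimod_hom_res_diff [OF per]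
  from X_class_8_representative [OF f \<iota> g X] obtain e where e: "\<And>x. g [x] = - euler x + (x * e - e * x)" by blast
  \<comment> \<open>The commutator with \<open>e\<close> commutes with the differential and the
    augmentation because these are bimodule maps, so \<open>S\<close> is again a lifting of
    \<open>g\<close>.\<close>
  define S where "S n z = - res_euler n z + (ract (res_bimod n) z e - lact (res_bimod n) e z)" for n z
  let ?\<psi> = "\<lambda>z. bar_hom n h (\<iota> n z)"
  have \<psi>h: "bimod_hom (res_bimod n) fk_bimod ?\<psi>"
    by (rule bimod_hom_compose [OF comparison_hom [OF \<iota>] bimod_hom_bar_hom [OF hochschild_cocycle_multilinear [OF h]]])
  have eu: "res_euler j (y + z) = res_euler j y + res_euler j z" for j and y z :: "'k res"
    by (rule linearD_add [OF linear_res_euler])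
  note c = res_euler_carr R.lact_carr R.ract_carr R.diff_carr R.uminus_carr R.add_carr
  note minus = R.lact_uminus_left R.ract_uminus_right R.lact_uminus_right R.ract_uminus_left
    R.lact_diff_left R.ract_diff_right R.lact_diff R.ract_diff
  have cob1: "hom_coboundary f n (\<lambda>z. bar_hom n (gbracket 1 n g h) (\<iota> n z) - (g [?\<psi> z] - ?\<psi> (S n z)))"
  proof (rule gbracket_via_lifting [OF f \<iota> g [unfolded hochschild_cocycle_1] h])
    fix j and y z :: "'k res" and x
    assume z: "z \<in> carr (res_bimod j)"
    show "S j z \<in> carr (res_bimod j)"
      unfolding S_def by (intro c z)
    show "S j (y + z) = S j y + S j z" if "y \<in> carr (res_bimod j)"
      unfolding S_def by (simp add: eu R.lact_add_right R.ract_add_left z that)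
    show "S j (lact (res_bimod j) x z) = lact (res_bimod j) (g [x]) z + lact (res_bimod j) x (S j z)"
      unfolding S_def e
      by (simp add: res_euler_lact z c R.lact_add_right R.lact_add_left minus R.lact_lact R.ract_lact)
    show "S j (ract (res_bimod j) z x) = ract (res_bimod j) z (g [x]) + ract (res_bimod j) (S j z) x"
      unfolding S_def e
      by (simp add: res_euler_ract z c R.ract_add_right R.ract_add_left minus R.ract_ract R.ract_lact)
  next
    fix j and z :: "'k res"
    assume z: "z \<in> carr (res_bimod (Suc j))"
    have "res_diff f (Suc j) (- w) = - res_diff f (Suc j) w" if "w \<in> carr (res_bimod (Suc j))" for w
      using bimod_hom_diff [OF dh fk_bimodule_res fk_bimodule_res R.zero_carr that]
      by (simp add: bimod_hom_zero [OF dh fk_bimodule_res fk_bimodule_res])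
    then show "res_diff f (Suc j) (S (Suc j) z) = S j (res_diff f (Suc j) z)"
      unfolding S_def
      by (simp add: z c bimod_hom_add [OF dh] bimod_hom_diff [OF dh fk_bimodule_res fk_bimodule_res]
          bimod_hom_lact [OF dh] bimod_hom_ract [OF dh] euler_maps_commute [OF per euler_maps_res_euler])
  next
    fix z :: "'k res"
    assume z: "z \<in> carr (res_bimod 0)"
    note ah = bimod_hom_res_aug
    have neg: "res_aug (- w) = - res_aug w" if "w \<in> carr (res_bimod 0)" for w :: "'k res"
      using bimod_hom_diff [OF ah fk_bimodule_res fk_bimodule_fk R.zero_carr that]
      by (simp add: bimod_hom_zero [OF ah fk_bimodule_res fk_bimodule_fk])
    have "res_aug (res_euler 0 z) = euler (res_aug z)"
      using derivation_lifting_euler [OF per euler_maps_res_euler] z by (simp add: derivation_lifting_def)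
    then show "res_aug (S 0 z) = g [res_aug z]"
      unfolding S_def e
      by (simp add: z c neg res_aug_add bimod_hom_diff [OF ah fk_bimodule_res fk_bimodule_fk]
          bimod_hom_lact [OF ah] bimod_hom_ract [OF ah])
  qed
  \<comment> \<open>The inner parts of \<open>g\<close> and \<open>S\<close> cancel because
    \<open>?\<psi>\<close> commutes with both multiplications by \<open>e\<close>.\<close>
  have \<psi>S: "g [?\<psi> z] - ?\<psi> (S n z) = ?\<psi> (res_euler n z) - euler (?\<psi> z)" if z: "z \<in> carr (res_bimod n)" for z
  proof -
    have "?\<psi> (- w) = - ?\<psi> w" if "w \<in> carr (res_bimod n)" for w
      using bimod_hom_diff [OF \<psi>h fk_bimodule_res fk_bimodule_fk R.zero_carr that]
      by (simp add: bimod_hom_zero [OF \<psi>h fk_bimodule_res fk_bimodule_fk])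
    then show ?thesis
      unfolding S_def e
      by (simp add: z c bimod_hom_add [OF \<psi>h] bimod_hom_diff [OF \<psi>h fk_bimodule_res fk_bimodule_fk]
          bimod_hom_lact [OF \<psi>h] bimod_hom_ract [OF \<psi>h])
  qed
  have \<phi>h: "bimod_hom (res_bimod n) fk_bimod \<phi>" using \<phi> by (simp add: hom_cocycle_def)
  have \<phi>R: "\<phi> (res_euler n z) - euler (\<phi> z) = fk_scale (- of_int d) (\<phi> z)" if "z \<in> carr (res_bimod n)" for z
    using that
  proof (induction rule: res_hom_induct)
    case (add y z)
    then show ?case
      by (simp add: eu bimod_hom_add [OF \<phi>h] c linearD_add [OF linear_euler] fk.scale_right_distrib algebra_simps)
  next
    case (hom N z)
    then show ?case
      by (simp add: euler_maps_deg [OF euler_maps_res_euler hom] euler_deg [OF deg [OF hom]]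
          bimod_hom_scale [OF \<phi>h fk_bimodule_res fk_bimodule_fk res_deg_carr [OF hom]]
          fk.scale_left_distrib fk.scale_minus_left)
  qed
  have cob\<psi>: "hom_coboundary f n (\<lambda>z. ?\<psi> z - \<phi> z)"
    using h\<phi> by (simp add: hh_class_def)
  \<comment> \<open>\<open>h\<close> represents \<open>\<phi>\<close> only up to a coboundary k d.
    Since d commutes with the Euler operators, the Euler commutator of k d is that of k followed by
    d, again a coboundary; in degree 0 there is no such correction.\<close>
  have cob2: "hom_coboundary f n (\<lambda>z. (?\<psi> (res_euler n z) - euler (?\<psi> z)) - fk_scale (- of_int d) (\<phi> z))"
  proof (cases n)
    case 0
    then have "?\<psi> z = \<phi> z" if "z \<in> carr (res_bimod n)" for z
      using cob\<psi> that by (simp add: hom_coboundary_def)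
    then show ?thesis
      by (intro hom_coboundary_cong [OF _ hom_coboundary_zero]) (simp add: c \<phi>R)
  next
    case (Suc m)
    from cob\<psi> [unfolded Suc] obtain k where k: "bimod_hom (res_bimod m) fk_bimod k"
      "\<And>z. z \<in> carr (res_bimod (Suc m)) \<Longrightarrow> bar_hom (Suc m) h (\<iota> (Suc m) z) - \<phi> z = k (res_diff f (Suc m) z)"
      by (rule hom_coboundary_SucE) blast
    \<comment> \<open>The Leibniz terms with \<open>euler x\<close> cancel, so the commutator of
      \<open>k\<close> with the Euler operators is a bimodule map.\<close>
    have "bimod_hom (res_bimod m) fk_bimod (\<lambda>z. k (res_euler m z) - euler (k z))"
      unfolding bimod_hom_def
    proof (intro conjI ballI allI)
      fix y z :: "'k res" and x :: "'k fk"
      assume z: "z \<in> carr (res_bimod m)"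
      show "k (res_euler m (z + y)) - euler (k (z + y)) = k (res_euler m z) - euler (k z) + (k (res_euler m y) - euler (k y))"
        if "y \<in> carr (res_bimod m)"
        by (simp add: eu z that c bimod_hom_add [OF k(1)] linearD_add [OF linear_euler])
      show "k (res_euler m (lact (res_bimod m) x z)) - euler (k (lact (res_bimod m) x z)) =
          lact fk_bimod x (k (res_euler m z) - euler (k z))"
        by (simp add: z c res_euler_lact bimod_hom_add [OF k(1)] bimod_hom_lact [OF k(1)]
            fk_derivation_mult [OF fk_derivation_euler] algebra_simps)
      show "k (res_euler m (ract (res_bimod m) z x)) - euler (k (ract (res_bimod m) z x)) =
          ract fk_bimod (k (res_euler m z) - euler (k z)) x"
        by (simp add: z c res_euler_ract bimod_hom_add [OF k(1)] bimod_hom_ract [OF k(1)]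
            fk_derivation_mult [OF fk_derivation_euler] algebra_simps)
    qed simp
    then show ?thesis
      unfolding Suc
    proof (rule hom_coboundary_Suc)
      fix z :: "'k res"
      assume z: "z \<in> carr (res_bimod (Suc m))"
      have \<psi>: "bar_hom (Suc m) h (\<iota> (Suc m) z) = \<phi> z + k (res_diff f (Suc m) z)"
        if "z \<in> carr (res_bimod (Suc m))" for z
        using k(2) [OF that] by (simp add: algebra_simps)
      show "bar_hom (Suc m) h (\<iota> (Suc m) (res_euler (Suc m) z)) - euler (bar_hom (Suc m) h (\<iota> (Suc m) z))
          - fk_scale (- of_int d) (\<phi> z) =
        k (res_euler m (res_diff f (Suc m) z)) - euler (k (res_diff f (Suc m) z))"
        unfolding \<psi> [OF z] \<psi> [OF res_euler_carr [OF z]] euler_maps_commute [OF per euler_maps_res_euler z]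
          \<phi>R [unfolded Suc, OF z, symmetric] linearD_add [OF linear_euler]
        by simp
    qed
  qed
  show ?thesis
  proof (rule hh_class_eqI, rule hom_coboundary_cong [OF _ hom_coboundary_add [OF cob1 cob2]])
    fix z :: "'k res" assume "z \<in> carr (res_bimod n)"
    then show "bar_hom n (gbracket 1 n g h) (\<iota> n z) - (g [?\<psi> z] - ?\<psi> (S n z))
        + (?\<psi> (res_euler n z) - euler (?\<psi> z) - fk_scale (- of_int d) (\<phi> z)) =
        (bar_hom n (gbracket 1 n g h) \<circ> \<iota> n) z - fk_scale (- of_int d) (\<phi> z)"
      by (simp add: \<psi>S)
  qed
qed

text \<open>Every representing pair yields the same class by \<open>gbracket_class\<close>, and at
  least one pair exists, so the union is exactly this class.\<close>

lemma hh_bracket_X_class_8: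
  fixes f :: "nat \<Rightarrow> 'k::field kos \<Rightarrow> 'k kos"
  assumes f: "fk_resolution f" and \<iota>: "fk_comparison f \<iota>" and \<phi>: "hom_cocycle f n \<phi>"
    and deg: "\<And>N z. z \<in> res_deg n N \<Longrightarrow> \<phi> z \<in> fk_deg (N + d)"
  shows "hh_bracket f \<iota> 1 n (X_class f 8) (hh_class f n \<phi>) = hh_scale f n (- of_int d) (hh_class f n \<phi>)"
proof -
  let ?g = "\<lambda>xs :: 'k fk list. - euler (hd xs)"
  have "fk_derivation (\<lambda>x :: 'k fk. - euler x)"
    unfolding fk_derivation_def
    by (auto intro!: linearI [OF fk_vs fk_vs] simp: linearD_add [OF linear_euler] linearD_scale [OF linear_euler]
        fk_derivation_mult [OF fk_derivation_euler] fk.scale_minus_right)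
  then have der: "fk_derivation (\<lambda>x. ?g [x])" by simp
  then have g: "hochschild_cocycle 1 ?g" by (simp only: hochschild_cocycle_1)
  have "bar_hom 1 ?g \<circ> \<iota> 1 \<in> X_class f 8"
  proof -
    have eq: "bar_hom 1 ?g (\<iota> 1 z) = X_cocycle 8 z" if "z \<in> carr (res_bimod (Suc 0))" for z
      using class_of_derivation [OF \<iota> der _ that, of 1] by (simp add: euler_mon fk.scale_minus_left)
    have "bimod_hom (res_bimod 1) fk_bimod (bar_hom 1 ?g \<circ> \<iota> 1)"
      using bimod_hom_compose [OF comparison_hom [OF \<iota>] bimod_hom_bar_hom [OF hochschild_cocycle_multilinear [OF g]]]
      by (simp add: comp_def)
    moreover have "hom_coboundary f 1 (\<lambda>z. (bar_hom 1 ?g \<circ> \<iota> 1) z - X_cocycle 8 z)"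
      by (rule hom_coboundary_cong [OF _ hom_coboundary_zero]) (simp add: eq [simplified])
    ultimately show ?thesis by (simp add: X_class_def hh_class_def X_degree_def)
  qed
  moreover obtain h where "hochschild_cocycle n h" "bar_hom n h \<circ> \<iota> n \<in> hh_class f n \<phi>"
    using cocycle_on_bar_resolution [OF f \<iota> \<phi>] by blast
  ultimately have ex: "\<exists>g h. hochschild_cocycle 1 g \<and> hochschild_cocycle n h \<and>
      bar_hom 1 g \<circ> \<iota> 1 \<in> X_class f 8 \<and> bar_hom n h \<circ> \<iota> n \<in> hh_class f n \<phi>"
    using g by blast
  have \<phi>h: "bimod_hom (res_bimod n) fk_bimod \<phi>" using \<phi> by (simp add: hom_cocycle_def)
  have "hh_bracket f \<iota> 1 n (X_class f 8) (hh_class f n \<phi>) = hh_class f n (\<lambda>z. fk_scale (- of_int d) (\<phi> z))"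
    unfolding hh_bracket_def add_diff_cancel_left'
    using gbracket_class [OF f \<iota> \<phi> deg] ex by blast
  then show ?thesis by (simp only: hh_scale_class [OF \<phi>h])
qed

section \<open>The classes \<open>X\<^sub>1, \<dots>, X\<^sub>1\<^sub>4\<close>\<close>

text \<open>In degree n + 1 at most 3 the resolution consists of the Koszul bimodule alone, so its
  differential is the Koszul differential.\<close>

lemma hom_cocycle_low:
  fixes f :: "nat \<Rightarrow> 'k::field kos \<Rightarrow> 'k kos"
  assumes f: "periodicity_maps f" and n: "n \<le> 2" and \<phi>: "bimod_hom (res_bimod n) fk_bimod \<phi>"
    and gen: "\<And>u. \<phi> (omega 0 (kos_diff (Suc n) (kos 1 u 1))) = 0"
  shows "hom_cocycle f n \<phi>"
proof (rule hom_cocycleI [OF f \<phi>])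
  fix i m
  assume "4 * i \<le> Suc n"
  then have "i = 0" using n by simp
  then show "\<phi> (omega i (kos_diff (Suc n - 4 * i) (kos 1 (dual_mon m) 1))
      + (if i = 0 then 0 else omega (i - 1) (f (Suc n - 4 * i) (kos 1 (dual_mon m) 1)))) = 0"
    using gen by simp
qed

lemma fkd_mon_Cons2: "fkd_mon (x # y # w) = fkd_mon [x] * fkd_mon (y # w)"
  by (simp flip: fkd_mon_append)

lemma fkd_mon_ACC_assoc: "fkd_mon [La] * (fkd_mon [Lc] * (fkd_mon [Lc] * z)) = fkd_mon [La] * (fkd_mon [Lb] * (fkd_mon [Lb] * z))"
  using arg_cong [OF fkd_mon_ACC, of "\<lambda>x. x * z"] by (simp only: mult.assoc)

lemmas cocycle_simps = elem_hom_kos_diff letters_def fkd_mon_Cons2 fkd_simps fkd_mon_ACC_assoc fk_mon_rels fk_mon_rels_assoc fk_mon_BAB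
  fk_mon_BAB_assoc distrib_left distrib_right left_diff_distrib right_diff_distrib fk.scale_right_distrib
  fk.scale_right_diff_distrib fk.scale_minus_left fk.scale_minus_right

lemmas bimod_hom_intros = bimod_hom_plus [OF _ _ fk_bimodule_fk] bimod_hom_elem_hom

lemma fk_deg_monomials:
  "fk_mon [x] \<in> fk_deg 1" "fk_mon [x] * fk_mon [y] \<in> fk_deg 2" "fk_mon [x] * fk_mon [y] * fk_mon [z] \<in> fk_deg 3"
  "fk_mon [x] * fk_mon [y] * fk_mon [z] * fk_mon [w] \<in> fk_deg 4"
  using fk_deg_mon [of "[x]"] fk_deg_mon [of "[x, y]"] fk_deg_mon [of "[x, y, z]"] fk_deg_mon [of "[x, y, z, w]"]
  by (simp_all flip: fk_mon_append)

lemma X_cocycle_simps: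
  fixes a b c :: "'k::field fk"
  defines "a \<equiv> fk_mon [La]" and "b \<equiv> fk_mon [Lb]" and "c \<equiv> fk_mon [Lc]"
  shows "X_cocycle 1 = elem_hom 0 [] (a * b + b * a)"
    and "X_cocycle 2 = elem_hom 0 [] (a * b + b * c - a * c)"
    and "X_cocycle 3 = elem_hom 0 [] (a * b * a * c)"
    and "X_cocycle 4 = elem_hom 0 [La] (b * a * c)"
    and "X_cocycle 5 = elem_hom 0 [Lb] (a * b * c)"
    and "X_cocycle 6 = elem_hom 0 [Lc] (a * b * a)"
    and "X_cocycle 7 = elem_hom 0 [La] (a * b * a - a * b * c)"
    and "X_cocycle 9 = elem_hom 0 [La, La] (1 :: 'k fk)"
    and "X_cocycle 10 = elem_hom 0 [Lb, Lb] (1 :: 'k fk)"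
    and "X_cocycle 11 = elem_hom 0 [Lc, Lc] (1 :: 'k fk)"
    and "X_cocycle 12 = (\<lambda>z. elem_hom 0 [La, Lb] 1 z + elem_hom 0 [La, Lc] (1 :: 'k fk) z)"
    and "X_cocycle 13 = (\<lambda>z. elem_hom 0 [La, La, La] a z + elem_hom 0 [Lb, Lb, Lb] b z + elem_hom 0 [Lc, Lc, Lc] c z)"
    and "X_cocycle 14 = elem_hom 1 [] (1 :: 'k fk)"
  unfolding a_def b_def c_def X_cocycle_def Let_def
  by (simp_all add: eval_nat_numeral)

text \<open>On each boundary the cochain is a combination of values of \<open>u\<close> with
  coefficients in \<open>FK(3)\<close>. Once the arguments of \<open>u\<close> and the coefficients
  are in normal form, everything cancels, for every function \<open>u\<close>.\<close>

lemma X_cocycle_low: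
  fixes f :: "nat \<Rightarrow> 'k::field kos \<Rightarrow> 'k kos"
  assumes f: "periodicity_maps f" and j: "j \<in> {1, 2, 3, 4, 5, 6, 7, 8, 9, 10, 11, 12}"
  shows "hom_cocycle f (X_degree j) (X_cocycle j)"
  using j
  by (elim insertE emptyE; hypsubst; intro hom_cocycle_low [OF f]; simp only: X_cocycle_simps X_cocycle_8)
    (simp_all add: X_degree_def bimod_hom_intros cocycle_simps)

text \<open>Here the prescribed value of \<open>f 0\<close> matters: in degree 4 the generator of
  \<omega>_1 \<open>K_0\<close> is sent to it in \<open>K_3\<close>. On \<open>AAA\<close>,
  \<open>BBB\<close>, \<open>CCC\<close> the functionals \<open>p\<close>, \<open>q\<close>,
  \<open>r\<close> take the value -2 at their own cube and 0 at the other two, which leaves a sum of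
  degree 4 in \<open>FK(3)\<close> that cancels.\<close>

lemma X_cocycle_13_f0: "X_cocycle 13 (omega 0 f0_value) = (0 :: 'k::field fk)"
proof -
  have basis: "{[La, La, La], [Lb, Lb, Lb], [Lc, Lc, Lc], [La, La, Lb], [La, La, Lc], [La, Lb, Lb]} \<subseteq> fkd_basis 3"
    by (simp add: fkd_basis_def eval_nat_numeral)
  have dual: "dual_mon m (fkd_mon m' :: 'k fkd) = of_bool (m = m')"
    if "m \<in> fkd_basis 3" "m' \<in> fkd_basis 3" for m m'
    using dual_mon_basis [OF that, where 'k = 'k] .
  have diff: "elem_hom i w x (z - z') = elem_hom i w x z - elem_hom i w x z'" for i w and x :: "'k fk" and z z'
    using elem_hom_add [of i w x "z - z'" z'] by simp
  have uminus: "elem_hom i w x (- z) = - elem_hom i w x z" for i w and x :: "'k fk" and z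
    using diff [of i w x 0 z] diff [of i w x 0 0] by simp
  show ?thesis
    using basis
    by (simp add: X_cocycle_simps f0_value_def Let_def single_add single_diff single_uminus elem_hom_add diff uminus
        elem_hom_omega dual)
      (simp add: fk_simps fk.scale_minus_left)
qed

lemma X_cocycle_13:
  fixes f :: "nat \<Rightarrow> 'k::field kos \<Rightarrow> 'k kos"
  assumes f: "fk_resolution f"
  shows "hom_cocycle f 3 (X_cocycle 13)"
proof (rule hom_cocycleI [OF fk_resolution_periodicity [OF f]])
  show "bimod_hom (res_bimod 3) fk_bimod (X_cocycle 13 :: 'k res \<Rightarrow> 'k fk)"
    unfolding X_cocycle_simps by (intro bimod_hom_intros)
  fix i m
  assume i: "4 * i \<le> Suc 3" and m: "m \<in> fkd_basis (Suc 3 - 4 * i)"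
  show "X_cocycle 13 (omega i (kos_diff (Suc 3 - 4 * i) (kos 1 (dual_mon m) 1))
      + (if i = 0 then 0 else omega (i - 1) (f (Suc 3 - 4 * i) (kos 1 (dual_mon m) 1)))) = (0 :: 'k fk)"
  proof (cases "i = 0")
    case True
    then show ?thesis by (simp add: X_cocycle_simps cocycle_simps)
  next
    case False
    then have i: "i = 1" using i by simp
    then have m: "m = []" using m by (simp add: fkd_basis_def)
    show ?thesis
      using X_cocycle_13_f0 fk_resolution_f0 [OF f]
      by (simp add: i m X_cocycle_simps elem_hom_add elem_hom_omega_other)
  qed
qed

text \<open>The cochain sees only the summand of \<omega>_1. The map \<open>f\<close> out of it
  lands in the summand of \<omega>_0, and the Koszul differential on \<open>K_1\<close> contributes
  -x + x for each letter x.\<close>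

lemma X_cocycle_14:
  fixes f :: "nat \<Rightarrow> 'k::field kos \<Rightarrow> 'k kos"
  assumes f: "periodicity_maps f"
  shows "hom_cocycle f 4 (X_cocycle 14)"
proof (rule hom_cocycleI [OF f])
  show "bimod_hom (res_bimod 4) fk_bimod (X_cocycle 14 :: 'k res \<Rightarrow> 'k fk)"
    unfolding X_cocycle_simps by (intro bimod_hom_intros)
  fix i m
  assume i: "4 * i \<le> Suc 4"
  show "X_cocycle 14 (omega i (kos_diff (Suc 4 - 4 * i) (kos 1 (dual_mon m) 1))
      + (if i = 0 then 0 else omega (i - 1) (f (Suc 4 - 4 * i) (kos 1 (dual_mon m) 1)))) = (0 :: 'k fk)"
  proof (cases "i = 0")
    case True
    then show ?thesis by (simp add: X_cocycle_simps elem_hom_omega_other)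
  next
    case False
    then have i: "i = 1" using i by simp
    show ?thesis
      by (simp add: i X_cocycle_simps elem_hom_add elem_hom_omega_other)
        (simp add: cocycle_simps)
  qed
qed

section \<open>Internal degrees of the fourteen classes\<close>

lemma X_class_bracket:
  fixes f :: "nat \<Rightarrow> 'k::field kos \<Rightarrow> 'k kos"
  assumes f: "fk_resolution f" and \<iota>: "fk_comparison f \<iota>" and X: "hom_cocycle f (X_degree j) (X_cocycle j)"
    and deg: "\<And>N (z :: 'k res). z \<in> res_deg (X_degree j) N \<Longrightarrow> X_cocycle j z \<in> fk_deg (N + d)"
  shows "hh_bracket f \<iota> 1 (X_degree j) (X_class f 8) (X_class f j) =
    hh_scale f (X_degree j) (- of_int d) (X_class f j)"
  using hh_bracket_X_class_8 [OF f \<iota> X deg] by (simp add: X_class_def)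


lemma fk_deg_X_values:
  fixes a b c :: "'k::field fk"
  defines "a \<equiv> fk_mon [La]" and "b \<equiv> fk_mon [Lb]" and "c \<equiv> fk_mon [Lc]"
  shows "a * b + b * a \<in> fk_deg 2" "a * b + b * c - a * c \<in> fk_deg 2" "a * b * a * c \<in> fk_deg 4"
    "b * a * c \<in> fk_deg 3" "a * b * c \<in> fk_deg 3" "a * b * a \<in> fk_deg 3" "a * b * a - a * b * c \<in> fk_deg 3"
  unfolding a_def b_def c_def by (intro fk_deg_add fk_deg_diff fk_deg_monomials)+

text \<open>The integers are the shifts s - n - 2i of \<open>elem_hom_deg\<close>: 2 and 4 in
  cohomological degree 0, then 3 - 1 and 1 - 1 in degree 1, 0 - 2 and 1 - 3 in degrees 2 and 3, and
  0 - 4 - 2 for the class on \<omega>_1. They keep the form \<open>- of_int d\<close> so as to match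
  \<open>X_class_bracket\<close>.\<close>

lemma X_class_bracket_values:
  fixes f :: "nat \<Rightarrow> 'k::field kos \<Rightarrow> 'k kos"
  assumes f: "fk_resolution f" and \<iota>: "fk_comparison f \<iota>"
  shows "j \<in> {1, 2, 4, 5, 6, 7} \<Longrightarrow>
      hh_bracket f \<iota> 1 (X_degree j) (X_class f 8) (X_class f j) = hh_scale f (X_degree j) (- of_int 2) (X_class f j)"
    and "hh_bracket f \<iota> 1 (X_degree 3) (X_class f 8) (X_class f 3) = hh_scale f (X_degree 3) (- of_int 4) (X_class f 3)"
    and "hh_bracket f \<iota> 1 (X_degree 8) (X_class f 8) (X_class f 8) = hh_scale f (X_degree 8) (- of_int 0) (X_class f 8)"
    and "j \<in> {9, 10, 11, 12, 13} \<Longrightarrow>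
      hh_bracket f \<iota> 1 (X_degree j) (X_class f 8) (X_class f j) = hh_scale f (X_degree j) (- of_int (- 2)) (X_class f j)"
    and "hh_bracket f \<iota> 1 (X_degree 14) (X_class f 8) (X_class f 14) = hh_scale f (X_degree 14) (- of_int (- 6)) (X_class f 14)"
proof -
  note per = fk_resolution_periodicity [OF f]
  note low = X_class_bracket [OF f \<iota> X_cocycle_low [OF per]]
  have deg: "X_degree 13 = 3" "X_degree 14 = 4" by (simp_all add: X_degree_def)
  note high = X_class_bracket [OF f \<iota> X_cocycle_13 [OF f, folded deg(1)]]
    X_class_bracket [OF f \<iota> X_cocycle_14 [OF per, folded deg(2)]]
  note vals = elem_hom_deg [OF fk_deg_X_values(1)] elem_hom_deg [OF fk_deg_X_values(2)] elem_hom_deg [OF fk_deg_X_values(3)]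
    elem_hom_deg [OF fk_deg_X_values(4)] elem_hom_deg [OF fk_deg_X_values(5)] elem_hom_deg [OF fk_deg_X_values(6)]
    elem_hom_deg [OF fk_deg_X_values(7)] elem_hom_deg [OF fk_deg_one] elem_hom_deg [OF fk_deg_monomials(1)]
  show "hh_bracket f \<iota> 1 (X_degree j) (X_class f 8) (X_class f j) = hh_scale f (X_degree j) (- of_int 2) (X_class f j)"
    if j: "j \<in> {1, 2, 4, 5, 6, 7}"
  proof (rule low)
    show "X_cocycle j z \<in> fk_deg (N + 2)" if "z \<in> res_deg (X_degree j) N" for N and z :: "'k res"
      using j that
      by (elim insertE emptyE; hypsubst)
        (simp_all only: X_cocycle_simps, (erule vals; simp add: X_degree_def)+)
  qed (use j in blast)
  show "hh_bracket f \<iota> 1 (X_degree 3) (X_class f 8) (X_class f 3) = hh_scale f (X_degree 3) (- of_int 4) (X_class f 3)"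
    by (rule low, simp, simp only: X_cocycle_simps, erule vals; simp add: X_degree_def)
  show "hh_bracket f \<iota> 1 (X_degree 8) (X_class f 8) (X_class f 8) = hh_scale f (X_degree 8) (- of_int 0) (X_class f 8)"
    by (rule low, simp, simp only: X_cocycle_8, intro fk_deg_add; erule vals; simp add: X_degree_def)
  show "hh_bracket f \<iota> 1 (X_degree 14) (X_class f 8) (X_class f 14) = hh_scale f (X_degree 14) (- of_int (- 6)) (X_class f 14)"
    by (rule high, simp only: X_cocycle_simps, erule vals; simp add: X_degree_def)
  show "hh_bracket f \<iota> 1 (X_degree j) (X_class f 8) (X_class f j) = hh_scale f (X_degree j) (- of_int (- 2)) (X_class f j)"
    if "j \<in> {9, 10, 11, 12, 13}"
  proof (cases "j = 13")
    case True
    show ?thesis unfolding True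
      by (rule high, simp only: X_cocycle_simps, intro fk_deg_add; erule vals; simp add: X_degree_def)
  next
    case False
    then have j: "j \<in> {9, 10, 11, 12}" using that by blast
    show ?thesis
    proof (rule low)
      show "X_cocycle j z \<in> fk_deg (N + - 2)" if "z \<in> res_deg (X_degree j) N" for N and z :: "'k res"
        using j that
        by (elim insertE emptyE; hypsubst)
          (simp_all only: X_cocycle_simps, (rule fk_deg_add | (erule vals; simp add: X_degree_def))+)
    qed (use j in blast)
  qed
qed

theorem proposition4p5:
  fixes f :: "nat \<Rightarrow> 'k::field kos \<Rightarrow> 'k kos"
    and \<iota> :: "nat \<Rightarrow> 'k res \<Rightarrow> 'k ten"
  assumes char: "CHAR('k) \<noteq> 2" "CHAR('k) \<noteq> 3"
    and resolution: "fk_resolution f"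
    and comparison: "fk_comparison f \<iota>"
  shows
    "(\<exists>!\<rho> :: 'k fk \<Rightarrow> 'k fk. euler_derivation \<rho>)
     \<and> (\<exists>R :: nat \<Rightarrow> 'k res \<Rightarrow> 'k res. euler_maps R)
     \<and> (\<forall>\<rho> R. euler_derivation \<rho> \<longrightarrow> euler_maps R \<longrightarrow> derivation_lifting f \<rho> R)
     \<and> (\<forall>\<rho>. euler_derivation \<rho> \<longrightarrow>
          hh_class f 1 (bar_hom 1 (\<lambda>xs. \<rho> (hd xs)) \<circ> \<iota> 1) = hh_scale f 1 (-1) (X_class f 8))
     \<and> (\<forall>n d. \<forall>\<xi>\<in>HH f n. hh_homogeneous f n d \<xi> \<longrightarrow>
          hh_bracket f \<iota> 1 n (X_class f 8) \<xi> = hh_scale f n (- of_int d) \<xi>)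
     \<and> (\<forall>j\<in>{1..7} - {3}.
          hh_bracket f \<iota> 1 (X_degree j) (X_class f 8) (X_class f j)
            = hh_scale f (X_degree j) (-2) (X_class f j))
     \<and> hh_bracket f \<iota> 1 0 (X_class f 8) (X_class f 3) = hh_scale f 0 (-4) (X_class f 3)
     \<and> hh_bracket f \<iota> 1 1 (X_class f 8) (X_class f 8) = hh_scale f 1 0 (X_class f 8)
     \<and> (\<forall>j\<in>{9..13}.
          hh_bracket f \<iota> 1 (X_degree j) (X_class f 8) (X_class f j)
            = hh_scale f (X_degree j) 2 (X_class f j))
     \<and> hh_bracket f \<iota> 1 4 (X_class f 8) (X_class f 14) = hh_scale f 4 6 (X_class f 14)"
proof (intro conjI allI impI ballI)
  note vals = X_class_bracket_values [OF resolution comparison]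
  show "\<exists>!\<rho> :: 'k fk \<Rightarrow> 'k fk. euler_derivation \<rho>"
    by (simp add: euler_derivation_iff)
  show "\<exists>R :: nat \<Rightarrow> 'k res \<Rightarrow> 'k res. euler_maps R"
    using euler_maps_res_euler by blast
  show "derivation_lifting f \<rho> R" if "euler_derivation \<rho>" "euler_maps R" for \<rho> R
    using derivation_lifting_euler [OF fk_resolution_periodicity [OF resolution] that(2)] that(1)
    by (simp add: euler_derivation_iff)
  show "hh_class f 1 (bar_hom 1 (\<lambda>xs. \<rho> (hd xs)) \<circ> \<iota> 1) = hh_scale f 1 (-1) (X_class f 8)"
    if "euler_derivation \<rho>" for \<rho>
  proof -
    let ?g = "\<lambda>xs :: 'k fk list. euler (hd xs)"
    have "fk_derivation (\<lambda>x :: 'k fk. ?g [x])"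
      using fk_derivation_euler by simp
    \<comment> \<open>The Euler derivation fixes the letters, and \<open>class_of_derivation\<close>
      counts with the opposite sign, hence the parameter -1.\<close>
    from class_of_derivation [OF comparison this, of "- 1"]
    have "hh_class f 1 (bar_hom 1 ?g \<circ> \<iota> 1) = hh_class f 1 (\<lambda>z. fk_scale (- 1) (X_cocycle 8 z))"
      by (intro hh_class_cong) (simp add: euler_mon)
    also have "\<dots> = hh_scale f 1 (- 1) (X_class f 8)"
      by (simp add: hh_scale_class [OF bimod_hom_X_cocycle_8] X_class_def X_degree_def)
    finally show ?thesis using that by (simp add: euler_derivation_iff)
  qed
  show "hh_bracket f \<iota> 1 n (X_class f 8) \<xi> = hh_scale f n (- of_int d) \<xi>"
    if "hh_homogeneous f n d \<xi>" for n d \<xi>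
    using that hh_bracket_X_class_8 [OF resolution comparison] unfolding hh_homogeneous_def by blast
  show "hh_bracket f \<iota> 1 (X_degree j) (X_class f 8) (X_class f j) = hh_scale f (X_degree j) (-2) (X_class f j)"
    if "j \<in> {1..7} - {3}" for j
  proof -
    have "{1..7} - {3} = {1, 2, 4, 5, 6, 7 :: nat}" by code_simp
    then show ?thesis using vals(1) [of j] that by simp
  qed
  show "hh_bracket f \<iota> 1 (X_degree j) (X_class f 8) (X_class f j) = hh_scale f (X_degree j) 2 (X_class f j)"
    if "j \<in> {9..13}" for j
  proof -
    have "{9..13} = {9, 10, 11, 12, 13 :: nat}" by code_simp
    then show ?thesis using vals(4) [of j] that by simp
  qed
  show "hh_bracket f \<iota> 1 0 (X_class f 8) (X_class f 3) = hh_scale f 0 (-4) (X_class f 3)"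
    "hh_bracket f \<iota> 1 1 (X_class f 8) (X_class f 8) = hh_scale f 1 0 (X_class f 8)"
    "hh_bracket f \<iota> 1 4 (X_class f 8) (X_class f 14) = hh_scale f 4 6 (X_class f 14)"
    using vals(2,3,5) by (simp_all add: X_degree_def)
qed

end
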